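(* Let $M_1,\dots,M_k$ be uniform matroids, each of rank $r$, with finite universes $U_1,\dots,U_k\subseteq\mathbb{N}$. Given a set $R\subseteq U_1\times\dots\times U_k$, one can compute a set $R'\subseteq R$ with $|R'|\le r^k$ that $k$-$(r-1)$-represents $R$, in time $O(|R|\cdot r^{k(\omega-1)}\cdot k)$, where $\omega$ is the matrix multiplication exponent.
   Context: The uniform matroid of rank $r$ on a finite universe $U$ is the matroid whose independent sets are all subsets of $U$ of size at most $r$. For positive integers $k,q$, an element $a\in\mathbb{N}^k$ is $k$-$q$-compatible with $b\in\binom{\mathbb{N}}{q}^k$ (a $k$-tuple of $q$-element subsets of $\mathbb{N}$) if $a[i]\notin b[i]$ for all $i\in[k]$. For $R'\subseteq R\subseteq\mathbb{N}^k$, we say $R'$ $k$-$q$-represents $R$ if for every $b\in\binom{\mathbb{N}}{q}^k$: there exists $a\in R$ that is $k$-$q$-compatible with $b$ if and only if there exists $a'\in R'$ that is $k$-$q$-compatible with $b$. *)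

theory Defs
  imports Complex_Main "Jordan_Normal_Form.Matrix"
begin

section \<open>Uniform matroids\<close>

record matroid =
  universe :: "nat set"
  indep :: "nat set set"

definition is_matroid :: "matroid \<Rightarrow> bool" where
  "is_matroid M \<longleftrightarrow>
     finite (universe M) \<and> indep M \<subseteq> Pow (universe M) \<and> {} \<in> indep M \<and>
     (\<forall>I J. J \<in> indep M \<and> I \<subseteq> J \<longrightarrow> I \<in> indep M) \<and>
     (\<forall>I J. I \<in> indep M \<and> J \<in> indep M \<and> card I < card J \<longrightarrow>
        (\<exists>x \<in> J - I. insert x I \<in> indep M))"

text \<open>
  As usual for uniform matroids, \<open>r\<close> is the parameter of the definition; a universe with fewer
  than \<open>r\<close> elements is not excluded.
\<close>

definition uniform_matroid :: "nat \<Rightarrow> nat set \<Rightarrow> matroid" where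
  "uniform_matroid r U = \<lparr>universe = U, indep = {I. I \<subseteq> U \<and> card I \<le> r}\<rparr>"

lemma is_matroid_uniform_matroid:
  assumes "finite U"
  shows "is_matroid (uniform_matroid r U)"
proof -
  have eqs: "universe (uniform_matroid r U) = U"
    "indep (uniform_matroid r U) = {I. I \<subseteq> U \<and> card I \<le> r}"
    by (simp_all add: uniform_matroid_def)
  have exchange: "\<exists>x \<in> J - I. insert x I \<subseteq> U \<and> card (insert x I) \<le> r"
    if "I \<subseteq> U" "J \<subseteq> U" "card J \<le> r" "card I < card J" for I J
  proof -
    have fin: "finite I" "finite J"
      using that(1,2) assms by (auto intro: finite_subset)
    have "\<not> J \<subseteq> I"
      using that(4) card_mono[OF fin(1), of J] by linarith
    then obtain x where "x \<in> J - I" by blast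
    then show ?thesis
      using that fin by (intro bexI[of _ x] conjI) auto
  qed
  have hereditary: "card I \<le> r" if "J \<subseteq> U" "card J \<le> r" "I \<subseteq> J" for I J
    using card_mono[of J I] finite_subset[OF that(1) assms] that(2,3) by linarith
  show ?thesis
    unfolding is_matroid_def eqs mem_Collect_eq
  proof (intro conjI allI impI)
    fix I J assume "(J \<subseteq> U \<and> card J \<le> r) \<and> I \<subseteq> J"
    then show "I \<subseteq> U" "card I \<le> r"
      by (blast, blast intro: hereditary)
  next
    fix I J assume "(I \<subseteq> U \<and> card I \<le> r) \<and> (J \<subseteq> U \<and> card J \<le> r) \<and> card I < card J"
    then show "\<exists>x \<in> J - I. insert x I \<subseteq> U \<and> card (insert x I) \<le> r"
      using exchange by presburger
  qed (use assms in \<open>simp_all add: subset_iff\<close>)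
qed


section \<open>Representative sets\<close>

text \<open>
  An element of \<open>\<nat>\<^sup>k\<close> is a list of length \<open>k\<close>; positions are counted from \<open>0\<close>.
\<close>

definition compatible :: "nat \<Rightarrow> nat list \<Rightarrow> nat set list \<Rightarrow> bool" where
  "compatible k a b \<longleftrightarrow> (\<forall>i<k. a ! i \<notin> b ! i)"

definition subset_tuples :: "nat \<Rightarrow> nat \<Rightarrow> nat set list set" where
  "subset_tuples k q = {b. length b = k \<and> (\<forall>B \<in> set b. finite B \<and> card B = q)}"

definition represents :: "nat \<Rightarrow> nat \<Rightarrow> nat list set \<Rightarrow> nat list set \<Rightarrow> bool" where
  "represents k q R' R \<longleftrightarrow>
     R' \<subseteq> R \<and> R \<subseteq> {a. length a = k} \<and>
     (\<forall>b \<in> subset_tuples k q.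
        (\<exists>a \<in> R. compatible k a b) \<longleftrightarrow> (\<exists>a' \<in> R'. compatible k a' b))"


section \<open>Machine model\<close>

text \<open>
  A random access machine with unit-cost rational arithmetic. A program uses finitely many
  registers, each holding a rational number, and finitely many unbounded arrays of rational
  numbers, each selected by a constant of the program. A register can be used as an array index
  only if its value is a natural number: \<open>Load\<close> and \<open>Store\<close> are stuck otherwise, so that
  indexing does not provide rounding. The machine has no other rounding operation and no bit
  operations, hence running times count arithmetic operations, comparisons and memory accesses.
\<close>

datatype arith_op = Add | Sub | Mul | Div

fun apply_op :: "arith_op \<Rightarrow> rat \<Rightarrow> rat \<Rightarrow> rat" where
  "apply_op Add u v = u + v"
| "apply_op Sub u v = u - v"
| "apply_op Mul u v = u * v"
| "apply_op Div u v = u / v"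

datatype prog =
    Skip
  | Const nat rat
  | Arith nat arith_op nat nat
  | Load nat nat nat
  | Store nat nat nat
  | Seq prog prog
  | Cond nat nat prog prog
  | Loop nat nat prog

record state =
  reg :: "nat \<Rightarrow> rat"
  arr :: "nat \<Rightarrow> nat \<Rightarrow> rat"

text \<open>
  \<open>exec P s t s'\<close>: started in \<open>s\<close>, the program \<open>P\<close> halts in \<open>s'\<close> after \<open>t\<close> steps.
  \<open>Load z A x\<close> is \<open>z := A[x]\<close> and \<open>Store A x y\<close> is \<open>A[x] := y\<close>; \<open>Cond\<close> and \<open>Loop\<close> (a while loop)
  test whether register \<open>x\<close> is less than register \<open>y\<close>.
\<close>

inductive exec :: "prog \<Rightarrow> state \<Rightarrow> nat \<Rightarrow> state \<Rightarrow> bool" where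
  Skip: "exec Skip s 1 s"
| Const: "exec (Const z q) s 1 (s\<lparr>reg := (reg s)(z := q)\<rparr>)"
| Arith: "exec (Arith z f x y) s 1 (s\<lparr>reg := (reg s)(z := apply_op f (reg s x) (reg s y))\<rparr>)"
| Load: "reg s x = of_nat i \<Longrightarrow>
    exec (Load z A x) s 1 (s\<lparr>reg := (reg s)(z := arr s A i)\<rparr>)"
| Store: "reg s x = of_nat i \<Longrightarrow>
    exec (Store A x y) s 1 (s\<lparr>arr := (arr s)(A := (arr s A)(i := reg s y))\<rparr>)"
| Seq: "exec P s t s' \<Longrightarrow> exec Q s' u s'' \<Longrightarrow> exec (Seq P Q) s (t + u) s''"
| CondTrue: "reg s x < reg s y \<Longrightarrow> exec P s t s' \<Longrightarrow> exec (Cond x y P Q) s (t + 1) s'"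
| CondFalse: "\<not> reg s x < reg s y \<Longrightarrow> exec Q s t s' \<Longrightarrow> exec (Cond x y P Q) s (t + 1) s'"
| LoopEnd: "\<not> reg s x < reg s y \<Longrightarrow> exec (Loop x y P) s 1 s"
| LoopStep: "reg s x < reg s y \<Longrightarrow> exec P s t s' \<Longrightarrow> exec (Loop x y P) s' u s'' \<Longrightarrow>
    exec (Loop x y P) s (t + u + 1) s''"

text \<open>
  The machine is deterministic, so \<open>runs_within\<close> below is a statement about the only run of the
  program.
\<close>

lemma exec_deterministic:
  assumes "exec P s t s'" "exec P s u s''"
  shows "u = t \<and> s'' = s'"
  using assms
proof (induction arbitrary: u s'' rule: exec.induct)
  case (Seq P s t s' Q v s2)
  from Seq.prems obtain t1 s1 t2 where
    *: "u = t1 + t2" "exec P s t1 s1" "exec Q s1 t2 s''"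
    by (cases rule: exec.cases) simp_all
  from Seq.IH(1)[OF *(2)] have "t1 = t" "s1 = s'" by simp_all
  with Seq.IH(2) * show ?case by simp
next
  case (CondTrue s x y P t s' Q)
  from CondTrue.prems CondTrue.hyps obtain v where "u = v + 1" "exec P s v s''"
    by (cases rule: exec.cases) simp_all
  with CondTrue.IH show ?case by simp
next
  case (CondFalse s x y Q t s' P)
  from CondFalse.prems CondFalse.hyps obtain v where "u = v + 1" "exec Q s v s''"
    by (cases rule: exec.cases) simp_all
  with CondFalse.IH show ?case by simp
next
  case (LoopStep s x y P t s' v s2)
  from LoopStep.prems LoopStep.hyps obtain t1 s1 t2 where
    *: "u = t1 + t2 + 1" "exec P s t1 s1" "exec (Loop x y P) s1 t2 s''"
    by (cases rule: exec.cases) simp_all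
  from LoopStep.IH(1)[OF *(2)] have "t1 = t" "s1 = s'" by simp_all
  with LoopStep.IH(2) * show ?case by simp
next
  case (Load s x i z A)
  from Load.prems Load.hyps show ?case by (cases rule: exec.cases) simp_all
next
  case (Store s x i A y)
  from Store.prems Store.hyps show ?case by (cases rule: exec.cases) simp_all
next
  case (LoopEnd s x y P)
  from LoopEnd.prems LoopEnd.hyps show ?case by (cases rule: exec.cases) simp_all
next
  case (Skip s)
  then show ?case by (cases rule: exec.cases) simp_all
next
  case (Const z q s)
  then show ?case by (cases rule: exec.cases) simp_all
next
  case (Arith z f x y s)
  then show ?case by (cases rule: exec.cases) simp_all
qed

definition runs_within :: "prog \<Rightarrow> state \<Rightarrow> real \<Rightarrow> (state \<Rightarrow> bool) \<Rightarrow> bool" where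
  "runs_within P s T post \<longleftrightarrow> (\<exists>t s'. exec P s t s' \<and> real t \<le> T \<and> post s')"


section \<open>The matrix multiplication exponent\<close>

definition stores_matrix :: "(nat \<Rightarrow> rat) \<Rightarrow> nat \<Rightarrow> rat mat \<Rightarrow> bool" where
  "stores_matrix F n A \<longleftrightarrow> (\<forall>i<n. \<forall>j<n. F (i * n + j) = A $$ (i, j))"

text \<open>
  \<open>matmul_time w\<close>: some program multiplies \<open>n \<times> n\<close> matrices in time \<open>O(n\<^sup>w)\<close>. The size is passed
  in register \<open>0\<close>, the factors in arrays \<open>0\<close> and \<open>1\<close>, and the product is returned in array \<open>2\<close>.
  Nothing is assumed about the initial contents of the rest of the memory.
\<close>

definition matmul_time :: "real \<Rightarrow> bool" where
  "matmul_time w \<longleftrightarrow>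
     (\<exists>P. \<exists>c::real. \<forall>n A B s.
        n \<ge> 1 \<and> A \<in> carrier_mat n n \<and> B \<in> carrier_mat n n \<and>
        reg s 0 = of_nat n \<and> stores_matrix (arr s 0) n A \<and> stores_matrix (arr s 1) n B \<longrightarrow>
        runs_within P s (c * real n powr w) (\<lambda>s'. stores_matrix (arr s' 2) n (A * B)))"

definition matmul_exponent :: real where
  "matmul_exponent = Inf {w. matmul_time w}"


section \<open>Input and output of sets of tuples\<close>

text \<open>A set of \<open>k\<close>-tuples is given by a repetition-free list, stored row by row.\<close>

definition stores_tuples :: "(nat \<Rightarrow> rat) \<Rightarrow> nat \<Rightarrow> nat list list \<Rightarrow> bool" where
  "stores_tuples F k xs \<longleftrightarrow> (\<forall>j<length xs. \<forall>i<k. F (j * k + i) = of_nat (xs ! j ! i))"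

definition input_set :: "state \<Rightarrow> nat \<Rightarrow> nat \<Rightarrow> nat list set \<Rightarrow> bool" where
  "input_set s k r R \<longleftrightarrow>
     (\<exists>xs. distinct xs \<and> set xs = R \<and>
        reg s 0 = of_nat k \<and> reg s 1 = of_nat r \<and> reg s 2 = of_nat (length xs) \<and>
        stores_tuples (arr s 0) k xs)"

text \<open>
  The conjunct \<open>set ys \<subseteq> {a. length a = k}\<close> makes the set read off from the memory unique.
\<close>

definition output_set :: "state \<Rightarrow> nat \<Rightarrow> nat list set \<Rightarrow> bool" where
  "output_set s k R \<longleftrightarrow>
     (\<exists>ys. distinct ys \<and> set ys = R \<and> set ys \<subseteq> {a. length a = k} \<and>
        reg s 0 = of_nat (length ys) \<and> stores_tuples (arr s 1) k ys)"

end

theory Submission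
  imports Defs
begin

text \<open>
  A tuple \<open>x\<close> is represented by the tensor product \<open>a\<^sub>x\<close> of the Vandermonde vectors
  \<open>(1, x\<^sub>i, \<dots>, x\<^sub>i\<^bsup>r-1\<^esup>)\<close>, a vector of length \<open>N = r\<^sup>k\<close>. Compatibility with \<open>b\<close> means that the
  linear form given by the coefficients of \<open>\<Prod>\<^sub>i \<Prod>\<^sub>y (x\<^sub>i - y)\<close>, \<open>y\<close> ranging over \<open>b\<^sub>i\<close>, does not vanish on
  \<open>a\<^sub>x\<close>, so it suffices to select at most \<open>N\<close> of the vectors in such a way that a relevant form vanishing
  on these vanishes on all of them.

  Row elimination would lose a logarithmic factor if the exponent were exactly 2. Instead, the
  \<open>j\<close>-th vector gets the weight \<open>\<delta>\<^sup>j\<close> for a tiny \<open>\<delta>\<close>, which exact rational arithmetic permits, and one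
  selects the vectors whose leverage score \<open>\<delta>\<^sup>j a\<^sub>j \<cdot> H\<^sup>-\<^sup>1 a\<^sub>j\<close> exceeds \<open>N / (N + 1)\<close>, where
  \<open>H = \<delta>\<^sup>m I + \<Sum>\<^sub>j \<delta>\<^sup>j a\<^sub>j a\<^sub>j\<^sup>T\<close>. The scores sum up to at most \<open>N\<close> (a trace), which bounds the number of
  selected vectors. If \<open>a\<^sub>j\<close> is the first vector on which an integral form \<open>f\<close> of bounded size does not
  vanish, its weight dominates all later ones, and Cauchy--Schwarz for \<open>H\<close> forces its score above the
  threshold. All this takes products of \<open>N \<times> N\<close> matrices, \<open>O(|R| / N)\<close> in number, and one inversion of
  the positive definite matrix \<open>H\<close>, by recursion on Schur complements without pivoting.
\<close>

section \<open>Programs on a relocated memory\<close>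

text \<open>Elimination on the \<open>|R|\<close> by \<open>N\<close> matrix, by recursion on halves
  of the columns, does work \<open>2^i * |R| * (N / 2^i)^(w-1)\<close> on level \<open>i\<close>;
  for \<open>w = 2\<close> all \<open>log N\<close> levels cost the same. Inverting a square matrix
  costs \<open>2^i * (N / 2^i)^w\<close> on level \<open>i\<close>, at most half of the level above,
  so no logarithm appears. This is why the selection goes through one inverse. As
  \<open>\<delta>\<close> tends to 0, the score of a vector tends to 1 if it lies outside the span
  of its predecessors and to 0 otherwise: the threshold imitates the greedy basis. But an actual
  \<open>\<delta>\<close> has to be computed beforehand, from a bound on the forms that depends on
  the input alone. With \<open>W\<close> equal to 1 plus the sum of all coordinates,
  \<open>\<delta> = 1 / (4 N W^(2 r k))\<close> is small enough. The term
  \<open>\<delta>^m I\<close> makes \<open>H\<close> invertible even if the vectors do not span. If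
  \<open>|R| \<le> N\<close>, the answer is \<open>R\<close> itself; otherwise
  \<open>N^w \<le> |R| N^(w-1)\<close> pays for the inversion.\<close>

lemma index_less:
  fixes i j m n :: nat
  assumes "i < m" "j < n"
  shows "i * n + j < m * n"
proof -
  have "i * n + j < Suc i * n" using assms by simp
  also have "\<dots> \<le> m * n" using assms by (intro mult_right_mono) auto
  finally show ?thesis .
qed

text \<open>Only writes count, and one bound serves for registers and arrays alike: reading does not
  disturb the memory above, so this suffices for the frame property
  \<open>exec_frame\<close>.\<close>

fun prog_bound :: "prog \<Rightarrow> nat" where
  "prog_bound Skip = 0"
| "prog_bound (Const z q) = Suc z"
| "prog_bound (Arith z f x y) = Suc z"
| "prog_bound (Load z A x) = Suc z"
| "prog_bound (Store A x y) = Suc A"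
| "prog_bound (Seq P Q) = max (prog_bound P) (prog_bound Q)"
| "prog_bound (Cond x y P Q) = max (prog_bound P) (prog_bound Q)"
| "prog_bound (Loop x y P) = prog_bound P"

lemma exec_frame:
  assumes "exec P s t s'" "prog_bound P \<le> z"
  shows "reg s' z = reg s z \<and> arr s' z = arr s z"
  using assms by (induction rule: exec.induct) auto

definition changed_cells_le :: "(nat \<Rightarrow> rat) \<Rightarrow> (nat \<Rightarrow> rat) \<Rightarrow> nat \<Rightarrow> bool" where
  "changed_cells_le F G t \<longleftrightarrow> finite {i. G i \<noteq> F i} \<and> card {i. G i \<noteq> F i} \<le> t"

lemma changed_cells_le_trans:
  assumes "changed_cells_le F G t" "changed_cells_le G H u"
  shows "changed_cells_le F H (t + u)"
proof -
  let ?X = "{i. G i \<noteq> F i} \<union> {i. H i \<noteq> G i}"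
  have fin: "finite ?X" and sub: "{i. H i \<noteq> F i} \<subseteq> ?X"
    using assms by (auto simp: changed_cells_le_def)
  have "card ?X \<le> t + u"
    using card_Un_le[of "{i. G i \<noteq> F i}" "{i. H i \<noteq> G i}"] assms
    unfolding changed_cells_le_def by linarith
  with card_mono[OF fin sub] finite_subset[OF sub fin] show ?thesis
    unfolding changed_cells_le_def by linarith
qed

text \<open>A step writes at most one cell. This yields the quadratic lower bound on matrix
  multiplication in \<open>matmul_time_ge_2\<close>.\<close>

lemma exec_changed_cells:
  assumes "exec P s t s'"
  shows "changed_cells_le (arr s A) (arr s' A) t"
  using assms
proof (induction rule: exec.induct)
  case (Store s x i A' y)
  let ?X = "{j. arr (s\<lparr>arr := (arr s)(A' := (arr s A')(i := reg s y))\<rparr>) A j \<noteq> arr s A j}"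
  have "?X \<subseteq> {i}" by auto
  with card_mono[OF _ this] finite_subset[OF this] show ?case
    by (simp add: changed_cells_le_def)
next
  case (LoopStep s x y P t s' u s'')
  then have "changed_cells_le (arr s A) (arr s'' A) (t + u)"
    by (rule_tac changed_cells_le_trans)
  then show ?case by (simp add: changed_cells_le_def)
next
  case Seq
  then show ?case by (rule_tac changed_cells_le_trans)
qed (auto simp: changed_cells_le_def)

text \<open>The floor exists in the specification alone: \<open>wd\<close> and
  \<open>hrun_sto\<close> demand natural numbers as indices, so the machine never has to
  round.\<close>

definition nat_of_rat :: "rat \<Rightarrow> nat" where
  "nat_of_rat q = nat \<lfloor>q\<rfloor>"

lemma nat_of_rat_simps [simp]:
  "nat_of_rat (of_nat i) = i" "nat_of_rat 0 = 0" "nat_of_rat 1 = 1" "nat_of_rat (numeral v) = numeral v"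
  by (simp_all add: nat_of_rat_def)

lemma of_nat_nat_of_rat [simp]: "q \<in> \<nat> \<Longrightarrow> of_nat (nat_of_rat q) = q"
  by (auto elim: Nats_cases)

lemma nat_of_rat_add [simp]: "p \<in> \<nat> \<Longrightarrow> q \<in> \<nat> \<Longrightarrow> nat_of_rat (p + q) = nat_of_rat p + nat_of_rat q"
  by (auto elim!: Nats_cases simp flip: of_nat_add)

lemma nat_of_rat_mult [simp]: "p \<in> \<nat> \<Longrightarrow> q \<in> \<nat> \<Longrightarrow> nat_of_rat (p * q) = nat_of_rat p * nat_of_rat q"
  by (auto elim!: Nats_cases simp flip: of_nat_mult)

declare Nats_add [simp] Nats_mult [simp]

section \<open>Expressions, their compilation, and a program logic with running times\<close>

datatype exp = K rat | V nat | Op arith_op exp exp | L nat exp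

abbreviation plus_exp (infixl "|+|" 65) where "a |+| b \<equiv> Op Add a b"
abbreviation minus_exp (infixl "|-|" 65) where "a |-| b \<equiv> Op Sub a b"
abbreviation times_exp (infixl "|*|" 70) where "a |*| b \<equiv> Op Mul a b"
abbreviation divide_exp (infixl "|'/|" 70) where "a |/| b \<equiv> Op Div a b"

fun eval :: "exp \<Rightarrow> state \<Rightarrow> rat" where
  "eval (K q) h = q"
| "eval (V x) h = reg h x"
| "eval (Op f a b) h = apply_op f (eval a h) (eval b h)"
| "eval (L A a) h = arr h A (nat_of_rat (eval a h))"

fun wd :: "exp \<Rightarrow> state \<Rightarrow> bool" where
  "wd (K q) h = True"
| "wd (V x) h = (x < 40)"
| "wd (Op f a b) h = (wd a h \<and> wd b h)"
| "wd (L A a) h = (wd a h \<and> eval a h \<in> \<nat>)"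

fun cost :: "exp \<Rightarrow> nat" where
  "cost (K q) = 1"
| "cost (V x) = 2"
| "cost (Op f a b) = cost a + cost b + 1"
| "cost (L A a) = cost a + 1"

abbreviation set_reg :: "nat \<Rightarrow> rat \<Rightarrow> state \<Rightarrow> state" where
  "set_reg z v h \<equiv> h\<lparr>reg := (reg h)(z := v)\<rparr>"

abbreviation set_arr :: "nat \<Rightarrow> (nat \<Rightarrow> rat) \<Rightarrow> state \<Rightarrow> state" where
  "set_arr A F h \<equiv> h\<lparr>arr := (arr h)(A := F)\<rparr>"

definition chg :: "nat set \<Rightarrow> nat set \<Rightarrow> state \<Rightarrow> state \<Rightarrow> bool" where
  "chg X Y h h' \<longleftrightarrow> (\<forall>x. x \<notin> X \<longrightarrow> reg h' x = reg h x) \<and> (\<forall>y. y \<notin> Y \<longrightarrow> arr h' y = arr h y)"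

lemma chg_reg: "chg X Y h h' \<Longrightarrow> x \<notin> X \<Longrightarrow> reg h' x = reg h x"
  and chg_arr: "chg X Y h h' \<Longrightarrow> y \<notin> Y \<Longrightarrow> arr h' y = arr h y"
  by (auto simp: chg_def)

lemma chg_refl [simp]: "chg X Y h h"
  by (simp add: chg_def)

lemma chg_trans:
  "chg X Y h h' \<Longrightarrow> chg X' Y' h' h'' \<Longrightarrow> X \<subseteq> Z \<Longrightarrow> X' \<subseteq> Z \<Longrightarrow> Y \<subseteq> W \<Longrightarrow> Y' \<subseteq> W \<Longrightarrow> chg Z W h h''"
  unfolding chg_def by (metis subsetD)

lemma chg_mono: "chg X Y h h' \<Longrightarrow> X \<subseteq> Z \<Longrightarrow> Y \<subseteq> W \<Longrightarrow> chg Z W h h'"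
  unfolding chg_def by blast

lemma chg_upd [simp]:
  "z \<in> X \<Longrightarrow> chg X Y h (set_reg z v h') = chg X Y h h'"
  "z \<in> X \<Longrightarrow> chg X Y (set_reg z v h) h' = chg X Y h h'"
  "A \<in> Y \<Longrightarrow> chg X Y h (set_arr A F h') = chg X Y h h'"
  "A \<in> Y \<Longrightarrow> chg X Y (set_arr A F h) h' = chg X Y h h'"
  by (auto simp: chg_def)

text \<open>
  A program is compiled for an abstract memory, whose registers \<open>0, \<dots>, 39\<close> and arrays are the
  machine's registers and arrays from \<open>B\<close> on. The registers from \<open>B + 40\<close> on hold intermediate
  results; those below \<open>B\<close> are left to the matrix multiplication program.
\<close>

locale ram =
  fixes B :: nat
begin

definition sim :: "state \<Rightarrow> state \<Rightarrow> bool" where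
  "sim s h \<longleftrightarrow> (\<forall>x<40. reg s (B + x) = reg h x) \<and> (\<forall>y. arr s (B + y) = arr h y)"

text \<open>A total correctness statement with a time bound. \<open>Q\<close> may itself be an
  \<open>hrun\<close> statement, so a sequence is treated by nesting, without intermediate
  assertions. Quantifying over all simulating \<open>s\<close> leaves the scratch registers and the
  memory below \<open>B\<close> arbitrary.\<close>

definition hrun :: "prog \<Rightarrow> state \<Rightarrow> real \<Rightarrow> (state \<Rightarrow> bool) \<Rightarrow> bool" where
  "hrun P h T Q \<longleftrightarrow> (\<forall>s. sim s h \<longrightarrow> (\<exists>t s' h'. exec P s t s' \<and> real t \<le> T \<and> sim s' h' \<and> Q h'))"

lemma hrun_mono:
  "hrun P h T Q \<Longrightarrow> T \<le> T' \<Longrightarrow> (\<And>h'. Q h' \<Longrightarrow> Q' h') \<Longrightarrow> hrun P h T' Q'"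
  unfolding hrun_def by (meson order_trans)

lemma hrun_Seq:
  assumes "hrun P h T (\<lambda>h'. hrun Q h' U R)" "T + U \<le> W"
  shows "hrun (Seq P Q) h W R"
  unfolding hrun_def
proof (intro allI impI)
  fix s assume "sim s h"
  with assms(1) obtain t s' h' where 1: "exec P s t s'" "real t \<le> T" "sim s' h'" "hrun Q h' U R"
    unfolding hrun_def by blast
  then obtain u s'' h'' where 2: "exec Q s' u s''" "real u \<le> U" "sim s'' h''" "R h''"
    unfolding hrun_def by blast
  show "\<exists>t s' h'. exec (Seq P Q) s t s' \<and> real t \<le> W \<and> sim s' h' \<and> R h'"
    using exec.Seq[OF 1(1) 2(1)] 1 2 assms(2)
    by (intro exI[of _ "t + u"] exI[of _ s''] exI[of _ h'']) auto
qed

lemma hrun_Skip: "Q h \<Longrightarrow> 1 \<le> T \<Longrightarrow> hrun Skip h T Q"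
  unfolding hrun_def by (metis exec.Skip of_nat_1)

text \<open>The machine has no register move, so a variable is added to a zero, which costs 2. The
  registers from \<open>t\<close> on serve as an evaluation stack; this is why the second operand
  goes to \<open>Suc t\<close>.\<close>

fun compile :: "exp \<Rightarrow> nat \<Rightarrow> prog" where
  "compile (K q) t = Const t q"
| "compile (V x) t = Seq (Const t 0) (Arith t Add (B + x) t)"
| "compile (Op f a b) t = Seq (compile a t) (Seq (compile b (Suc t)) (Arith t f t (Suc t)))"
| "compile (L A a) t = Seq (compile a t) (Load t (B + A) t)"

lemma exec_compile:
  assumes "sim s h" "wd e h" "t \<ge> B + 40"
  shows "\<exists>s'. exec (compile e t) s (cost e) s' \<and> reg s' t = eval e h \<and> arr s' = arr s \<and>
    (\<forall>x<t. reg s' x = reg s x)"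
  using assms
proof (induction e arbitrary: t s)
  case (K q)
  then show ?case using exec.Const[of t q s] by fastforce
next
  case (V x)
  have "exec (compile (V x) t) s (1 + 1) (set_reg t (reg s (B + x)) s)"
    using exec.Seq[OF exec.Const[of t 0 s] exec.Arith[of t Add "B + x" t]] V by simp
  moreover have "cost (V x) = 1 + 1" by simp
  ultimately have "exec (compile (V x) t) s (cost (V x)) (set_reg t (reg s (B + x)) s)"
    by argo
  then show ?case
    by (intro exI[of _ "set_reg t (reg s (B + x)) s"]) (use V in \<open>auto simp: sim_def\<close>)
next
  case (Op f a b)
  from Op.IH(1)[of s t] Op.prems obtain s1 where 1: "exec (compile a t) s (cost a) s1"
    "reg s1 t = eval a h" "arr s1 = arr s" "\<forall>x<t. reg s1 x = reg s x" by auto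
  have "sim s1 h" using Op.prems 1 by (auto simp: sim_def)
  with Op.IH(2)[of s1 "Suc t"] Op.prems obtain s2 where 2: "exec (compile b (Suc t)) s1 (cost b) s2"
    "reg s2 (Suc t) = eval b h" "arr s2 = arr s1" "\<forall>x<Suc t. reg s2 x = reg s1 x" by auto
  show ?case
    using exec.Seq[OF 1(1) exec.Seq[OF 2(1) exec.Arith[of t f t "Suc t" s2]]] 1 2
    by (intro exI[of _ "set_reg t (apply_op f (reg s2 t) (reg s2 (Suc t))) s2"])
      (auto simp: add.assoc)
next
  case (L A a)
  from L.IH[of s t] L.prems obtain s1 where 1: "exec (compile a t) s (cost a) s1"
    "reg s1 t = eval a h" "arr s1 = arr s" "\<forall>x<t. reg s1 x = reg s x" by auto
  have "reg s1 t = of_nat (nat_of_rat (eval a h))"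
    using 1 L.prems by simp
  from exec.Seq[OF 1(1) exec.Load[OF this, of t "B + A"]]
  have "exec (compile (L A a) t) s (cost (L A a)) (set_reg t (arr s1 (B + A) (nat_of_rat (eval a h))) s1)"
    by simp
  then show ?case
    by (intro exI conjI, assumption) (use 1 L.prems in \<open>auto simp: sim_def\<close>)
qed

definition asg :: "nat \<Rightarrow> exp \<Rightarrow> prog" (infix "::=" 62) where
  "z ::= e = Seq (compile e (B + 40)) (Seq (Const (B + 41) 0) (Arith (B + z) Add (B + 40) (B + 41)))"

lemma hrun_asg:
  assumes "wd e h" "z < 40" "Q (set_reg z (eval e h) h)" "real (cost e) + 2 \<le> T"
  shows "hrun (z ::= e) h T Q"
  unfolding hrun_def
proof (intro allI impI)
  fix s assume s: "sim s h"
  from exec_compile[OF this assms(1), of "B + 40"] obtain s' where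
    1: "exec (compile e (B + 40)) s (cost e) s'" "reg s' (B + 40) = eval e h" "arr s' = arr s"
    "\<forall>x<B + 40. reg s' x = reg s x" by auto
  let ?s = "set_reg (B + z) (eval e h) (set_reg (B + 41) 0 s')"
  have e: "exec (z ::= e) s (cost e + (1 + 1)) ?s"
    unfolding asg_def
    using exec.Seq[OF 1(1) exec.Seq[OF exec.Const[of "B + 41" 0 s'] exec.Arith[of "B + z" Add "B + 40" "B + 41"]]]
      1(2) by simp
  have "sim ?s (set_reg z (eval e h) h)"
    using s 1 by (auto simp: sim_def)
  with e assms show "\<exists>t s' h'. exec (z ::= e) s t s' \<and> real t \<le> T \<and> sim s' h' \<and> Q h'"
    by (intro exI[of _ "cost e + (1 + 1)"] exI[of _ ?s] exI[of _ "set_reg z (eval e h) h"]) simp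
qed

definition sto :: "nat \<Rightarrow> exp \<Rightarrow> exp \<Rightarrow> prog" where
  "sto A i e = Seq (compile i (B + 40)) (Seq (compile e (B + 41)) (Store (B + A) (B + 40) (B + 41)))"

lemma hrun_sto:
  assumes "wd i h" "wd e h" "eval i h \<in> \<nat>"
    "Q (set_arr A ((arr h A)(nat_of_rat (eval i h) := eval e h)) h)" "real (cost i + cost e) + 1 \<le> T"
  shows "hrun (sto A i e) h T Q"
  unfolding hrun_def
proof (intro allI impI)
  fix s assume s: "sim s h"
  from exec_compile[OF this assms(1), of "B + 40"] obtain s1 where
    1: "exec (compile i (B + 40)) s (cost i) s1" "reg s1 (B + 40) = eval i h" "arr s1 = arr s"
    "\<forall>x<B + 40. reg s1 x = reg s x" by auto
  have "sim s1 h" using s 1 by (auto simp: sim_def)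
  from exec_compile[OF this assms(2), of "B + 41"] obtain s2 where
    2: "exec (compile e (B + 41)) s1 (cost e) s2" "reg s2 (B + 41) = eval e h" "arr s2 = arr s1"
    "\<forall>x<B + 41. reg s2 x = reg s1 x" by auto
  let ?h = "set_arr A ((arr h A)(nat_of_rat (eval i h) := eval e h)) h"
  let ?s = "set_arr (B + A) ((arr s2 (B + A))(nat_of_rat (eval i h) := reg s2 (B + 41))) s2"
  have "reg s2 (B + 40) = of_nat (nat_of_rat (eval i h))"
    using 1 2 assms by simp
  then have e: "exec (sto A i e) s (cost i + (cost e + 1)) ?s"
    unfolding sto_def by (rule exec.Seq[OF 1(1) exec.Seq[OF 2(1) exec.Store]])
  have "sim ?s ?h"
    using s 1 2 by (auto simp: sim_def)
  with e assms show "\<exists>t s' h'. exec (sto A i e) s t s' \<and> real t \<le> T \<and> sim s' h' \<and> Q h'"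
    by (intro exI[of _ "cost i + (cost e + 1)"] exI[of _ ?s] exI[of _ ?h]) simp
qed

definition IfLess :: "nat \<Rightarrow> nat \<Rightarrow> prog \<Rightarrow> prog \<Rightarrow> prog" where
  "IfLess x y P Q = Cond (B + x) (B + y) P Q"

lemma hrun_IfLess:
  assumes "x < 40" "y < 40"
    "reg h x < reg h y \<Longrightarrow> hrun P h T R" "\<not> reg h x < reg h y \<Longrightarrow> hrun Q h T R" "T + 1 \<le> W"
  shows "hrun (IfLess x y P Q) h W R"
  unfolding hrun_def IfLess_def
proof (intro allI impI)
  fix s assume s: "sim s h"
  then have eq: "reg s (B + x) = reg h x" "reg s (B + y) = reg h y"
    using assms by (auto simp: sim_def)
  show "\<exists>t s' h'. exec (Cond (B + x) (B + y) P Q) s t s' \<and> real t \<le> W \<and> sim s' h' \<and> R h'"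
  proof (cases "reg h x < reg h y")
    case True
    with assms(3) s obtain t s' h' where "exec P s t s'" "real t \<le> T" "sim s' h'" "R h'"
      unfolding hrun_def by blast
    with True eq assms(5) show ?thesis
      using exec.CondTrue[of s "B + x" "B + y" P t s' Q] by fastforce
  next
    case False
    with assms(4) s obtain t s' h' where "exec Q s t s'" "real t \<le> T" "sim s' h'" "R h'"
      unfolding hrun_def by blast
    with False eq assms(5) show ?thesis
      using exec.CondFalse[of s "B + x" "B + y" Q t s' P] by fastforce
  qed
qed

definition While :: "nat \<Rightarrow> nat \<Rightarrow> prog \<Rightarrow> prog" where
  "While x y P = Loop (B + x) (B + y) P"

lemma hrun_While_end:
  assumes "x < 40" "y < 40" "\<not> reg h x < reg h y" "Q h" "1 \<le> T"
  shows "hrun (While x y P) h T Q"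
  unfolding hrun_def While_def
proof (intro allI impI)
  fix s assume s: "sim s h"
  then have eq: "reg s (B + x) = reg h x" "reg s (B + y) = reg h y"
    using assms by (auto simp: sim_def)
  show "\<exists>t s' h'. exec (Loop (B + x) (B + y) P) s t s' \<and> real t \<le> T \<and> sim s' h' \<and> Q h'"
    using s eq assms exec.LoopEnd[of s "B + x" "B + y" P] by fastforce
qed

lemma hrun_While_step:
  assumes "x < 40" "y < 40" "reg h x < reg h y" "hrun P h T (\<lambda>h'. hrun (While x y P) h' U Q)"
    "T + U + 1 \<le> W"
  shows "hrun (While x y P) h W Q"
  unfolding hrun_def
proof (intro allI impI)
  fix s assume s: "sim s h"
  then have eq: "reg s (B + x) = reg h x" "reg s (B + y) = reg h y"
    using assms by (auto simp: sim_def)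
  from assms(4) s obtain t s' h' where 1: "exec P s t s'" "real t \<le> T" "sim s' h'"
    "hrun (While x y P) h' U Q"
    unfolding hrun_def by blast
  then obtain u s'' h'' where 2: "exec (Loop (B + x) (B + y) P) s' u s''" "real u \<le> U" "sim s'' h''" "Q h''"
    unfolding hrun_def While_def by blast
  have "exec (Loop (B + x) (B + y) P) s (t + u + 1) s''"
    using exec.LoopStep[OF _ 1(1) 2(1)] eq assms(3) by simp
  then show "\<exists>t s' h'. exec (While x y P) s t s' \<and> real t \<le> W \<and> sim s' h' \<and> Q h'"
    unfolding While_def using 1 2 assms(5)
    by (intro exI[of _ "t + u + 1"] exI[of _ s''] exI[of _ h'']) auto
qed

lemma hrun_While:
  assumes xy: "x < 40" "y < 40"
    and init: "I 0 h"
    and step: "\<And>c h. c < n \<Longrightarrow> I c h \<Longrightarrow> reg h x < reg h y \<and> hrun P h T (I (Suc c))"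
    and stop: "\<And>h. I n h \<Longrightarrow> \<not> reg h x < reg h y"
    and time: "real n * (T + 1) + 1 \<le> W"
    and post: "\<And>h. I n h \<Longrightarrow> Q h"
  shows "hrun (While x y P) h W Q"
proof -
  have "hrun (While x y P) h (real d * (T + 1) + 1) Q" if "c + d = n" "I c h" for c d h
    using that
  proof (induction d arbitrary: c h)
    case 0
    with stop[of h] post[of h] xy show ?case
      by (intro hrun_While_end) auto
  next
    case (Suc d)
    with step[of c h] have s: "reg h x < reg h y" "hrun P h T (I (Suc c))" by auto
    have "hrun P h T (\<lambda>h'. hrun (While x y P) h' (real d * (T + 1) + 1) Q)"
      using Suc by (intro hrun_mono[OF s(2)]) auto
    then show ?case
      using xy s by (intro hrun_While_step) (auto simp: algebra_simps)
  qed
  then have "hrun (While x y P) h (real n * (T + 1) + 1) Q"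
    using init by simp
  then show ?thesis
    by (rule hrun_mono) (use time in auto)
qed

definition For :: "nat \<Rightarrow> nat \<Rightarrow> prog \<Rightarrow> prog" where
  "For i n P = Seq (i ::= K 0) (While i n (Seq P (i ::= V i |+| K 1)))"

lemma hrun_For:
  assumes xy: "i < 40" "z < 40" "i \<noteq> z"
    and n: "reg h z = of_nat n"
    and init: "I 0 (set_reg i 0 h)"
    and step: "\<And>c h. c < n \<Longrightarrow> I c h \<Longrightarrow> reg h i = of_nat c \<Longrightarrow> reg h z = of_nat n \<Longrightarrow>
      hrun P h T (\<lambda>h'. reg h' i = of_nat c \<and> reg h' z = of_nat n \<and> I (Suc c) (set_reg i (of_nat (Suc c)) h'))"
    and time: "real n * (T + 7) + 4 \<le> W"
    and post: "\<And>h. I n h \<Longrightarrow> reg h i = of_nat n \<Longrightarrow> reg h z = of_nat n \<Longrightarrow> Q h"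
  shows "hrun (For i z P) h W Q"
proof -
  let ?J = "\<lambda>c h. I c h \<and> reg h i = of_nat c \<and> reg h z = of_nat n"
  have "hrun (While i z (Seq P (i ::= V i |+| K 1))) (set_reg i 0 h) (real n * (T + 7) + 1) Q"
  proof (rule hrun_While[where I = ?J and n = n and T = "T + 6"])
    fix c h assume c: "c < n" "?J c h"
    have "hrun (Seq P (i ::= V i |+| K 1)) h (T + 6) (?J (Suc c))"
    proof (rule hrun_Seq)
      show "hrun P h T (\<lambda>h'. hrun (i ::= V i |+| K 1) h' 6 (?J (Suc c)))"
        by (rule hrun_mono[OF step[of c h]])
          (use c xy in \<open>auto intro!: hrun_asg simp: add.commute\<close>)
    qed simp
    then show "reg h i < reg h z \<and> hrun (Seq P (i ::= V i |+| K 1)) h (T + 6) (?J (Suc c))"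
      using c by simp
  qed (use xy n init post in \<open>auto simp: algebra_simps\<close>)
  then have "hrun (For i z P) h (3 + (real n * (T + 7) + 1)) Q"
    unfolding For_def using xy by (intro hrun_Seq[OF hrun_asg]) auto
  then show ?thesis
    by (rule hrun_mono) (use time in auto)
qed

end

section \<open>Copying arrays, filling matrices and calling the multiplication program\<close>

context ram
begin

text \<open>The arguments are machine addresses, not shifted by \<open>B\<close>: copies cross the
  border between the simulated memory and the memory of the multiplication program.\<close>

definition copy_array :: "nat \<Rightarrow> nat \<Rightarrow> nat \<Rightarrow> prog" where
  "copy_array b a n = Seq (Const (B + 40) 0) (Seq (Const (B + 42) 1) (Loop (B + 40) n
     (Seq (Load (B + 41) a (B + 40)) (Seq (Store b (B + 40) (B + 41))
       (Arith (B + 40) Add (B + 40) (B + 42))))))"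

lemma exec_copy_array:
  assumes n: "reg s n = of_nat N" "n < B + 40" and ab: "a \<noteq> b"
  shows "\<exists>t s'. exec (copy_array b a n) s t s' \<and> t \<le> 4 * N + 3 \<and>
    arr s' = (arr s)(b := \<lambda>x. if x < N then arr s a x else arr s b x) \<and>
    (\<forall>x<B + 40. reg s' x = reg s x)"
proof -
  define body where "body = Seq (Load (B + 41) a (B + 40)) (Seq (Store b (B + 40) (B + 41))
    (Arith (B + 40) Add (B + 40) (B + 42)))"
  define copied where "copied c s' \<longleftrightarrow> reg s' (B + 40) = of_nat c \<and> reg s' (B + 42) = 1 \<and>
    arr s' = (arr s)(b := \<lambda>x. if x < c then arr s a x else arr s b x) \<and>
    (\<forall>x<B + 40. reg s' x = reg s x)" for c and s' :: state
  have loop: "\<exists>s2. exec (Loop (B + 40) n body) s1 (4 * d + 1) s2 \<and> copied N s2"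
    if "c + d = N" "copied c s1" for c d s1
    using that
  proof (induction d arbitrary: c s1)
    case 0
    then have "exec (Loop (B + 40) n body) s1 1 s1"
      using n by (intro exec.LoopEnd) (simp add: copied_def)
    then show ?case using 0 by auto
  next
    case (Suc d)
    let ?a = "set_reg (B + 41) (arr s1 a c) s1"
    let ?b = "set_arr b ((arr ?a b)(c := reg ?a (B + 41))) ?a"
    let ?c = "set_reg (B + 40) (apply_op Add (reg ?b (B + 40)) (reg ?b (B + 42))) ?b"
    have c: "reg s1 (B + 40) = of_nat c" "reg ?a (B + 40) = of_nat c"
      using Suc.prems by (simp_all add: copied_def)
    have "exec body s1 (1 + (1 + 1)) ?c"
      unfolding body_def
      by (rule exec.Seq[OF exec.Load[OF c(1)] exec.Seq[OF exec.Store[OF c(2)] exec.Arith]])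
    moreover have "copied (Suc c) ?c"
      using Suc.prems(2) ab by (auto simp: copied_def fun_eq_iff less_Suc_eq)
    then obtain s2 where "exec (Loop (B + 40) n body) ?c (4 * d + 1) s2" "copied N s2"
      using Suc.IH[of "Suc c" ?c] Suc.prems(1) by auto
    moreover have "reg s1 (B + 40) < reg s1 n"
      using Suc.prems n by (simp add: copied_def)
    ultimately have "exec (Loop (B + 40) n body) s1 ((1 + (1 + 1)) + (4 * d + 1) + 1) s2 \<and> copied N s2"
      using exec.LoopStep by blast
    moreover have "(1 + (1 + 1)) + (4 * d + 1) + 1 = 4 * Suc d + 1" by simp
    ultimately show ?case by metis
  qed
  let ?s = "set_reg (B + 42) 1 (set_reg (B + 40) 0 s)"
  have "copied 0 ?s" by (simp add: copied_def)
  with loop[of 0 N ?s] obtain s' where s': "exec (Loop (B + 40) n body) ?s (4 * N + 1) s'" "copied N s'"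
    by auto
  have "exec (copy_array b a n) s (1 + (1 + (4 * N + 1))) s'"
    unfolding copy_array_def body_def[symmetric]
    by (rule exec.Seq[OF exec.Const exec.Seq[OF exec.Const s'(1)]])
  with s'(2) show ?thesis
    unfolding copied_def by (intro exI[of _ "1 + (1 + (4 * N + 1))"] exI[of _ s']) auto
qed

definition fill_matrix :: "nat \<Rightarrow> nat \<Rightarrow> exp \<Rightarrow> exp \<Rightarrow> prog" where
  "fill_matrix z D ix e = For 20 z (For 21 z (sto D ix e))"

text \<open>The expression \<open>e\<close> may read the very cell that is about to be overwritten,
  as in-place updates do. Injectivity of \<open>f\<close> ensures that this cell still has its old
  value when it is reached.\<close>

lemma hrun_fill_matrix:
  assumes z: "z < 20" "reg h z = of_nat n" "n \<ge> 1"
    and wd: "\<And>i j h' F. i < n \<Longrightarrow> j < n \<Longrightarrow>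
      reg h' = (reg h)(20 := of_nat i, 21 := of_nat j) \<Longrightarrow> arr h' = (arr h)(D := F) \<Longrightarrow>
      wd ix h' \<and> wd e h' \<and> eval ix h' = of_nat (f i j) \<and>
      (F (f i j) = arr h D (f i j) \<longrightarrow> eval e h' = g i j)"
    and inj: "\<And>i j i' j'. i < n \<Longrightarrow> j < n \<Longrightarrow> i' < n \<Longrightarrow> j' < n \<Longrightarrow> f i j = f i' j' \<Longrightarrow> i = i' \<and> j = j'"
    and time: "real n * real n * (real (cost ix + cost e) + 23) \<le> T"
    and post: "\<And>h' F. reg h' = (reg h)(20 := of_nat n, 21 := of_nat n) \<Longrightarrow> arr h' = (arr h)(D := F) \<Longrightarrow>
      (\<And>i j. i < n \<Longrightarrow> j < n \<Longrightarrow> F (f i j) = g i j) \<Longrightarrow>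
      (\<And>x. (\<And>i j. i < n \<Longrightarrow> j < n \<Longrightarrow> x \<noteq> f i j) \<Longrightarrow> F x = arr h D x) \<Longrightarrow> Q h'"
  shows "hrun (fill_matrix z D ix e) h T Q"
proof -
  \<comment> \<open>The positions visited before \<open>(c, d)\<close> in row order.\<close>
  define S where "S c d = {(i, j). (i < c \<or> i = c \<and> j < d) \<and> j < n}" for c d :: nat
  define I where "I c d h' \<longleftrightarrow> reg h' = (reg h)(20 := of_nat c, 21 := of_nat d) \<and>
    (\<exists>F. arr h' = (arr h)(D := F) \<and> (\<forall>(i, j) \<in> S c d. F (f i j) = g i j) \<and>
      (\<forall>x. (\<forall>(i, j) \<in> S c d. x \<noteq> f i j) \<longrightarrow> F x = arr h D x))" for c d and h' :: state
  \<comment> \<open>Between two rows, register 21 holds its initial content if \<open>c = 0\<close>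
    and the final value \<open>n\<close> of the inner loop otherwise.\<close>
  define J where "J c h' \<longleftrightarrow> (\<exists>v. reg h' = (reg h)(20 := of_nat c, 21 := v) \<and> (c > 0 \<longrightarrow> v = of_nat n)) \<and>
    (\<exists>F. arr h' = (arr h)(D := F) \<and> (\<forall>(i, j) \<in> S c 0. F (f i j) = g i j) \<and>
      (\<forall>x. (\<forall>(i, j) \<in> S c 0. x \<noteq> f i j) \<longrightarrow> F x = arr h D x))" for c and h' :: state
  let ?t = "real (cost ix + cost e) + 1"
  have inner: "hrun (sto D ix e) h' ?t (\<lambda>h''. reg h'' 21 = of_nat d \<and> reg h'' z = of_nat n \<and>
      I c (Suc d) (set_reg 21 (of_nat (Suc d)) h''))"
    if cd: "c < n" "d < n" and I: "I c d h'" for c d h'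
  proof -
    from I obtain F where F: "arr h' = (arr h)(D := F)" "\<forall>(i, j) \<in> S c d. F (f i j) = g i j"
      "\<forall>x. (\<forall>(i, j) \<in> S c d. x \<noteq> f i j) \<longrightarrow> F x = arr h D x"
      and r: "reg h' = (reg h)(20 := of_nat c, 21 := of_nat d)"
      unfolding I_def by blast
    have fresh: "f c d \<noteq> f i j" if "(i, j) \<in> S c d" for i j
      using inj[of c d i j] that cd by (auto simp: S_def)
    have fresh': "f i j \<noteq> f c d" and old: "F (f i j) = g i j" if "(i, j) \<in> S c d" for i j
      using fresh[OF that] F(2) that by auto
    have w: "wd ix h'" "wd e h'" "eval ix h' = of_nat (f c d)" "eval e h' = g c d"
      using wd[OF cd r F(1)] F(3) fresh by auto
    have S: "S c (Suc d) = insert (c, d) (S c d)"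
      using cd by (auto simp: S_def)
    show ?thesis
      by (rule hrun_sto) (use w r z F(1,3) fresh' old in \<open>auto simp: I_def S intro!: exI[of _ "F(f c d := g c d)"]\<close>)
  qed
  have "hrun (For 20 z (For 21 z (sto D ix e))) h T Q"
  proof (rule hrun_For[where I = J and n = n and T = "real n * (?t + 7) + 4"])
    show "J 0 (set_reg 20 0 h)"
      by (auto simp: J_def S_def intro!: exI[of _ "reg h 21"] exI[of _ "arr h D"])
  next
    fix c h' assume c: "c < n" "J c h'"
    have S: "S c n = S (Suc c) 0"
      by (auto simp: S_def)
    show "hrun (For 21 z (sto D ix e)) h' (real n * (?t + 7) + 4)
      (\<lambda>h'. reg h' 20 = of_nat c \<and> reg h' z = of_nat n \<and> J (Suc c) (set_reg 20 (of_nat (Suc c)) h'))"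
    proof (rule hrun_For[where I = "I c" and n = n and T = ?t])
      show "I c 0 (set_reg 21 0 h')"
        using c(2) unfolding J_def I_def by auto
    next
      fix d h' assume "d < n" "I c d h'"
      then show "hrun (sto D ix e) h' ?t (\<lambda>h''. reg h'' 21 = of_nat d \<and> reg h'' z = of_nat n \<and>
        I c (Suc d) (set_reg 21 (of_nat (Suc d)) h''))"
        using inner c(1) by blast
    next
      fix h' assume "I c n h'"
      then show "reg h' 20 = of_nat c \<and> reg h' z = of_nat n \<and> J (Suc c) (set_reg 20 (of_nat (Suc c)) h')"
        using z unfolding I_def J_def S by (auto simp: fun_eq_iff intro!: exI[of _ "of_nat n"])
    qed (use z c in \<open>auto simp: J_def\<close>)
  next
    fix h' assume J: "J n h'"
    then obtain F where F: "arr h' = (arr h)(D := F)" "\<forall>(i, j) \<in> S n 0. F (f i j) = g i j"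
      "\<forall>x. (\<forall>(i, j) \<in> S n 0. x \<noteq> f i j) \<longrightarrow> F x = arr h D x"
      unfolding J_def by blast
    show "Q h'"
    proof (rule post[of h' F])
      show "reg h' = (reg h)(20 := of_nat n, 21 := of_nat n)"
        using J z by (auto simp: J_def)
    qed (use F in \<open>auto simp: S_def\<close>)
  next
    \<comment> \<open>Since \<open>n \<ge> 1\<close>, linear and constant overheads are charged to
      \<open>n * n\<close>; the constant 23 is 8 per entry, 11 per row and 4 for the whole.\<close>
    have "1 * real n \<le> real n * real n" "1 * 1 \<le> real n * real n"
      using z(3) by (intro mult_mono; simp)+
    then have "real n * (real n * (?t + 7) + 4 + 7) + 4
      \<le> real n * real n * (?t + 7) + real n * real n * 11 + real n * real n * 4"
      by (simp add: algebra_simps)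
    also have "\<dots> = real n * real n * (real (cost ix + cost e) + 23)"
      by (simp add: algebra_simps)
    finally show "real n * (real n * (?t + 7) + 4 + 7) + 4 \<le> T"
      using time by linarith
  qed (use z in auto)
  then show ?thesis by (simp add: fill_matrix_def)
qed

end

text \<open>\<open>MM_bound\<close> keeps the writes of \<open>MM\<close> below the simulated
  memory, and \<open>B \<ge> 3\<close> keeps the arrays 0, 1, 2 of its interface apart from
  it.\<close>

locale matmul_ram = ram +
  fixes MM :: prog and cM w :: real
  assumes MM_bound: "prog_bound MM \<le> B"
    and B_ge: "B \<ge> 3"
    and w_ge: "w \<ge> 2"
    and MM: "\<And>n A C s. n \<ge> 1 \<Longrightarrow> A \<in> carrier_mat n n \<Longrightarrow> C \<in> carrier_mat n n \<Longrightarrow>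
      reg s 0 = of_nat n \<Longrightarrow> stores_matrix (arr s 0) n A \<Longrightarrow> stores_matrix (arr s 1) n C \<Longrightarrow>
      runs_within MM s (cM * real n powr w) (\<lambda>s'. stores_matrix (arr s' 2) n (A * C))"
begin

definition matmul :: "nat \<Rightarrow> nat \<Rightarrow> nat \<Rightarrow> nat \<Rightarrow> prog" where
  "matmul z a b c = Seq (39 ::= V z |*| V z) (Seq (copy_array 0 (B + a) (B + 39))
     (Seq (copy_array 1 (B + b) (B + 39)) (Seq (Const (B + 40) 0) (Seq (Arith 0 Add (B + z) (B + 40))
       (Seq MM (copy_array (B + c) 2 (B + 39)))))))"

text \<open>\<open>cM\<close> comes from an existential statement and has no known sign, hence the
  absolute value. The 40 covers copying two factors in and the product out.\<close>

definition mm_time :: "nat \<Rightarrow> real" where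
  "mm_time n = (\<bar>cM\<bar> + 40) * real n powr w"

text \<open>Every quadratic overhead, for copying or filling, is charged to a matrix product in this
  way.\<close>

lemma n2_le_powr: "n \<ge> 1 \<Longrightarrow> real n * real n \<le> real n powr w"
  using powr_mono[OF w_ge, of "real n"] by (simp add: powr_numeral power2_eq_square)

lemma hrun_matmul:
  assumes z: "z < 39" "reg h z = of_nat n" "n \<ge> 1"
    and time: "mm_time n \<le> T"
    and post: "\<And>h' F. reg h' = (reg h)(39 := of_nat (n * n)) \<Longrightarrow> arr h' = (arr h)(c := F) \<Longrightarrow>
      (\<And>i j. i < n \<Longrightarrow> j < n \<Longrightarrow>
        F (i * n + j) = (\<Sum>l<n. arr h a (i * n + l) * arr h b (l * n + j))) \<Longrightarrow> Q h'"
  shows "hrun (matmul z a b c) h T Q"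
  unfolding hrun_def
proof (intro allI impI)
  fix s assume "sim s h"
  moreover have "hrun (39 ::= V z |*| V z) h 7 (\<lambda>h'. h' = set_reg 39 (of_nat (n * n)) h)"
    using z by (intro hrun_asg) auto
  ultimately obtain t1 s1 where 1: "exec (39 ::= V z |*| V z) s t1 s1" "real t1 \<le> 7"
    "sim s1 (set_reg 39 (of_nat (n * n)) h)"
    unfolding hrun_def by blast
  then have r1: "reg s1 (B + 39) = of_nat (n * n)" "reg s1 (B + z) = of_nat n"
    using z by (auto simp: sim_def)
  obtain t2 s2 where 2: "exec (copy_array 0 (B + a) (B + 39)) s1 t2 s2" "t2 \<le> 4 * (n * n) + 3"
    "arr s2 = (arr s1)(0 := \<lambda>x. if x < n * n then arr s1 (B + a) x else arr s1 0 x)"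
    "\<forall>x<B + 40. reg s2 x = reg s1 x"
    using exec_copy_array[OF r1(1), of "B + a" 0] B_ge by auto
  then have r2: "reg s2 (B + 39) = of_nat (n * n)" "reg s2 (B + z) = of_nat n"
    using r1 z by auto
  obtain t3 s3 where 3: "exec (copy_array 1 (B + b) (B + 39)) s2 t3 s3" "t3 \<le> 4 * (n * n) + 3"
    "arr s3 = (arr s2)(1 := \<lambda>x. if x < n * n then arr s2 (B + b) x else arr s2 1 x)"
    "\<forall>x<B + 40. reg s3 x = reg s2 x"
    using exec_copy_array[OF r2(1), of "B + b" 1] B_ge by auto
  let ?s4 = "set_reg (B + 40) 0 s3"
  let ?s5 = "set_reg 0 (apply_op Add (reg ?s4 (B + z)) (reg ?s4 (B + 40))) ?s4"
  define A where "A = Matrix.mat n n (\<lambda>(i, j). arr h a (i * n + j))"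
  define C where "C = Matrix.mat n n (\<lambda>(i, j). arr h b (i * n + j))"
  have ix: "i * n + j < n * n" if "i < n" "j < n" for i j :: nat
  proof -
    have "i * n + j < Suc i * n" using that by simp
    also have "\<dots> \<le> n * n" using that by (intro mult_right_mono) auto
    finally show ?thesis .
  qed
  have "stores_matrix (arr ?s5 0) n A" "stores_matrix (arr ?s5 1) n C"
    using B_ge 1(3) by (auto simp: stores_matrix_def A_def C_def 3(3) 2(3) ix sim_def)
  moreover have "reg ?s5 0 = of_nat n"
    using z r2 3(4) by simp
  ultimately obtain t6 s6 where 6: "exec MM ?s5 t6 s6" "real t6 \<le> cM * real n powr w"
    "stores_matrix (arr s6 2) n (A * C)"
    using MM[of n A C ?s5] z(3) unfolding runs_within_def by (auto simp: A_def C_def)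
  have f6: "reg s6 x = reg ?s5 x" "arr s6 x = arr ?s5 x" if "x \<ge> B" for x
    using exec_frame[OF 6(1), of x] MM_bound that by auto
  have r6: "reg s6 (B + 39) = of_nat (n * n)"
    using f6(1)[of "B + 39"] 3(4) r2 B_ge by auto
  obtain t7 s7 where 7: "exec (copy_array (B + c) 2 (B + 39)) s6 t7 s7" "t7 \<le> 4 * (n * n) + 3"
    "arr s7 = (arr s6)(B + c := \<lambda>x. if x < n * n then arr s6 2 x else arr s6 (B + c) x)"
    "\<forall>x<B + 40. reg s7 x = reg s6 x"
    using exec_copy_array[OF r6(1), of 2 "B + c"] B_ge by auto
  define F where "F = (\<lambda>x. if x < n * n then arr s6 2 x else arr s6 (B + c) x)"
  have e: "exec (matmul z a b c) s (t1 + (t2 + (t3 + (1 + (1 + (t6 + t7)))))) s7"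
    unfolding matmul_def
    by (rule exec.Seq[OF 1(1) exec.Seq[OF 2(1) exec.Seq[OF 3(1) exec.Seq[OF exec.Const
          exec.Seq[OF exec.Arith exec.Seq[OF 6(1) 7(1)]]]]]])
  have F: "F (i * n + j) = (\<Sum>l<n. arr h a (i * n + l) * arr h b (l * n + j))" if "i < n" "j < n" for i j
    using 6(3) that by (auto simp: stores_matrix_def F_def ix A_def C_def scalar_prod_def lessThan_atLeast0)
  let ?h = "h\<lparr>reg := (reg h)(39 := of_nat (n * n)), arr := (arr h)(c := F)\<rparr>"
  have "arr s7 (B + y) = arr ?h y" for y
    using f6(2)[of "B + y"] 1(3) B_ge by (auto simp: 7(3) 3(3) 2(3) F_def sim_def)
  moreover have "reg s7 (B + x) = reg ?h x" if "x < 40" for x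
    using that f6(1)[of "B + x"] 7(4) 3(4) 2(4) 1(3) B_ge by (auto simp: sim_def)
  ultimately have "sim s7 ?h"
    by (simp add: sim_def)
  moreover have "Q ?h"
    using F by (intro post) auto
  moreover have "real (t1 + (t2 + (t3 + (1 + (1 + (t6 + t7)))))) \<le> T"
  proof -
    have "real t2 \<le> 4 * (real n * real n) + 3" "real t3 \<le> 4 * (real n * real n) + 3"
      "real t7 \<le> 4 * (real n * real n) + 3"
      using 2(2) 3(2) 7(2) by (metis (mono_tags, opaque_lifting) of_nat_le_iff of_nat_add of_nat_mult of_nat_numeral)+
    moreover have "1 * 1 \<le> real n * real n"
      using z(3) by (intro mult_mono) auto
    moreover have "cM * real n powr w \<le> \<bar>cM\<bar> * real n powr w"
      by (intro mult_right_mono) auto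
    ultimately show ?thesis
      using 1(2) 6(2) n2_le_powr[OF z(3)] time unfolding mm_time_def by (simp add: algebra_simps)
  qed
  ultimately show "\<exists>t s' h'. exec (matmul z a b c) s t s' \<and> real t \<le> T \<and> sim s' h' \<and> Q h'"
    using e by blast
qed

end

section \<open>Inversion of positive definite matrices by blocks\<close>

text \<open>Matrices are plain functions with the dimension passed separately, so a block is just a
  shift of the indices and entries outside the range do not matter.\<close>

definition mmul :: "nat \<Rightarrow> (nat \<Rightarrow> nat \<Rightarrow> rat) \<Rightarrow> (nat \<Rightarrow> nat \<Rightarrow> rat) \<Rightarrow> nat \<Rightarrow> nat \<Rightarrow> rat" where
  "mmul b X Y i j = (\<Sum>l<b. X i l * Y l j)"

lemma mmul_assoc: "mmul b (mmul b X Y) Z = mmul b X (mmul b Y Z)"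
proof (intro ext)
  fix i j
  have "mmul b (mmul b X Y) Z i j = (\<Sum>k<b. \<Sum>l<b. X i l * Y l k * Z k j)"
    by (simp add: mmul_def sum_distrib_right)
  also have "\<dots> = (\<Sum>l<b. \<Sum>k<b. X i l * Y l k * Z k j)"
    by (rule sum.swap)
  also have "\<dots> = mmul b X (mmul b Y Z) i j"
    by (simp add: mmul_def sum_distrib_left mult.assoc)
  finally show "mmul b (mmul b X Y) Z i j = mmul b X (mmul b Y Z) i j" .
qed

lemma mmul_cong:
  "(\<And>l. l < b \<Longrightarrow> X i l = X' i l) \<Longrightarrow> (\<And>l. l < b \<Longrightarrow> Y l j = Y' l j) \<Longrightarrow> mmul b X Y i j = mmul b X' Y' i j"
  by (simp add: mmul_def)

lemma mmul_add_right: "mmul b X (\<lambda>i j. Y i j + Z i j) i j = mmul b X Y i j + mmul b X Z i j"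
  and mmul_minus_right: "mmul b X (\<lambda>i j. - Y i j) i j = - mmul b X Y i j"
  and mmul_diff_left: "mmul b (\<lambda>i j. Y i j - Z i j) X i j = mmul b Y X i j - mmul b Z X i j"
  by (simp_all add: mmul_def algebra_simps sum.distrib sum_negf sum_subtractf)

lemma sum_double: "(\<Sum>l<b + b. f l) = (\<Sum>l<b. f l) + (\<Sum>l<b. f (b + l))"
  for f :: "nat \<Rightarrow> rat"
proof (induction b)
  case (Suc b)
  have "f (b + b) + (\<Sum>l<b. f (b + l)) = f b + (\<Sum>l<b. f (Suc (b + l)))"
    using sum.lessThan_Suc[of "\<lambda>l. f (b + l)" b] sum.lessThan_Suc_shift[of "\<lambda>l. f (b + l)" b]
    by (simp add: add.commute)
  with Suc show ?case by simp
qed simp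

definition right_inverse :: "nat \<Rightarrow> (nat \<Rightarrow> nat \<Rightarrow> rat) \<Rightarrow> (nat \<Rightarrow> nat \<Rightarrow> rat) \<Rightarrow> bool" where
  "right_inverse n M X \<longleftrightarrow> (\<forall>i<n. \<forall>j<n. mmul n M X i j = of_bool (i = j))"

text \<open>Positivity of the quadratic form alone, without symmetry, passes to the upper left block
  and to the Schur complement, so it can serve as the invariant of the recursion.\<close>

definition pos_def :: "nat \<Rightarrow> (nat \<Rightarrow> nat \<Rightarrow> rat) \<Rightarrow> bool" where
  "pos_def n M \<longleftrightarrow> (\<forall>x. (\<exists>i<n. x i \<noteq> 0) \<longrightarrow> 0 < (\<Sum>i<n. x i * (\<Sum>j<n. M i j * x j)))"

lemma mmul_right_inverse:
  assumes "right_inverse b M X" "i < b"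
  shows "mmul b (mmul b M X) Y i j = Y i j"
proof -
  have "mmul b (mmul b M X) Y i j = (\<Sum>l<b. if l = i then Y l j else 0)"
    unfolding mmul_def[of b "mmul b M X"] using assms
    by (intro sum.cong) (auto simp: right_inverse_def)
  also have "\<dots> = Y i j"
    using assms(2) by simp
  finally show ?thesis .
qed

text \<open>Write \<open>M = (A B; C D)\<close> in blocks. With \<open>E = A^-1 B\<close>,
  \<open>F = C A^-1\<close> and the Schur complement \<open>S = D - C E\<close>, the inverse is
  \<open>(A^-1 + E S^-1 F, - E S^-1; - S^-1 F, S^-1)\<close>. Every intermediate product has a name
  because the program computes them one at a time; \<open>M X = I\<close> is checked block by
  block.\<close>

lemma right_inverse_block:
  assumes Ai: "right_inverse b M Ai"
    and E: "\<And>i j. i < b \<Longrightarrow> j < b \<Longrightarrow> E i j = mmul b Ai (\<lambda>i j. M i (b + j)) i j"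
    and S: "\<And>i j. i < b \<Longrightarrow> j < b \<Longrightarrow> S i j = M (b + i) (b + j) - mmul b (\<lambda>i j. M (b + i) j) E i j"
    and Si: "right_inverse b S Si"
    and F: "\<And>i j. i < b \<Longrightarrow> j < b \<Longrightarrow> F i j = mmul b (\<lambda>i j. M (b + i) j) Ai i j"
    and G: "\<And>i j. i < b \<Longrightarrow> j < b \<Longrightarrow> G i j = mmul b E Si i j"
    and P: "\<And>i j. i < b \<Longrightarrow> j < b \<Longrightarrow> P i j = mmul b G F i j"
    and Q: "\<And>i j. i < b \<Longrightarrow> j < b \<Longrightarrow> Q i j = mmul b Si F i j"
    and X: "\<And>i j. i < b \<Longrightarrow> j < b \<Longrightarrow> X i j = Ai i j + P i j"
      "\<And>i j. i < b \<Longrightarrow> j < b \<Longrightarrow> X i (b + j) = - G i j"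
      "\<And>i j. i < b \<Longrightarrow> j < b \<Longrightarrow> X (b + i) j = - Q i j"
      "\<And>i j. i < b \<Longrightarrow> j < b \<Longrightarrow> X (b + i) (b + j) = Si i j"
  shows "right_inverse (b + b) M X"
proof -
  define B where "B = (\<lambda>i j. M i (b + j))"
  define C where "C = (\<lambda>i j. M (b + i) j)"
  define D where "D = (\<lambda>i j. M (b + i) (b + j))"
  have split: "mmul (b + b) M X i j = mmul b M X i j + mmul b B (\<lambda>i j. X (b + i) j) i j" for i j
    by (simp add: mmul_def sum_double B_def)
  have split': "mmul (b + b) M X (b + i) j = mmul b C X i j + mmul b D (\<lambda>i j. X (b + i) j) i j" for i j
    by (simp add: mmul_def sum_double C_def D_def)
  have ME: "mmul b M E i j = B i j" if "i < b" "j < b" for i j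
  proof -
    have "mmul b M E i j = mmul b M (mmul b Ai B) i j"
      by (rule mmul_cong) (use that E in \<open>auto simp: B_def\<close>)
    then show ?thesis using mmul_right_inverse[OF Ai] that by (simp add: mmul_assoc)
  qed
  have MG: "mmul b M G i j = mmul b B Si i j" if "i < b" "j < b" for i j
  proof -
    have "mmul b M G i j = mmul b M (mmul b E Si) i j"
      by (rule mmul_cong) (use that G in auto)
    also have "\<dots> = mmul b (mmul b M E) Si i j" by (simp add: mmul_assoc)
    also have "\<dots> = mmul b B Si i j" by (rule mmul_cong) (use ME that in auto)
    finally show ?thesis .
  qed
  have MP: "mmul b M P i j = mmul b B Q i j" if "i < b" "j < b" for i j
  proof -
    have "mmul b M P i j = mmul b M (mmul b G F) i j"
      by (rule mmul_cong) (use that P in auto)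
    also have "\<dots> = mmul b (mmul b M G) F i j" by (simp add: mmul_assoc)
    also have "\<dots> = mmul b (mmul b B Si) F i j" by (rule mmul_cong) (use MG that in auto)
    also have "\<dots> = mmul b B (mmul b Si F) i j" by (simp add: mmul_assoc)
    also have "\<dots> = mmul b B Q i j" by (rule mmul_cong) (use Q that in auto)
    finally show ?thesis .
  qed
  have SSi: "mmul b D Si i j - mmul b C G i j = of_bool (i = j)" if "i < b" "j < b" for i j
  proof -
    have "mmul b C G i j = mmul b C (mmul b E Si) i j"
      by (rule mmul_cong) (use that G in auto)
    then have "mmul b D Si i j - mmul b C G i j = mmul b (\<lambda>i j. D i j - mmul b C E i j) Si i j"
      by (simp add: mmul_diff_left mmul_assoc)
    also have "\<dots> = mmul b S Si i j"
      by (rule mmul_cong) (use that S in \<open>auto simp: C_def D_def\<close>)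
    finally show ?thesis using Si that by (simp add: right_inverse_def)
  qed
  \<comment> \<open>This is \<open>D Si - C G = I\<close> multiplied by \<open>F\<close> from the
    right, as \<open>Q = Si F\<close> and \<open>P = G F\<close>.\<close>
  have DQ: "mmul b D Q i j - mmul b C P i j = F i j" if "i < b" "j < b" for i j
  proof -
    have "mmul b D Q i j = mmul b (mmul b D Si) F i j"
      unfolding mmul_assoc by (rule mmul_cong) (use that Q in auto)
    moreover have "mmul b C P i j = mmul b (mmul b C G) F i j"
      unfolding mmul_assoc by (rule mmul_cong) (use that P in auto)
    ultimately have "mmul b D Q i j - mmul b C P i j = (\<Sum>l<b. (mmul b D Si i l - mmul b C G i l) * F l j)"
      by (simp add: mmul_def[of b _ F] left_diff_distrib sum_subtractf)
    also have "\<dots> = (\<Sum>l<b. if l = i then F l j else 0)"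
      using that SSi by (intro sum.cong) auto
    finally show ?thesis using that by simp
  qed
  have CAi: "mmul b C Ai i j = F i j" if "i < b" "j < b" for i j
    using F that by (simp add: C_def)
  have "mmul (b + b) M X i j = of_bool (i = j)" if ij: "i < b + b" "j < b + b" for i j
  proof (cases "i < b"; cases "j < b")
    assume c: "i < b" "j < b"
    have "mmul b M X i j = mmul b M (\<lambda>i j. Ai i j + P i j) i j"
      by (rule mmul_cong) (use c X in auto)
    moreover have "mmul b B (\<lambda>i j. X (b + i) j) i j = mmul b B (\<lambda>i j. - Q i j) i j"
      by (rule mmul_cong) (use c X in auto)
    ultimately show ?thesis
      using c MP Ai by (simp add: split mmul_add_right mmul_minus_right right_inverse_def)
  next
    assume c: "i < b" "\<not> j < b"
    define j' where "j' = j - b"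
    have j: "j = b + j'" "j' < b" using c ij by (auto simp: j'_def)
    have "mmul b M X i j = mmul b M (\<lambda>i j. - G i j) i j'"
      unfolding mmul_def using j X(2) by (intro sum.cong) auto
    moreover have "mmul b B (\<lambda>i j. X (b + i) j) i j = mmul b B Si i j'"
      unfolding mmul_def using j X(4) by (intro sum.cong) auto
    ultimately show ?thesis
      using c j MG by (simp add: split mmul_minus_right)
  next
    assume c: "\<not> i < b" "j < b"
    define i' where "i' = i - b"
    have i: "i = b + i'" "i' < b" using c ij by (auto simp: i'_def)
    have "mmul b C X i' j = mmul b C (\<lambda>i j. Ai i j + P i j) i' j"
      by (rule mmul_cong) (use c X in auto)
    moreover have "mmul b D (\<lambda>i j. X (b + i) j) i' j = mmul b D (\<lambda>i j. - Q i j) i' j"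
      by (rule mmul_cong) (use c X in auto)
    ultimately show ?thesis
      using c i DQ[of i' j] CAi[of i' j] by (simp add: split' mmul_add_right mmul_minus_right)
  next
    assume c: "\<not> i < b" "\<not> j < b"
    define i' j' where "i' = i - b" and "j' = j - b"
    have i: "i = b + i'" "i' < b" and j: "j = b + j'" "j' < b"
      using c ij by (auto simp: i'_def j'_def)
    have "mmul b C X i' j = mmul b C (\<lambda>i j. - G i j) i' j'"
      unfolding mmul_def using j X(2) by (intro sum.cong) auto
    moreover have "mmul b D (\<lambda>i j. X (b + i) j) i' j = mmul b D Si i' j'"
      unfolding mmul_def using j X(4) by (intro sum.cong) auto
    ultimately show ?thesis
      using i j SSi[of i' j'] by (simp add: split' mmul_minus_right)
  qed
  then show ?thesis by (simp add: right_inverse_def)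
qed

lemma pos_def_upper_left:
  assumes "pos_def (b + b) M"
  shows "pos_def b M"
  unfolding pos_def_def
proof (intro allI impI)
  fix x :: "nat \<Rightarrow> rat" assume x: "\<exists>i<b. x i \<noteq> 0"
  let ?y = "\<lambda>i. if i < b then x i else 0"
  have "\<exists>i<b + b. ?y i \<noteq> 0"
    using x by (metis trans_less_add1)
  then have "0 < (\<Sum>i<b + b. ?y i * (\<Sum>j<b + b. M i j * ?y j))"
    using assms by (auto simp: pos_def_def)
  also have "\<dots> = (\<Sum>i<b. x i * (\<Sum>j<b. M i j * x j))"
    by (simp add: sum_double)
  finally show "0 < (\<Sum>i<b. x i * (\<Sum>j<b. M i j * x j))" .
qed

text \<open>The Schur complement is the form of \<open>M\<close> restricted to the vectors \<open>(- E x, x)\<close>.\<close>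

lemma pos_def_Schur_complement:
  assumes M: "pos_def (b + b) M" and Ai: "right_inverse b M Ai"
    and E: "\<And>i j. i < b \<Longrightarrow> j < b \<Longrightarrow> E i j = mmul b Ai (\<lambda>i j. M i (b + j)) i j"
    and S: "\<And>i j. i < b \<Longrightarrow> j < b \<Longrightarrow> S i j = M (b + i) (b + j) - mmul b (\<lambda>i j. M (b + i) j) E i j"
  shows "pos_def b S"
  unfolding pos_def_def
proof (intro allI impI)
  fix x :: "nat \<Rightarrow> rat" assume x: "\<exists>i<b. x i \<noteq> 0"
  define y where "y = (\<lambda>i. if i < b then - (\<Sum>j<b. E i j * x j) else x (i - b))"
  from x obtain i where "i < b" "x i \<noteq> 0" by blast
  then have "\<exists>i<b + b. y i \<noteq> 0"
    by (intro exI[of _ "b + i"]) (simp add: y_def)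
  then have "0 < (\<Sum>i<b + b. y i * (\<Sum>j<b + b. M i j * y j))"
    using M by (auto simp: pos_def_def)
  also have "\<dots> = (\<Sum>i<b. x i * (\<Sum>j<b. S i j * x j))"
  proof -
    have "(\<Sum>j<b + b. M i j * y j) = 0" if "i < b" for i
    proof -
      have "(\<Sum>j<b. M i j * (\<Sum>l<b. E j l * x l)) = mmul b (mmul b M E) (\<lambda>l _. x l) i 0"
        by (simp add: mmul_assoc mmul_def[of b M] mmul_def[of b E])
      also have "\<dots> = mmul b (\<lambda>i j. M i (b + j)) (\<lambda>l _. x l) i 0"
      proof (rule mmul_cong)
        fix l assume l: "l < b"
        have "mmul b M E i l = mmul b M (mmul b Ai (\<lambda>i j. M i (b + j))) i l"
          by (rule mmul_cong) (use l E in auto)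
        then show "mmul b M E i l = M i (b + l)"
          using mmul_right_inverse[OF Ai that] by (simp add: mmul_assoc)
      qed simp
      finally show ?thesis
        by (simp add: sum_double y_def sum_negf) (simp add: mmul_def)
    qed
    moreover have "(\<Sum>j<b + b. M (b + i) j * y j) = (\<Sum>j<b. S i j * x j)" if "i < b" for i
    proof -
      have "(\<Sum>j<b. M (b + i) j * (\<Sum>l<b. E j l * x l)) = (\<Sum>l<b. mmul b (\<lambda>i j. M (b + i) j) E i l * x l)"
        using fun_cong[OF fun_cong[OF mmul_assoc[of b "\<lambda>i j. M (b + i) j" E "\<lambda>l _. x l"], of i], of 0]
        by (simp add: mmul_def)
      then show ?thesis
        using that S by (simp add: sum_double y_def sum_negf left_diff_distrib sum_subtractf)
    qed
    ultimately show ?thesis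
      by (simp add: sum_double) (simp add: y_def)
  qed
  finally show "0 < (\<Sum>i<b. x i * (\<Sum>j<b. S i j * x j))" .
qed

lemma pos_def_singleton: "pos_def 1 M \<Longrightarrow> 0 < M 0 0"
  unfolding pos_def_def by (drule spec[of _ "\<lambda>_. 1"]) simp

section \<open>Leverage scores\<close>

text \<open>\<open>\<epsilon>\<close> is a ridge term that makes \<open>gram\<close> definite.
  \<open>X\<close> is meant to be the inverse of \<open>gram\<close>, but this is assumed only in a
  context further down: definiteness must be available before an inverse has been computed.\<close>

locale weighted_rows =
  fixes n m :: nat and a :: "nat \<Rightarrow> nat \<Rightarrow> rat" and d :: "nat \<Rightarrow> rat" and \<epsilon> :: rat
    and X :: "nat \<Rightarrow> nat \<Rightarrow> rat"
  assumes d_pos: "\<And>j. j < m \<Longrightarrow> 0 < d j" and eps_pos: "0 < \<epsilon>"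
begin

definition gram :: "nat \<Rightarrow> nat \<Rightarrow> rat" where
  "gram i t = of_bool (i = t) * \<epsilon> + (\<Sum>j<m. d j * a j i * a j t)"

definition dot :: "(nat \<Rightarrow> rat) \<Rightarrow> (nat \<Rightarrow> rat) \<Rightarrow> rat" where
  "dot f g = (\<Sum>i<n. f i * g i)"

definition form :: "(nat \<Rightarrow> rat) \<Rightarrow> (nat \<Rightarrow> rat) \<Rightarrow> rat" where
  "form f g = (\<Sum>i<n. f i * (\<Sum>t<n. gram i t * g t))"

text \<open>The bracketing is that of the program, which obtains the rows of \<open>A X\<close> from
  a matrix product and then takes one dot product per row.\<close>

definition leverage :: "nat \<Rightarrow> rat" where
  "leverage j = d j * (\<Sum>t<n. (\<Sum>l<n. a j l * X l t) * a j t)"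

lemma form_eq: "form f g = \<epsilon> * dot f g + (\<Sum>j<m. d j * dot (a j) f * dot (a j) g)"
proof -
  have "(\<Sum>t<n. gram i t * g t) = \<epsilon> * g i + (\<Sum>j<m. d j * a j i * dot (a j) g)" if "i < n" for i
  proof -
    have "(\<Sum>t<n. gram i t * g t) = (\<Sum>t<n. if t = i then \<epsilon> * g t else 0)
        + (\<Sum>t<n. \<Sum>j<m. d j * a j i * (a j t * g t))"
      unfolding sum.distrib[symmetric]
      by (intro sum.cong) (auto simp: gram_def sum_distrib_left algebra_simps)
    also have "(\<Sum>t<n. \<Sum>j<m. d j * a j i * (a j t * g t)) = (\<Sum>j<m. d j * a j i * dot (a j) g)"
      by (subst sum.swap) (simp add: dot_def sum_distrib_left)
    finally show ?thesis using that by simp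
  qed
  then have "form f g = (\<Sum>i<n. \<epsilon> * (f i * g i) + (\<Sum>j<m. d j * dot (a j) g * (a j i * f i)))"
    unfolding form_def by (intro sum.cong) (auto simp: sum_distrib_left algebra_simps)
  also have "\<dots> = \<epsilon> * dot f g + (\<Sum>i<n. \<Sum>j<m. d j * dot (a j) g * (a j i * f i))"
    by (simp add: sum.distrib dot_def sum_distrib_left)
  also have "(\<Sum>i<n. \<Sum>j<m. d j * dot (a j) g * (a j i * f i)) = (\<Sum>j<m. d j * dot (a j) f * dot (a j) g)"
    by (subst sum.swap) (simp add: dot_def[of _ f] sum_distrib_left mult_ac)
  finally show ?thesis .
qed

lemma form_sym: "form f g = form g f"
  by (simp add: form_eq dot_def mult_ac)

lemma dot_nonneg: "0 \<le> dot f f"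
  by (auto simp: dot_def intro: sum_nonneg)

lemma rows_nonneg: "0 \<le> (\<Sum>j<m. d j * dot (a j) f * dot (a j) f)"
proof (rule sum_nonneg)
  fix j assume "j \<in> {..<m}"
  then have "0 \<le> d j * (dot (a j) f * dot (a j) f)"
    using d_pos[of j] by (intro mult_nonneg_nonneg zero_le_square) auto
  then show "0 \<le> d j * dot (a j) f * dot (a j) f" by (simp add: mult.assoc)
qed

lemma form_nonneg: "0 \<le> form f f"
  unfolding form_eq using eps_pos by (intro add_nonneg_nonneg mult_nonneg_nonneg dot_nonneg rows_nonneg) auto

lemma form_pos:
  assumes "i < n" "f i \<noteq> 0"
  shows "0 < form f f"
proof -
  have "0 < f i * f i" using assms(2) by (auto simp: zero_less_mult_iff neq_iff)
  also have "\<dots> \<le> dot f f"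
    unfolding dot_def by (rule member_le_sum) (use assms in auto)
  finally have "0 < \<epsilon> * dot f f" using eps_pos by simp
  with rows_nonneg[of f] show ?thesis unfolding form_eq by linarith
qed

lemma pos_def_gram: "pos_def n gram"
  using form_pos unfolding pos_def_def form_def by blast

lemma form_lincomb:
  "form (\<lambda>i. p * f i - q * y i) (\<lambda>i. p * f i - q * y i) = p\<^sup>2 * form f f - 2 * p * q * form f y + q\<^sup>2 * form y y"
proof -
  have dot: "dot g (\<lambda>i. p * f i - q * y i) = p * dot g f - q * dot g y" for g
    by (simp add: dot_def algebra_simps sum_subtractf sum_distrib_left)
  have form: "form g (\<lambda>i. p * f i - q * y i) = p * form g f - q * form g y" for g
    by (simp add: form_eq dot algebra_simps sum_subtractf sum_distrib_left)
  show ?thesis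
    by (subst form, subst (1 2) form_sym, subst form, subst form)
      (simp add: form_sym[of y f] algebra_simps power2_eq_square)
qed

context
  assumes X: "right_inverse n gram X"
begin

lemma gram_X: "i < n \<Longrightarrow> (\<Sum>l<n. gram i l * (\<Sum>t<n. X l t * g t)) = g i"
  using mmul_right_inverse[OF X, of i "\<lambda>t _. g t" 0] by (simp add: mmul_assoc mmul_def)

lemma form_X: "form f (\<lambda>l. \<Sum>t<n. X l t * g t) = dot f g"
  unfolding form_def dot_def by (intro sum.cong) (auto simp: gram_X)

lemma leverage_eq: "leverage j = d j * form (\<lambda>l. \<Sum>t<n. X l t * a j t) (\<lambda>l. \<Sum>t<n. X l t * a j t)"
proof -
  have "(\<Sum>t<n. (\<Sum>l<n. a j l * X l t) * a j t) = (\<Sum>t<n. \<Sum>l<n. a j l * (X l t * a j t))"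
    by (simp add: sum_distrib_right mult.assoc)
  also have "\<dots> = dot (a j) (\<lambda>l. \<Sum>t<n. X l t * a j t)"
    by (subst sum.swap) (simp add: dot_def sum_distrib_left)
  also have "\<dots> = dot (\<lambda>l. \<Sum>t<n. X l t * a j t) (a j)"
    by (simp add: dot_def mult.commute)
  finally show ?thesis by (simp add: leverage_def form_X)
qed

lemma leverage_nonneg: "j < m \<Longrightarrow> 0 \<le> leverage j"
  unfolding leverage_eq using d_pos[of j] by (intro mult_nonneg_nonneg form_nonneg) auto

text \<open>Cauchy--Schwarz for the inner product \<open>form\<close>, in which \<open>X a\<^sub>j\<close> represents \<open>f \<mapsto> a\<^sub>j \<cdot> f\<close>.\<close>

lemma leverage_bound:
  assumes "j < m"
  shows "d j * (dot (a j) f)\<^sup>2 \<le> leverage j * form f f"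
proof -
  define y where "y = (\<lambda>l. \<Sum>t<n. X l t * a j t)"
  define p q where "p = dot (a j) f" and "q = form y y"
  have fy: "form f y = p"
    unfolding y_def form_X by (simp add: p_def dot_def mult.commute)
  have "p\<^sup>2 \<le> q * form f f"
  proof (cases "q = 0")
    case True
    then have "\<forall>i<n. y i = 0"
      using form_pos[of _ y] by (auto simp: q_def)
    then have "form f y = 0"
      by (simp add: form_def)
    with fy True show ?thesis by simp
  next
    case False
    then have q: "0 < q" using form_nonneg[of y] by (simp add: q_def)
    \<comment> \<open>\<open>q f - p y\<close> is \<open>q\<close> times the component of
      \<open>f\<close> orthogonal to \<open>y\<close> with respect to \<open>form\<close>, which
      avoids a division.\<close>
    have "0 \<le> form (\<lambda>i. q * f i - p * y i) (\<lambda>i. q * f i - p * y i)"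
      by (rule form_nonneg)
    also have "\<dots> = q * (q * form f f - p\<^sup>2)"
      unfolding form_lincomb fy by (simp add: q_def[symmetric] algebra_simps power2_eq_square)
    finally show ?thesis using q by (simp add: zero_le_mult_iff)
  qed
  then have "d j * p\<^sup>2 \<le> d j * (q * form f f)"
    using d_pos[OF assms] by simp
  then show ?thesis
    by (simp add: leverage_eq p_def q_def y_def mult.assoc)
qed

text \<open>The sum is the trace of \<open>X (H - \<epsilon> I)\<close>, that is
  \<open>n - \<epsilon> tr X\<close>. In each of the \<open>n - N\<close> padding coordinates
  \<open>H\<close> agrees with \<open>\<epsilon> I\<close>, so that coordinate contributes exactly 1
  to \<open>\<epsilon> tr X\<close>; the other diagonal entries of \<open>X\<close> are
  nonnegative.\<close>

lemma sum_leverage_le: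
  assumes N: "N \<le> n" and a0: "\<And>j t. j < m \<Longrightarrow> N \<le> t \<Longrightarrow> t < n \<Longrightarrow> a j t = 0"
  shows "(\<Sum>j<m. leverage j) \<le> of_nat N"
proof -
  have inv: "(\<Sum>l<n. gram t l * X l t) = 1" if "t < n" for t
    using X that by (simp add: right_inverse_def mmul_def)
  \<comment> \<open>Column \<open>t\<close> of \<open>X\<close> is \<open>X\<close> applied to a
    unit vector, so \<open>X t t\<close> is the square of its length with respect to
    \<open>form\<close>.\<close>
  have diag: "0 \<le> X t t" if "t < n" for t
  proof -
    let ?e = "\<lambda>i. of_bool (i = t) :: rat"
    have y: "(\<Sum>s<n. X l s * ?e s) = X l t" for l
    proof -
      have "(\<Sum>s<n. X l s * ?e s) = (\<Sum>s<n. if s = t then X l s else 0)"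
        by (intro sum.cong) auto
      then show ?thesis using that by simp
    qed
    have "dot (\<lambda>l. X l t) ?e = (\<Sum>s<n. if s = t then X s t else 0)"
      unfolding dot_def by (intro sum.cong) auto
    then have "form (\<lambda>l. X l t) (\<lambda>l. X l t) = X t t"
      using form_X[of "\<lambda>l. X l t" ?e] that unfolding y by simp
    with form_nonneg[of "\<lambda>l. X l t"] show ?thesis by simp
  qed
  have diag': "\<epsilon> * X t t = 1" if "N \<le> t" "t < n" for t
  proof -
    have "(\<Sum>l<n. gram t l * X l t) = (\<Sum>l<n. if l = t then \<epsilon> * X l t else 0)"
      using a0 that by (intro sum.cong) (auto simp: gram_def)
    then show ?thesis using inv[of t] that by simp
  qed
  have "(\<Sum>j<m. leverage j) = (\<Sum>j<m. \<Sum>t<n. \<Sum>l<n. d j * a j l * a j t * X l t)"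
    by (simp add: leverage_def sum_distrib_left sum_distrib_right mult_ac)
  also have "\<dots> = (\<Sum>t<n. \<Sum>j<m. \<Sum>l<n. d j * a j l * a j t * X l t)"
    by (rule sum.swap)
  also have "\<dots> = (\<Sum>t<n. \<Sum>l<n. \<Sum>j<m. d j * a j l * a j t * X l t)"
    by (rule sum.cong[OF refl], rule sum.swap)
  also have "\<dots> = (\<Sum>t<n. \<Sum>l<n. (\<Sum>j<m. d j * a j l * a j t) * X l t)"
    by (simp add: sum_distrib_right)
  also have "\<dots> = (\<Sum>t<n. \<Sum>l<n. gram t l * X l t - (if l = t then \<epsilon> * X l t else 0))"
    by (intro sum.cong) (auto simp: gram_def algebra_simps)
  also have "\<dots> = of_nat n - (\<Sum>t<n. \<epsilon> * X t t)"
    using inv by (simp add: sum_subtractf)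
  also have "(\<Sum>t<n. \<epsilon> * X t t) = (\<Sum>t<N. \<epsilon> * X t t) + (\<Sum>t\<in>{N..<n}. \<epsilon> * X t t)"
    using N by (metis atLeast0LessThan le0 sum.atLeastLessThan_concat)
  also have "(\<Sum>t\<in>{N..<n}. \<epsilon> * X t t) = of_nat (n - N)"
    using diag' by simp
  also have "of_nat n - ((\<Sum>t<N. \<epsilon> * X t t) + of_nat (n - N)) \<le> of_nat N - (\<Sum>t<N. \<epsilon> * X t t)"
    using N by simp
  also have "\<dots> \<le> of_nat N"
    using diag eps_pos N by (auto intro!: sum_nonneg mult_nonneg_nonneg)
  finally show ?thesis .
qed

text \<open>\<open>N + 1\<close> scores above \<open>N / (N + 1)\<close> would add up to more than
  \<open>N\<close>; no smaller threshold would follow from the sum in this way.\<close>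

lemma card_large_leverage_le:
  assumes N: "N \<le> n" and a0: "\<And>j t. j < m \<Longrightarrow> N \<le> t \<Longrightarrow> t < n \<Longrightarrow> a j t = 0"
  shows "card {j. j < m \<and> of_nat N < leverage j * (of_nat N + 1)} \<le> N"
proof (rule ccontr)
  let ?S = "{j. j < m \<and> of_nat N < leverage j * (of_nat N + 1)}"
  assume "\<not> card ?S \<le> N"
  then have "Suc N \<le> card ?S" and ne: "?S \<noteq> {}"
    by (simp, force)
  then have c: "of_nat N + 1 \<le> (of_nat (card ?S) :: rat)"
    using of_nat_mono[of "Suc N" "card ?S", where ?'a = rat] by simp
  have "(of_nat N + 1) * of_nat N \<le> of_nat (card ?S) * (of_nat N :: rat)"
    using c by (intro mult_right_mono) auto
  also have "\<dots> = (\<Sum>j\<in>?S. of_nat N)" by simp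
  also have "\<dots> < (\<Sum>j\<in>?S. leverage j * (of_nat N + 1))"
    by (rule sum_strict_mono) (use ne in auto)
  also have "\<dots> \<le> (\<Sum>j<m. leverage j * (of_nat N + 1))"
    using leverage_nonneg by (intro sum_mono2) auto
  also have "\<dots> \<le> of_nat N * (of_nat N + 1)"
    using sum_leverage_le[OF N a0] by (simp add: sum_distrib_right[symmetric] mult_right_mono)
  finally show False by (simp add: mult.commute)
qed

end

end

text \<open>The additional \<open>2 * \<delta> ^ m\<close> closes the induction, because
  \<open>\<delta> ^ m + 2 * \<delta> ^ Suc m \<le> 2 * \<delta> ^ m\<close>. It also leaves room for
  the ridge term, which has weight \<open>\<delta> ^ m\<close>.\<close>

lemma sum_powers_le:
  fixes \<delta> :: rat
  assumes "0 < \<delta>" "\<delta> \<le> 1 / 2" "j < m"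
  shows "(\<Sum>i\<in>{Suc j..<m}. \<delta> ^ i) + 2 * \<delta> ^ m \<le> 2 * \<delta> ^ Suc j"
  using assms(3)
proof (induction m)
  case (Suc m)
  show ?case
  proof (cases "j = m")
    case False
    then have "j < m" using Suc.prems by simp
    moreover have "\<delta> * \<delta> ^ m \<le> 1 / 2 * \<delta> ^ m"
      using assms by (intro mult_right_mono) auto
    ultimately show ?thesis
      using Suc.IH by (simp add: algebra_simps)
  qed simp
qed simp

text \<open>Let \<open>p\<close> be the first row on which \<open>f\<close> does not vanish. It
  contributes \<open>u \<ge> \<delta> ^ p\<close> to \<open>form f f\<close>, while the later rows
  and the ridge together contribute \<open>v \<le> 2 * C * \<delta> ^ Suc p \<le> \<delta> ^ p / (2
  * N)\<close>. By \<open>leverage_bound\<close> the score is at least \<open>u / (u + v)\<close>,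
  which exceeds \<open>N / (N + 1)\<close> as soon as \<open>N * v < u\<close>. Of the factor 4 in
  the assumption on \<open>\<delta>\<close>, one 2 pays for the geometric sum and the other makes
  this inequality strict.\<close>

lemma (in weighted_rows) large_leverage_detects:
  fixes \<delta> C :: rat
  assumes X: "right_inverse n gram X"
    and d: "\<And>j. j < m \<Longrightarrow> d j = \<delta> ^ j" and eps: "\<epsilon> = \<delta> ^ m"
    and \<delta>: "0 < \<delta>" "4 * of_nat N * C * \<delta> \<le> 1" and N: "1 \<le> N" and C: "1 \<le> C"
    and f: "dot f f \<le> C" "\<And>i. i < m \<Longrightarrow> (dot (a i) f)\<^sup>2 \<le> C"
      "\<And>i. i < m \<Longrightarrow> dot (a i) f \<noteq> 0 \<Longrightarrow> 1 \<le> (dot (a i) f)\<^sup>2"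
    and j: "j < m" "dot (a j) f \<noteq> 0"
  shows "\<exists>j<m. of_nat N < leverage j * (of_nat N + 1) \<and> dot (a j) f \<noteq> 0"
proof -
  define p where "p = (LEAST j. j < m \<and> dot (a j) f \<noteq> 0)"
  have p: "p < m" "dot (a p) f \<noteq> 0"
    using LeastI[of "\<lambda>j. j < m \<and> dot (a j) f \<noteq> 0" j] j unfolding p_def by auto
  have before: "dot (a i) f = 0" if "i < p" for i
    using not_less_Least[of i "\<lambda>j. j < m \<and> dot (a j) f \<noteq> 0"] that p(1) unfolding p_def by auto
  have "1 * 1 \<le> of_nat N * C"
    using N C by (intro mult_mono) auto
  then have "4 * \<delta> \<le> 4 * (of_nat N * C) * \<delta>"
    using \<delta>(1) by simp
  also have "\<dots> = 4 * of_nat N * C * \<delta>" by simp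
  finally have half: "\<delta> \<le> 1 / 2" using \<delta> by linarith
  show ?thesis
  proof (rule exI[of _ p], intro conjI p, rule ccontr)
    assume "\<not> of_nat N < leverage p * (of_nat N + 1)"
    then have le: "leverage p * (of_nat N + 1) \<le> of_nat N" by simp
    define u where "u = d p * (dot (a p) f)\<^sup>2"
    define v where "v = \<epsilon> * dot f f + (\<Sum>i\<in>{Suc p..<m}. d i * (dot (a i) f)\<^sup>2)"
    have "form f f = \<epsilon> * dot f f + (\<Sum>i<m. d i * (dot (a i) f)\<^sup>2)"
      by (simp add: form_eq power2_eq_square mult.assoc)
    also have "(\<Sum>i<m. d i * (dot (a i) f)\<^sup>2) = (\<Sum>i\<in>{p..<m}. d i * (dot (a i) f)\<^sup>2)"
      using before by (intro sum.mono_neutral_right) auto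
    also have "\<dots> = u + (\<Sum>i\<in>{Suc p..<m}. d i * (dot (a i) f)\<^sup>2)"
      using p(1) by (simp add: sum.atLeast_Suc_lessThan u_def)
    finally have form: "form f f = u + v" by (simp add: v_def)
    have "v \<le> \<delta> ^ m * C + (\<Sum>i\<in>{Suc p..<m}. \<delta> ^ i * C)"
      unfolding v_def eps using \<delta>(1) f d
      by (intro add_mono mult_left_mono sum_mono) auto
    also have "\<dots> = C * ((\<Sum>i\<in>{Suc p..<m}. \<delta> ^ i) + \<delta> ^ m)"
      by (simp add: sum_distrib_left algebra_simps)
    also have "\<dots> \<le> C * (2 * \<delta> ^ Suc p)"
      using sum_powers_le[OF \<delta>(1) half p(1)] \<delta>(1) C zero_less_power[OF \<delta>(1), of m]
      by (intro mult_left_mono) linarith+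
    finally have v: "v \<le> C * (2 * \<delta> ^ Suc p)" .
    have "u * (of_nat N + 1) \<le> leverage p * form f f * (of_nat N + 1)"
      using leverage_bound[OF X p(1), of f] by (simp add: u_def mult_right_mono)
    also have "\<dots> = (leverage p * (of_nat N + 1)) * form f f" by simp
    also have "\<dots> \<le> of_nat N * (u + v)"
      unfolding form[symmetric] using le form_nonneg by (rule mult_right_mono)
    finally have "u \<le> of_nat N * v" by (simp add: algebra_simps)
    also have "\<dots> \<le> of_nat N * (C * (2 * \<delta> ^ Suc p))"
      using v by (rule mult_left_mono) simp
    also have "\<dots> = (4 * of_nat N * C * \<delta>) * \<delta> ^ p / 2" by simp
    also have "\<dots> \<le> 1 * \<delta> ^ p / 2"
      using \<delta> by (intro divide_right_mono mult_right_mono) auto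
    finally have "u \<le> \<delta> ^ p / 2" by simp
    moreover have "\<delta> ^ p * 1 \<le> u"
      unfolding u_def d[OF p(1)] using f(3)[OF p] \<delta>(1) by (intro mult_left_mono) auto
    ultimately show False using zero_less_power[OF \<delta>(1), of p] by linarith
  qed
qed

section \<open>Tensor products of Vandermonde vectors\<close>

text \<open>Indices below \<open>r ^ k\<close> are read as \<open>k\<close>-digit numbers in base \<open>r\<close>.\<close>

fun tensor :: "nat \<Rightarrow> nat \<Rightarrow> (nat \<Rightarrow> nat \<Rightarrow> rat) \<Rightarrow> nat \<Rightarrow> rat" where
  "tensor r 0 g t = 1"
| "tensor r (Suc k) g t = tensor r k g (t mod r ^ k) * g k (t div r ^ k)"

lemma tensor_mult: "tensor r k f t * tensor r k g t = tensor r k (\<lambda>i d. f i d * g i d) t"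
  by (induction k arbitrary: t) (simp_all add: mult_ac)

lemma abs_tensor: "\<bar>tensor r k g t\<bar> = tensor r k (\<lambda>i d. \<bar>g i d\<bar>) t"
  by (induction k arbitrary: t) (simp_all add: abs_mult)

lemma sum_digits:
  fixes g :: "nat \<Rightarrow> nat \<Rightarrow> rat"
  assumes "s > 0"
  shows "(\<Sum>t<r * s. g (t mod s) (t div s)) = (\<Sum>d<r. \<Sum>u<s. g u d)"
proof -
  have "(\<Sum>t<r * s. g (t mod s) (t div s)) = (\<Sum>d<r. \<Sum>t\<in>{d * s..<d * s + s}. g (t mod s) (t div s))"
    by (rule sum.nat_group[symmetric])
  also have "\<dots> = (\<Sum>d<r. \<Sum>u<s. g u d)"
  proof (rule sum.cong[OF refl])
    fix d
    have "(\<Sum>t\<in>{d * s..<d * s + s}. g (t mod s) (t div s))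
        = (\<Sum>u\<in>{0..<s}. g ((u + d * s) mod s) ((u + d * s) div s))"
      using sum.shift_bounds_nat_ivl[of "\<lambda>t. g (t mod s) (t div s)" 0 "d * s" s] by (simp add: add.commute)
    also have "\<dots> = (\<Sum>u<s. g u d)"
      using assms by (simp add: lessThan_atLeast0)
    finally show "(\<Sum>t\<in>{d * s..<d * s + s}. g (t mod s) (t div s)) = (\<Sum>u<s. g u d)" .
  qed
  finally show ?thesis .
qed

text \<open>The distributive law: expanding the product chooses one index per factor, and these
  choices are the digits of \<open>t\<close>.\<close>

lemma sum_tensor:
  assumes "r \<ge> 1"
  shows "(\<Sum>t<r ^ k. tensor r k g t) = (\<Prod>i<k. \<Sum>d<r. g i d)"
proof (induction k)
  case (Suc k)
  have "(\<Sum>t<r ^ Suc k. tensor r (Suc k) g t) = (\<Sum>d<r. \<Sum>u<r ^ k. tensor r k g u * g k d)"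
    using sum_digits[of "r ^ k" "\<lambda>u d. tensor r k g u * g k d" r] assms by simp
  also have "\<dots> = (\<Sum>u<r ^ k. tensor r k g u) * (\<Sum>d<r. g k d)"
    by (simp add: sum_distrib_left sum_distrib_right)
  finally show ?case using Suc by simp
qed simp

text \<open>Entry \<open>t\<close> is the monomial whose exponents are the digits of
  \<open>t\<close>. A linear form on these vectors is therefore a polynomial of degree less than
  \<open>r\<close> in each coordinate.\<close>

definition vandermonde :: "nat \<Rightarrow> nat \<Rightarrow> nat list \<Rightarrow> nat \<Rightarrow> rat" where
  "vandermonde r k x = tensor r k (\<lambda>i d. of_nat (x ! i) ^ d)"

lemma vandermonde_low: "t < r ^ i \<Longrightarrow> vandermonde r (Suc i) x t = vandermonde r i x t"
  by (simp add: vandermonde_def)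

text \<open>Raising the leading digit of the index by 1 multiplies the entry by
  \<open>x ! i\<close>, so the program can extend a vector at the cost of one multiplication per
  entry.\<close>

lemma vandermonde_shift:
  "r \<ge> 1 \<Longrightarrow> vandermonde r (Suc i) x (r ^ i + u) = vandermonde r (Suc i) x u * of_nat (x ! i)"
  by (simp add: vandermonde_def)

text \<open>Multiplying a polynomial by \<open>x - y\<close> multiplies the sum of the absolute
  values of its coefficients by at most \<open>1 + y \<le> W\<close>. The coefficients are chosen
  before \<open>r\<close>, since the induction step uses the same ones for the lengths
  \<open>s\<close> and \<open>Suc s\<close>.\<close>

lemma polynomial_with_roots:
  assumes "finite Y" "\<And>y. y \<in> Y \<Longrightarrow> Suc y \<le> W"
  shows "\<exists>c :: nat \<Rightarrow> rat. \<forall>r > card Y. (\<forall>x. (\<Sum>d<r. c d * x ^ d) = (\<Prod>y\<in>Y. x - of_nat y)) \<and>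
    (\<Sum>d<r. \<bar>c d\<bar>) \<le> of_nat W ^ card Y"
  using assms
proof (induction Y)
  case empty
  have "(\<Sum>d<r. of_bool (d = 0) * x ^ d) = (1::rat)" "(\<Sum>d<r. \<bar>of_bool (d = 0)\<bar>) = (1::rat)"
    if "r > 0" for r :: nat and x :: rat
    using that by (cases r; simp add: sum.lessThan_Suc_shift)+
  then show ?case by (intro exI[of _ "\<lambda>d. of_bool (d = 0)"]) auto
next
  case (insert y Y)
  then obtain c :: "nat \<Rightarrow> rat" where
    c: "\<And>r x. r > card Y \<Longrightarrow> (\<Sum>d<r. c d * x ^ d) = (\<Prod>y\<in>Y. x - of_nat y)"
    "\<And>r. r > card Y \<Longrightarrow> (\<Sum>d<r. \<bar>c d\<bar>) \<le> of_nat W ^ card Y"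
    by auto
  \<comment> \<open>Coefficients of the old polynomial multiplied by \<open>x - y\<close>.\<close>
  define c' where "c' d = (case d of 0 \<Rightarrow> 0 | Suc e \<Rightarrow> c e) - of_nat y * c d" for d
  have shift: "(\<Sum>d<Suc s. (case d of 0 \<Rightarrow> 0 | Suc e \<Rightarrow> f e)) = (\<Sum>e<s. f e)" for s and f :: "nat \<Rightarrow> rat"
    by (subst sum.lessThan_Suc_shift) simp
  show ?case
  proof (intro exI[of _ c'] allI impI conjI)
    fix r and x :: rat assume r: "card (insert y Y) < r"
    then obtain s where s: "r = Suc s" "card Y < s"
      using insert.hyps by (cases r) auto
    have "(\<Sum>d<r. c' d * x ^ d)
        = (\<Sum>d<Suc s. (case d of 0 \<Rightarrow> 0 | Suc e \<Rightarrow> x * (c e * x ^ e)) - of_nat y * (c d * x ^ d))"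
      unfolding s by (intro sum.cong) (auto simp: c'_def algebra_simps split: nat.split)
    also have "\<dots> = x * (\<Sum>e<s. c e * x ^ e) - of_nat y * (\<Sum>d<Suc s. c d * x ^ d)"
      unfolding sum_subtractf shift sum_distrib_left[symmetric] by simp
    also have "\<dots> = (x - of_nat y) * (\<Prod>y\<in>Y. x - of_nat y)"
      using c(1)[of s] c(1)[of "Suc s"] s(2) by (simp add: left_diff_distrib)
    finally show "(\<Sum>d<r. c' d * x ^ d) = (\<Prod>y\<in>insert y Y. x - of_nat y)"
      using insert.hyps by simp
  next
    fix r assume r: "card (insert y Y) < r"
    then obtain s where s: "r = Suc s" "card Y < s"
      using insert.hyps by (cases r) auto
    have "(\<Sum>d<r. \<bar>c' d\<bar>) \<le> (\<Sum>d<Suc s. (case d of 0 \<Rightarrow> 0 | Suc e \<Rightarrow> \<bar>c e\<bar>) + of_nat y * \<bar>c d\<bar>)"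
      unfolding s
    proof (rule sum_mono)
      fix d
      show "\<bar>c' d\<bar> \<le> (case d of 0 \<Rightarrow> 0 | Suc e \<Rightarrow> \<bar>c e\<bar>) + of_nat y * \<bar>c d\<bar>"
        unfolding c'_def by (rule order_trans[OF abs_triangle_ineq4]) (auto simp: abs_mult split: nat.split)
    qed
    also have "\<dots> = (\<Sum>e<s. \<bar>c e\<bar>) + of_nat y * (\<Sum>d<Suc s. \<bar>c d\<bar>)"
      unfolding sum.distrib shift sum_distrib_left[symmetric] by simp
    also have "\<dots> \<le> of_nat W ^ card Y + of_nat y * of_nat W ^ card Y"
      using c(2)[of s] c(2)[of "Suc s"] s(2) by (intro add_mono mult_left_mono) auto
    also have "\<dots> = of_nat (Suc y) * of_nat W ^ card Y"
      by (simp add: algebra_simps)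
    also have "\<dots> \<le> of_nat W * of_nat W ^ card Y"
      using insert.prems by (intro mult_right_mono) (auto simp del: of_nat_Suc)
    finally show "(\<Sum>d<r. \<bar>c' d\<bar>) \<le> of_nat W ^ card (insert y Y)"
      using insert.hyps by simp
  qed
qed

text \<open>
  Elements of \<open>b ! i\<close> that exceed every coordinate can be ignored; this is what keeps the
  coefficients bounded in terms of the input.
\<close>

lemma compatibility_polynomial:
  assumes b: "b \<in> subset_tuples k (r - 1)" and r: "r \<ge> 1" and W: "W \<ge> 1"
  obtains f :: "nat \<Rightarrow> rat" where
    "(\<Sum>t<r ^ k. \<bar>f t\<bar>) \<le> (of_nat W ^ r) ^ k"
    "\<And>x. \<forall>i<k. Suc (x ! i) \<le> W \<Longrightarrow> (\<Sum>t<r ^ k. vandermonde r k x t * f t) \<noteq> 0 \<longleftrightarrow> compatible k x b"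
    "\<And>x. \<forall>i<k. Suc (x ! i) \<le> W \<Longrightarrow> \<bar>\<Sum>t<r ^ k. vandermonde r k x t * f t\<bar> \<le> (of_nat W ^ r) ^ k"
    "\<And>x. (\<Sum>t<r ^ k. vandermonde r k x t * f t) \<in> \<int>"
proof -
  define Y where "Y i = {y \<in> b ! i. Suc y \<le> W}" for i
  have Y: "finite (Y i)" "card (Y i) < r" if "i < k" for i
  proof -
    have "b ! i \<in> set b" using b that by (simp add: subset_tuples_def)
    then have "finite (b ! i)" "card (b ! i) = r - 1"
      using b by (auto simp: subset_tuples_def)
    then show "finite (Y i)" "card (Y i) < r"
      using card_mono[of "b ! i" "Y i"] r by (auto simp: Y_def)
  qed
  have "\<forall>i. \<exists>c :: nat \<Rightarrow> rat. i < k \<longrightarrow> (\<forall>x. (\<Sum>d<r. c d * x ^ d) = (\<Prod>y\<in>Y i. x - of_nat y)) \<and>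
    (\<Sum>d<r. \<bar>c d\<bar>) \<le> of_nat W ^ card (Y i)"
  proof
    fix i
    show "\<exists>c :: nat \<Rightarrow> rat. i < k \<longrightarrow> (\<forall>x. (\<Sum>d<r. c d * x ^ d) = (\<Prod>y\<in>Y i. x - of_nat y)) \<and>
      (\<Sum>d<r. \<bar>c d\<bar>) \<le> of_nat W ^ card (Y i)"
    proof (cases "i < k")
      case True
      from polynomial_with_roots[OF Y(1)[OF this], of W] obtain c :: "nat \<Rightarrow> rat" where
        "\<forall>r > card (Y i). (\<forall>x. (\<Sum>d<r. c d * x ^ d) = (\<Prod>y\<in>Y i. x - of_nat y)) \<and>
          (\<Sum>d<r. \<bar>c d\<bar>) \<le> of_nat W ^ card (Y i)"
        by (auto simp: Y_def)
      with Y(2)[OF True] show ?thesis by blast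
    qed simp
  qed
  then obtain c :: "nat \<Rightarrow> nat \<Rightarrow> rat" where
    c: "\<And>i x. i < k \<Longrightarrow> (\<Sum>d<r. c i d * x ^ d) = (\<Prod>y\<in>Y i. x - of_nat y)"
    "\<And>i. i < k \<Longrightarrow> (\<Sum>d<r. \<bar>c i d\<bar>) \<le> of_nat W ^ card (Y i)"
    by metis
  have pow: "of_nat W ^ card (Y i) \<le> (of_nat W ^ r :: rat)" if "i < k" for i
    using Y(2)[OF that] W by (intro power_increasing) auto
  have eval: "(\<Sum>t<r ^ k. vandermonde r k x t * tensor r k c t) = (\<Prod>i<k. \<Prod>y\<in>Y i. of_nat (x ! i) - of_nat y)"
    for x
  proof -
    have "(\<Sum>t<r ^ k. vandermonde r k x t * tensor r k c t)
        = (\<Prod>i<k. \<Sum>d<r. of_nat (x ! i) ^ d * c i d)"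
      unfolding vandermonde_def tensor_mult by (rule sum_tensor[OF r])
    also have "\<dots> = (\<Prod>i<k. \<Prod>y\<in>Y i. of_nat (x ! i) - of_nat y)"
      by (intro prod.cong refl) (simp add: c(1)[symmetric] mult.commute)
    finally show ?thesis .
  qed
  show thesis
  proof (rule that[of "tensor r k c"])
    have "(\<Sum>t<r ^ k. \<bar>tensor r k c t\<bar>) = (\<Prod>i<k. \<Sum>d<r. \<bar>c i d\<bar>)"
      unfolding abs_tensor by (rule sum_tensor[OF r])
    also have "\<dots> \<le> (\<Prod>i<k. of_nat W ^ r)"
      using c(2) pow by (intro prod_mono conjI sum_nonneg) (auto intro: order_trans)
    finally show "(\<Sum>t<r ^ k. \<bar>tensor r k c t\<bar>) \<le> (of_nat W ^ r) ^ k" by simp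
  next
    fix x :: "nat list" assume x: "\<forall>i<k. Suc (x ! i) \<le> W"
    have "(\<Prod>i<k. \<Prod>y\<in>Y i. of_nat (x ! i) - (of_nat y :: rat)) \<noteq> 0 \<longleftrightarrow> (\<forall>i<k. x ! i \<notin> Y i)"
      using Y(1) by (auto simp: prod_zero_iff)
    also have "\<dots> \<longleftrightarrow> compatible k x b"
      using x by (auto simp: compatible_def Y_def)
    finally show "(\<Sum>t<r ^ k. vandermonde r k x t * tensor r k c t) \<noteq> 0 \<longleftrightarrow> compatible k x b"
      unfolding eval .
    have fac: "\<bar>of_nat (x ! i) - of_nat y\<bar> \<le> (of_nat W :: rat)" if "i < k" "y \<in> Y i" for i y
    proof -
      have "x ! i < W" "y < W" using x that by (auto simp: Y_def Suc_le_eq)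
      then have "(of_nat (x ! i) :: rat) \<le> of_nat W" "(of_nat y :: rat) \<le> of_nat W" by auto
      then show ?thesis by (auto simp: abs_le_iff)
    qed
    have "\<bar>\<Prod>i<k. \<Prod>y\<in>Y i. of_nat (x ! i) - (of_nat y :: rat)\<bar> \<le> (\<Prod>i<k. of_nat W ^ r)"
      unfolding abs_prod
    proof (intro prod_mono conjI prod_nonneg)
      fix i assume i: "i \<in> {..<k}"
      have "(\<Prod>y\<in>Y i. \<bar>of_nat (x ! i) - (of_nat y :: rat)\<bar>) \<le> (\<Prod>y\<in>Y i. of_nat W)"
        using fac i by (intro prod_mono) auto
      also have "\<dots> \<le> of_nat W ^ r" using pow i by simp
      finally show "(\<Prod>y\<in>Y i. \<bar>of_nat (x ! i) - (of_nat y :: rat)\<bar>) \<le> of_nat W ^ r" .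
    qed auto
    then show "\<bar>\<Sum>t<r ^ k. vandermonde r k x t * tensor r k c t\<bar> \<le> (of_nat W ^ r) ^ k"
      unfolding eval by simp
  next
    fix x show "(\<Sum>t<r ^ k. vandermonde r k x t * tensor r k c t) \<in> \<int>"
      unfolding eval by (intro Ints_prod Ints_diff Ints_of_nat)
  qed
qed

lemma one_le_square_Ints:
  fixes q :: rat assumes "q \<in> \<int>" "q \<noteq> 0" shows "1 \<le> q\<^sup>2"
proof -
  from assms obtain z where z: "q = of_int z" "z \<noteq> 0" by (auto elim: Ints_cases)
  then have "1 \<le> z\<^sup>2" by (simp add: int_one_le_iff_zero_less)
  then have "(of_int 1 :: rat) \<le> of_int (z\<^sup>2)" by (simp only: of_int_le_iff)
  then show ?thesis using z by simp
qed

text \<open>This is \<open>1 / (4 * N * C)\<close> as \<open>large_leverage_detects\<close> asks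
  for, where \<open>C\<close>, the square of \<open>(W ^ r) ^ k\<close>, bounds the squared values
  of the form and the square of its length. The nested power is how the program computes it.\<close>

definition step_weight :: "nat \<Rightarrow> nat \<Rightarrow> nat \<Rightarrow> rat" where
  "step_weight r k W = 1 / (4 * of_nat (r ^ k) * ((of_nat W ^ r) ^ k * (of_nat W ^ r) ^ k))"

text \<open>For each \<open>b\<close>, the coefficients of the compatibility polynomial, padded with
  zeros, form the vector to which \<open>large_leverage_detects\<close> is applied. The polynomial
  takes integral values, so a nonzero value has square at least 1.\<close>

lemma represents_large_leverage:
  fixes xs :: "nat list list" and r k n W :: nat and X :: "nat \<Rightarrow> nat \<Rightarrow> rat"
  defines "m \<equiv> length xs"
  defines "a \<equiv> \<lambda>j t. if t < r ^ k then vandermonde r k (xs ! j) t else 0"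
  defines "\<delta> \<equiv> step_weight r k W"
  assumes r: "r \<ge> 1" and W: "W \<ge> 1"
    and xs: "\<And>x. x \<in> set xs \<Longrightarrow> length x = k" "\<And>x i. x \<in> set xs \<Longrightarrow> i < k \<Longrightarrow> Suc (x ! i) \<le> W"
    and n: "r ^ k \<le> n"
    and X: "right_inverse n (weighted_rows.gram m a (power \<delta>) (\<delta> ^ m)) X"
  defines "S \<equiv> {j. j < m \<and> of_nat (r ^ k) < weighted_rows.leverage n a (power \<delta>) X j * (of_nat (r ^ k) + 1)}"
  shows "card S \<le> r ^ k" "represents k (r - 1) ((!) xs ` S) (set xs)"
proof -
  have Wpos: "1 \<le> (of_nat W ^ r :: rat) ^ k" using W by simp
  have \<delta>: "0 < \<delta>" unfolding \<delta>_def step_weight_def using r W by simp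
  interpret weighted_rows n m a "power \<delta>" "\<delta> ^ m" X
    by unfold_locales (use \<delta> in auto)
  show "card S \<le> r ^ k"
    unfolding S_def using X n by (intro card_large_leverage_le) (auto simp: a_def)
  have dot: "dot (a j) f = (\<Sum>t<r ^ k. vandermonde r k (xs ! j) t * f t)" for j f
  proof -
    have "dot (a j) f = (\<Sum>t<r ^ k. a j t * f t)"
      unfolding dot_def using n by (intro sum.mono_neutral_right) (auto simp: a_def)
    then show ?thesis by (simp add: a_def)
  qed
  have "\<exists>j\<in>S. compatible k (xs ! j) b" if b: "b \<in> subset_tuples k (r - 1)" and x: "x \<in> set xs" "compatible k x b" for b x
  proof -
    from compatibility_polynomial[OF b r W] obtain f :: "nat \<Rightarrow> rat" where
      f: "(\<Sum>t<r ^ k. \<bar>f t\<bar>) \<le> (of_nat W ^ r) ^ k"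
      "\<And>x. \<forall>i<k. Suc (x ! i) \<le> W \<Longrightarrow> (\<Sum>t<r ^ k. vandermonde r k x t * f t) \<noteq> 0 \<longleftrightarrow> compatible k x b"
      "\<And>x. \<forall>i<k. Suc (x ! i) \<le> W \<Longrightarrow> \<bar>\<Sum>t<r ^ k. vandermonde r k x t * f t\<bar> \<le> (of_nat W ^ r) ^ k"
      "\<And>x. (\<Sum>t<r ^ k. vandermonde r k x t * f t) \<in> \<int>" by blast
    define g where "g t = (if t < r ^ k then f t else 0)" for t
    have dg: "dot (a j) g = (\<Sum>t<r ^ k. vandermonde r k (xs ! j) t * f t)" for j
      unfolding dot by (simp add: g_def)
    let ?C = "(of_nat W ^ r) ^ k * (of_nat W ^ r) ^ k :: rat"
    have ok: "\<forall>i<k. Suc (xs ! j ! i) \<le> W" if "j < m" for j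
      using xs that by (auto simp: m_def)
    from x(1) obtain j where j: "j < m" "xs ! j = x" by (auto simp: in_set_conv_nth m_def)
    have "\<exists>j<m. of_nat (r ^ k) < leverage j * (of_nat (r ^ k) + 1) \<and> dot (a j) g \<noteq> 0"
    proof (rule large_leverage_detects[where C = ?C])
      show "4 * of_nat (r ^ k) * ?C * \<delta> \<le> 1"
        using r W by (simp add: \<delta>_def step_weight_def)
      show "1 \<le> ?C" using mult_mono[OF Wpos Wpos] by simp
      show "1 \<le> r ^ k" using r by simp
      have "dot g g = (\<Sum>t<r ^ k. g t * g t)"
        unfolding dot_def using n by (intro sum.mono_neutral_right) (auto simp: g_def)
      also have "\<dots> = (\<Sum>t<r ^ k. \<bar>f t\<bar> * \<bar>f t\<bar>)" by (simp add: g_def)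
      also have "\<dots> \<le> (\<Sum>t<r ^ k. \<bar>f t\<bar> * (\<Sum>t<r ^ k. \<bar>f t\<bar>))"
        by (intro sum_mono mult_left_mono member_le_sum) auto
      also have "\<dots> = (\<Sum>t<r ^ k. \<bar>f t\<bar>) * (\<Sum>t<r ^ k. \<bar>f t\<bar>)"
        by (simp add: sum_distrib_right)
      also have "\<dots> \<le> ?C" using f(1) by (intro mult_mono sum_nonneg) auto
      finally show "dot g g \<le> ?C" .
      show "(dot (a i) g)\<^sup>2 \<le> ?C" if "i < m" for i
        using f(3)[OF ok[OF that]] mult_mono[OF f(3)[OF ok[OF that]] f(3)[OF ok[OF that]]]
        unfolding dg by (simp add: power2_eq_square flip: abs_mult)
      show "1 \<le> (dot (a i) g)\<^sup>2" if "dot (a i) g \<noteq> 0" for i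
        using that f(4) unfolding dg by (rule_tac one_le_square_Ints)
      show "j < m" by (rule j)
      show "dot (a j) g \<noteq> 0" using f(2)[OF ok[OF j(1)]] x(2) j(2) unfolding dg by simp
    qed (use X \<delta> in auto)
    then show ?thesis
      using f(2)[OF ok] unfolding dg S_def by blast
  qed
  moreover have "(!) xs ` S \<subseteq> set xs" by (auto simp: S_def m_def)
  ultimately show "represents k (r - 1) ((!) xs ` S) (set xs)"
    using xs(1) unfolding represents_def by blast
qed

section \<open>The inversion program\<close>

context ram
begin

text \<open>With \<open>order_refl\<close> plugged in, unification computes the running time of a
  straight-line program while it is executed symbolically; \<open>hrun_le\<close> compares it with
  the claimed bound at the end.\<close>

lemmas hrun_Seq_exact = hrun_Seq[OF _ order_refl]
lemmas hrun_asg_exact = hrun_asg[OF _ _ _ order_refl]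
lemmas hrun_sto_exact = hrun_sto[OF _ _ _ _ order_refl]

lemma hrun_le: "hrun P h T Q \<Longrightarrow> T \<le> T' \<Longrightarrow> hrun P h T' Q"
  by (rule hrun_mono)

end

lemma index_inj:
  assumes "i * n + j = i' * n + j'" "j < n" "j' < (n::nat)"
  shows "i = i' \<and> j = j'"
proof -
  have "(i * n + j) div n = i" "(i' * n + j') div n = i'" using assms(2,3) by simp_all
  then have "i = i'" using assms(1) by simp
  then show ?thesis using assms(1) by simp
qed

lemma one_le_square: "b \<ge> 1 \<Longrightarrow> 1 \<le> real b * real b"
  using mult_mono[of 1 "real b" 1 "real b"] by simp

definition block_get :: "(nat \<Rightarrow> rat) \<Rightarrow> nat \<Rightarrow> nat \<Rightarrow> nat \<Rightarrow> nat \<Rightarrow> nat \<Rightarrow> rat" where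
  "block_get H n r c i j = H ((r + i) * n + (c + j))"

section \<open>Blocks of a stored matrix, Schur complement and block inverse in place\<close>

context matmul_ram
begin

definition get_block :: "nat \<Rightarrow> nat \<Rightarrow> nat \<Rightarrow> prog" where
  "get_block D ro co = fill_matrix 11 D (V 20 |*| V 11 |+| V 21)
     (L 4 ((V ro |+| V 20) |*| V 6 |+| (V co |+| V 21)))"

lemma hrun_get_block:
  assumes "reg h 11 = of_nat b" "b \<ge> 1" "reg h 6 = of_nat n"
    "reg h ro = of_nat r" "reg h co = of_nat c" "ro < 20" "co < 20" "D \<noteq> 4"
    and post: "\<And>h' F. reg h' = (reg h)(20 := of_nat b, 21 := of_nat b) \<Longrightarrow> arr h' = (arr h)(D := F) \<Longrightarrow>
      (\<And>i j. i < b \<Longrightarrow> j < b \<Longrightarrow> F (i * b + j) = block_get (arr h 4) n r c i j) \<Longrightarrow> Q h'"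
  shows "hrun (get_block D ro co) h (46 * (real b * real b)) Q"
  unfolding get_block_def
proof (rule hrun_fill_matrix[where n = b and f = "\<lambda>i j. i * b + j"
      and g = "block_get (arr h 4) n r c"])
  fix i j i' j' assume "j < b" "j' < b" "i * b + j = i' * b + j'"
  then show "i = i' \<and> j = j'" using index_inj by blast
qed (use assms in \<open>auto simp: block_get_def\<close>)

definition put_block :: "nat \<Rightarrow> nat \<Rightarrow> exp \<Rightarrow> prog" where
  "put_block ro co e = fill_matrix 11 4 ((V ro |+| V 20) |*| V 6 |+| (V co |+| V 21)) e"

lemma hrun_put_block:
  assumes h: "reg h 11 = of_nat b" "b \<ge> 1" "reg h 6 = of_nat n"
    "reg h ro = of_nat r" "reg h co = of_nat c" "ro < 20" "co < 20" "c + b \<le> n"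
    and e: "\<And>i j h' F. i < b \<Longrightarrow> j < b \<Longrightarrow>
      reg h' = (reg h)(20 := of_nat i, 21 := of_nat j) \<Longrightarrow> arr h' = (arr h)(4 := F) \<Longrightarrow>
      wd e h' \<and> (F ((r + i) * n + (c + j)) = arr h 4 ((r + i) * n + (c + j)) \<longrightarrow> eval e h' = g i j)"
    and post: "\<And>h' F. reg h' = (reg h)(20 := of_nat b, 21 := of_nat b) \<Longrightarrow> arr h' = (arr h)(4 := F) \<Longrightarrow>
      (\<And>p q. q < n \<Longrightarrow> F (p * n + q) = (if r \<le> p \<and> p < r + b \<and> c \<le> q \<and> q < c + b
        then g (p - r) (q - c) else arr h 4 (p * n + q))) \<Longrightarrow> Q h'"
  shows "hrun (put_block ro co e) h ((37 + real (cost e)) * (real b * real b)) Q"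
  unfolding put_block_def
proof (rule hrun_fill_matrix[where n = b and f = "\<lambda>i j. (r + i) * n + (c + j)" and g = g])
  fix i j i' j' assume "j < b" "j' < b" "(r + i) * n + (c + j) = (r + i') * n + (c + j')"
  then show "i = i' \<and> j = j'" using index_inj[of "r + i" n "c + j" "r + i'" "c + j'"] h by auto
next
  fix h' :: state and F
  assume 1: "reg h' = (reg h)(20 := of_nat b, 21 := of_nat b)" "arr h' = (arr h)(4 := F)"
    and F: "\<And>i j. i < b \<Longrightarrow> j < b \<Longrightarrow> F ((r + i) * n + (c + j)) = g i j"
    "\<And>x. (\<And>i j. i < b \<Longrightarrow> j < b \<Longrightarrow> x \<noteq> (r + i) * n + (c + j)) \<Longrightarrow> F x = arr h 4 x"
  show "Q h'"
  proof (rule post[OF 1])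
    fix p q assume q: "q < n"
    show "F (p * n + q) = (if r \<le> p \<and> p < r + b \<and> c \<le> q \<and> q < c + b
      then g (p - r) (q - c) else arr h 4 (p * n + q))"
    proof (cases "r \<le> p \<and> p < r + b \<and> c \<le> q \<and> q < c + b")
      case True
      then show ?thesis using F(1)[of "p - r" "q - c"] by auto
    next
      case False
      have "p * n + q \<noteq> (r + i) * n + (c + j)" if "i < b" "j < b" for i j
        using index_inj[of p n q "r + i" "c + j"] q False that h by auto
      then show ?thesis using F(2) False by auto
    qed
  qed
qed (use h e in \<open>auto simp: algebra_simps\<close>)

lemma hrun_mm:
  assumes "z < 39" "reg h z = of_nat n" "n \<ge> 1"
    and P: "\<And>i j. i < n \<Longrightarrow> j < n \<Longrightarrow> arr h a (i * n + j) = P i j"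
    and R: "\<And>i j. i < n \<Longrightarrow> j < n \<Longrightarrow> arr h b (i * n + j) = R i j"
    and post: "\<And>h' F. reg h' = (reg h)(39 := of_nat (n * n)) \<Longrightarrow> arr h' = (arr h)(c := F) \<Longrightarrow>
      (\<And>i j. i < n \<Longrightarrow> j < n \<Longrightarrow> F (i * n + j) = mmul n P R i j) \<Longrightarrow> Q h'"
  shows "hrun (matmul z a b c) h (mm_time n) Q"
proof (rule hrun_matmul[OF assms(1-3) order_refl])
  fix h' :: state and F
  assume 1: "reg h' = (reg h)(39 := of_nat (n * n))" "arr h' = (arr h)(c := F)"
    and F: "\<And>i j. i < n \<Longrightarrow> j < n \<Longrightarrow>
      F (i * n + j) = (\<Sum>l<n. arr h a (i * n + l) * arr h b (l * n + j))"
  show "Q h'"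
    by (rule post[OF 1]) (simp add: F mmul_def P R)
qed

lemma block_get_shift:
  "(\<lambda>i j. block_get H n l l i (b + j)) = block_get H n l (l + b)"
  "(\<lambda>i j. block_get H n l l (b + i) j) = block_get H n (l + b) l"
  "(\<lambda>i j. block_get H n l l (b + i) (b + j)) = block_get H n (l + b) (l + b)"
  "block_get H n l l (b + i) (b + j) = block_get H n (l + b) (l + b) i j"
  by (simp_all add: block_get_def fun_eq_iff add.assoc)

text \<open>The inversion works in place: at this point the upper left block of \<open>M\<close>
  already contains its own inverse, so the inner \<open>mmul b M\<close> multiplies by the
  inverse.\<close>

definition Schur_entry :: "nat \<Rightarrow> (nat \<Rightarrow> nat \<Rightarrow> rat) \<Rightarrow> nat \<Rightarrow> nat \<Rightarrow> rat" where
  "Schur_entry b M i j = M (b + i) (b + j) -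
     mmul b (\<lambda>i j. M (b + i) j) (mmul b M (\<lambda>i j. M i (b + j))) i j"

definition Schur :: prog where
  "Schur = Seq (17 ::= V 12 |+| V 11) (Seq (get_block 5 12 12) (Seq (get_block 6 12 17)
     (Seq (matmul 11 5 6 7) (Seq (get_block 5 17 12) (Seq (matmul 11 5 7 6)
       (put_block 17 17 (L 4 ((V 17 |+| V 20) |*| V 6 |+| (V 17 |+| V 21)) |-| L 6 (V 20 |*| V 11 |+| V 21))))))))"

lemma hrun_Schur:
  assumes h: "reg h 11 = of_nat b" "b \<ge> 1" "reg h 6 = of_nat n" "reg h 12 = of_nat l" "l + b + b \<le> n"
    and post: "\<And>h'. chg {17, 20, 21, 39} {4, 5, 6, 7} h h' \<Longrightarrow>
      (\<And>p q. q < n \<Longrightarrow> arr h' 4 (p * n + q) =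
        (if l + b \<le> p \<and> p < l + b + b \<and> l + b \<le> q \<and> q < l + b + b
         then Schur_entry b (block_get (arr h 4) n l l) (p - (l + b)) (q - (l + b))
         else arr h 4 (p * n + q))) \<Longrightarrow> Q h'"
  shows "hrun Schur h (2 * mm_time b + 300 * (real b * real b)) Q"
  unfolding Schur_def
  apply (rule hrun_le)
   apply (rule hrun_Seq_exact, rule hrun_asg_exact, simp, simp)
   apply (rule hrun_Seq_exact, rule hrun_get_block[where b = b and n = n and r = l and c = l])
           apply (use h in \<open>simp; fail\<close>)+
   apply (rule hrun_Seq_exact, rule hrun_get_block[where b = b and n = n and r = l and c = "l + b"])
           apply (use h in \<open>simp; fail\<close>)+
   apply (rule hrun_Seq_exact, rule hrun_mm[where n = b and P = "block_get (arr h 4) n l l" and R = "block_get (arr h 4) n l (l + b)"])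
        apply (use h in \<open>simp; fail\<close>)+
   apply (rule hrun_Seq_exact, rule hrun_get_block[where b = b and n = n and r = "l + b" and c = l])
           apply (use h in \<open>simp; fail\<close>)+
   apply (rule hrun_Seq_exact, rule hrun_mm[where n = b and P = "block_get (arr h 4) n (l + b) l" and R = "mmul b (block_get (arr h 4) n l l) (block_get (arr h 4) n l (l + b))"])
        apply (use h in \<open>simp; fail\<close>)+
   apply (rule hrun_put_block[where b = b and n = n and r = "l + b" and c = "l + b"
        and g = "Schur_entry b (block_get (arr h 4) n l l)"])
           apply (use h in \<open>simp; fail\<close>)+

    apply (use h in \<open>auto simp: Schur_entry_def block_get_shift block_get_def[of _ _ "l + b" "l + b"]\<close>)[1]
   apply (rule post)
    apply (simp add: chg_def)
   apply (use h in \<open>simp; fail\<close>)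
  apply (use one_le_square[OF h(2)] in \<open>simp add: algebra_simps; fail\<close>)
  done

text \<open>Here the upper left block of \<open>M\<close> has been replaced by its inverse and the
  lower right one by the inverse of the Schur complement. The formula is that of
  \<open>right_inverse_block\<close>.\<close>

definition block_inverse :: "nat \<Rightarrow> (nat \<Rightarrow> nat \<Rightarrow> rat) \<Rightarrow> nat \<Rightarrow> nat \<Rightarrow> rat" where
  "block_inverse b M i j = (let E = mmul b M (\<lambda>i j. M i (b + j)); F = mmul b (\<lambda>i j. M (b + i) j) M;
     Si = (\<lambda>i j. M (b + i) (b + j)); G = mmul b E Si in
     if i < b then if j < b then M i j + mmul b G F i j else - G i (j - b)
     else if j < b then - mmul b Si F (i - b) j else Si (i - b) (j - b))"

lemma block_inverse_block_get:
  assumes "i < b" "j < b"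
  shows "block_inverse b (block_get H n l l) i j = H ((l + i) * n + (l + j)) +
      mmul b (mmul b (mmul b (block_get H n l l) (block_get H n l (l + b))) (block_get H n (l + b) (l + b))) (mmul b (block_get H n (l + b) l) (block_get H n l l)) i j"
    "block_inverse b (block_get H n l l) i (b + j) = - mmul b (mmul b (block_get H n l l) (block_get H n l (l + b))) (block_get H n (l + b) (l + b)) i j"
    "block_inverse b (block_get H n l l) (b + i) j =
      - mmul b (block_get H n (l + b) (l + b)) (mmul b (block_get H n (l + b) l) (block_get H n l l)) i j"
    "block_inverse b (block_get H n l l) (b + i) (b + j) = H ((l + b + i) * n + (l + b + j))"
  unfolding block_inverse_def Let_def block_get_shift using assms
  by (simp_all add: block_get_def[of H n l l] block_get_def[of H n "l + b" "l + b"])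

text \<open>The product \<open>E\<close> is computed a second time, because inverting the Schur
  complement in between may have overwritten the work arrays.\<close>

definition combine :: prog where
  "combine = Seq (get_block 5 12 12) (Seq (get_block 6 12 17) (Seq (matmul 11 5 6 7)
     (Seq (get_block 6 17 12) (Seq (matmul 11 6 5 9) (Seq (get_block 6 17 17) (Seq (matmul 11 7 6 10)
     (Seq (matmul 11 10 9 11) (Seq (matmul 11 6 9 7)
     (Seq (put_block 12 12 (L 4 ((V 12 |+| V 20) |*| V 6 |+| (V 12 |+| V 21)) |+| L 11 (V 20 |*| V 11 |+| V 21)))
     (Seq (put_block 12 17 (K 0 |-| L 10 (V 20 |*| V 11 |+| V 21)))
       (put_block 17 12 (K 0 |-| L 7 (V 20 |*| V 11 |+| V 21)))))))))))))"

lemma hrun_combine: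
  assumes h: "reg h 11 = of_nat b" "b \<ge> 1" "reg h 6 = of_nat n" "reg h 12 = of_nat l" "l + b + b \<le> n"
    "reg h 17 = of_nat (l + b)"
    and post: "\<And>h'. chg {20, 21, 39} {4, 5, 6, 7, 9, 10, 11} h h' \<Longrightarrow>
      (\<And>p q. q < n \<Longrightarrow> arr h' 4 (p * n + q) =
        (if l \<le> p \<and> p < l + b + b \<and> l \<le> q \<and> q < l + b + b
         then block_inverse b (block_get (arr h 4) n l l) (p - l) (q - l)
         else arr h 4 (p * n + q))) \<Longrightarrow> Q h'"
  shows "hrun combine h (5 * mm_time b + 600 * (real b * real b)) Q"
  unfolding combine_def
  apply (rule hrun_le)
   apply (rule hrun_Seq_exact, rule hrun_get_block[where b = b and n = n and r = l and c = l])
           apply (use h in \<open>simp; fail\<close>)+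
   apply (rule hrun_Seq_exact, rule hrun_get_block[where b = b and n = n and r = l and c = "l + b"])
           apply (use h in \<open>simp; fail\<close>)+
   apply (rule hrun_Seq_exact, rule hrun_mm[where n = b and P = "block_get (arr h 4) n l l" and R = "block_get (arr h 4) n l (l + b)"])
        apply (use h in \<open>simp; fail\<close>)+
   apply (rule hrun_Seq_exact, rule hrun_get_block[where b = b and n = n and r = "l + b" and c = l])
           apply (use h in \<open>simp; fail\<close>)+
   apply (rule hrun_Seq_exact, rule hrun_mm[where n = b and P = "block_get (arr h 4) n (l + b) l" and R = "block_get (arr h 4) n l l"])
        apply (use h in \<open>simp; fail\<close>)+
   apply (rule hrun_Seq_exact, rule hrun_get_block[where b = b and n = n and r = "l + b" and c = "l + b"])
           apply (use h in \<open>simp; fail\<close>)+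
   apply (rule hrun_Seq_exact, rule hrun_mm[where n = b and P = "mmul b (block_get (arr h 4) n l l) (block_get (arr h 4) n l (l + b))" and R = "block_get (arr h 4) n (l + b) (l + b)"])
        apply (use h in \<open>simp; fail\<close>)+
   apply (rule hrun_Seq_exact, rule hrun_mm[where n = b and P = "mmul b (mmul b (block_get (arr h 4) n l l) (block_get (arr h 4) n l (l + b))) (block_get (arr h 4) n (l + b) (l + b))" and R = "mmul b (block_get (arr h 4) n (l + b) l) (block_get (arr h 4) n l l)"])
        apply (use h in \<open>simp; fail\<close>)+
   apply (rule hrun_Seq_exact, rule hrun_mm[where n = b and P = "block_get (arr h 4) n (l + b) (l + b)" and R = "mmul b (block_get (arr h 4) n (l + b) l) (block_get (arr h 4) n l l)"])
        apply (use h in \<open>simp; fail\<close>)+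
   apply (rule hrun_Seq_exact, rule hrun_put_block[where b = b and n = n and r = l and c = l
        and g = "\<lambda>i j. block_inverse b (block_get (arr h 4) n l l) i j"])
           apply (use h in \<open>simp; fail\<close>)+
    subgoal using h by (auto simp: block_inverse_block_get)
   apply (rule hrun_Seq_exact, rule hrun_put_block[where b = b and n = n and r = l and c = "l + b"
        and g = "\<lambda>i j. block_inverse b (block_get (arr h 4) n l l) i (b + j)"])
           apply (use h in \<open>simp; fail\<close>)+
    subgoal using h by (auto simp: block_inverse_block_get)
   apply (rule hrun_put_block[where b = b and n = n and r = "l + b" and c = l
        and g = "\<lambda>i j. block_inverse b (block_get (arr h 4) n l l) (b + i) j"])
           apply (use h in \<open>simp; fail\<close>)+
    subgoal using h by (auto simp: block_inverse_block_get)
   apply (rule post)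
    apply (simp add: chg_def)
  \<comment> \<open>None of the three calls of \<open>put_block\<close> writes the lower right
    block: it already holds the inverse of the Schur complement, which is the value that
    \<open>block_inverse\<close> has there.\<close>
  subgoal for h1 F1 h2 F2 h3 F3 h4 F4 h5 F5 h6 F6 h7 F7 h8 F8 h9 F9 h10 F10 h11 F11 h12 F12 p q
    apply simp
    apply (cases "l \<le> p \<and> p < l + b + b \<and> l \<le> q \<and> q < l + b + b")
    subgoal
      using block_inverse_block_get(4)[of "p - (l + b)" b "q - (l + b)" "arr h 4" n l] h
      by (cases "p < l + b"; cases "q < l + b") auto
    subgoal by auto
    done
  apply (use one_le_square[OF h(2)] in \<open>simp add: algebra_simps; fail\<close>)
  done

end

context ram
begin

lemma hrun_IfLess_true:
  assumes "reg h x < reg h y" "x < 40" "y < 40" "hrun P h T R"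
  shows "hrun (IfLess x y P Q) h (T + 1) R"
  using assms by (intro hrun_IfLess[OF _ _ _ _ order_refl]) auto

lemma hrun_IfLess_false:
  assumes "\<not> reg h x < reg h y" "x < 40" "y < 40" "hrun Q h T R"
  shows "hrun (IfLess x y P Q) h (T + 1) R"
  using assms by (intro hrun_IfLess[OF _ _ _ _ order_refl]) auto

end

section \<open>The recursive inversion as a loop\<close>

context matmul_ram
begin

text \<open>
  The recursion of the block inversion is unrolled into a loop. The register 13 is 0 when the
  block of size \<open>b\<close> (register 11) at position \<open>l\<close> (register 12) is still to be inverted and 1 when it
  has been; then entry \<open>b\<close> of array 8 tells whether it is the left or the right half of its parent.
\<close>

definition invert_step :: prog where
  "invert_step = IfLess 13 16
     (IfLess 16 11
       (Seq (11 ::= V 11 |/| K 2) (sto 8 (V 11) (K 0)))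
       (Seq (sto 4 (V 12 |*| V 6 |+| V 12) (K 1 |/| L 4 (V 12 |*| V 6 |+| V 12))) (13 ::= K 1)))
     (IfLess 11 6
       (Seq (18 ::= L 8 (V 11)) (IfLess 18 16
         (Seq Schur (Seq (sto 8 (V 11) (K 1)) (Seq (12 ::= V 12 |+| V 11) (13 ::= K 0))))
         (Seq (17 ::= V 12) (Seq (12 ::= V 12 |-| V 11) (Seq combine (11 ::= V 11 |+| V 11))))))
       (14 ::= K 0))"

definition invert_loop :: prog where
  "invert_loop = While 15 14 invert_step"

lemma hrun_invert_loop:
  assumes "reg h 15 < reg h 14" "hrun invert_step h T (\<lambda>h'. hrun invert_loop h' U Q)" "T + U + 1 \<le> W"
  shows "hrun invert_loop h W Q"
  using assms unfolding invert_loop_def by (intro hrun_While_step) auto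

definition invert :: prog where
  "invert = Seq (15 ::= K 0) (Seq (16 ::= K 1) (Seq (14 ::= K 1) (Seq (13 ::= K 0)
     (Seq (12 ::= K 0) (Seq (11 ::= V 6) invert_loop)))))"

definition invert_regs :: "nat \<Rightarrow> state \<Rightarrow> nat \<Rightarrow> nat \<Rightarrow> rat \<Rightarrow> bool" where
  "invert_regs n h b l md \<longleftrightarrow> reg h 6 = of_nat n \<and> reg h 15 = 0 \<and> reg h 16 = 1 \<and> reg h 14 = 1 \<and>
     reg h 11 = of_nat b \<and> reg h 12 = of_nat l \<and> reg h 13 = md"

lemma hrun_down_step:
  assumes h: "invert_regs n h (2 * b) l 0" "b \<ge> 1"
    and cont: "\<And>h'. invert_regs n h' b l 0 \<Longrightarrow> chg {11} {8} h h' \<Longrightarrow>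
      arr h' 8 = (arr h 8)(b := 0) \<Longrightarrow> hrun invert_loop h' U R"
  shows "hrun invert_loop h (50 + U) R"
proof (rule hrun_invert_loop)
  show "hrun invert_step h 30 (\<lambda>h'. hrun invert_loop h' U R)"
    unfolding invert_step_def
    apply (rule hrun_le)
     apply (rule hrun_IfLess_true)
        apply (use h in \<open>simp add: invert_regs_def; fail\<close>)+
     apply (rule hrun_IfLess_true)
        apply (use h in \<open>simp add: invert_regs_def; fail\<close>)+
     apply (rule hrun_Seq_exact, rule hrun_asg_exact, simp, simp)
     apply (rule hrun_sto_exact, simp, simp)
      apply (use h in \<open>simp add: invert_regs_def; fail\<close>)
     apply (rule cont)
       apply (use h in \<open>simp add: invert_regs_def; fail\<close>)
      apply (simp add: chg_def)
     apply (use h in \<open>simp add: invert_regs_def; fail\<close>)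
    apply simp
    done
qed (use h in \<open>auto simp: invert_regs_def\<close>)

lemma hrun_leaf_step:
  assumes h: "invert_regs n h 1 l 0"
    and cont: "\<And>h'. invert_regs n h' 1 l 1 \<Longrightarrow> chg {13} {4} h h' \<Longrightarrow>
      arr h' 4 = (arr h 4)(l * n + l := 1 / arr h 4 (l * n + l)) \<Longrightarrow> hrun invert_loop h' U R"
  shows "hrun invert_loop h (50 + U) R"
proof (rule hrun_invert_loop)
  show "hrun invert_step h 40 (\<lambda>h'. hrun invert_loop h' U R)"
    unfolding invert_step_def
    apply (rule hrun_le)
     apply (rule hrun_IfLess_true)
        apply (use h in \<open>simp add: invert_regs_def; fail\<close>)+
     apply (rule hrun_IfLess_false)
        apply (use h in \<open>simp add: invert_regs_def; fail\<close>)+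
     apply (rule hrun_Seq_exact, rule hrun_sto_exact)
        apply (use h in \<open>simp add: invert_regs_def; fail\<close>)+
     apply (rule hrun_asg_exact, simp, simp)
     apply (rule cont)
       apply (use h in \<open>simp add: invert_regs_def; fail\<close>)
      apply (simp add: chg_def)
     apply (use h in \<open>simp add: invert_regs_def; fail\<close>)
    apply simp
    done
qed (use h in \<open>auto simp: invert_regs_def\<close>)

lemma hrun_left_step:
  assumes h: "invert_regs n h b l 1" "b \<ge> 1" "l + b + b \<le> n" "arr h 8 b = 0"
    and cont: "\<And>h'. invert_regs n h' b (l + b) 0 \<Longrightarrow>
      chg {12, 13, 17, 18, 20, 21, 39} {4, 5, 6, 7, 8} h h' \<Longrightarrow> arr h' 8 = (arr h 8)(b := 1) \<Longrightarrow>
      (\<And>p q. q < n \<Longrightarrow> arr h' 4 (p * n + q) =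
        (if l + b \<le> p \<and> p < l + b + b \<and> l + b \<le> q \<and> q < l + b + b
         then Schur_entry b (block_get (arr h 4) n l l) (p - (l + b)) (q - (l + b))
         else arr h 4 (p * n + q))) \<Longrightarrow> hrun invert_loop h' U R"
  shows "hrun invert_loop h (2 * mm_time b + 300 * (real b * real b) + 60 + U) R"
proof (rule hrun_invert_loop)
  show "hrun invert_step h (2 * mm_time b + 300 * (real b * real b) + 50) (\<lambda>h'. hrun invert_loop h' U R)"
    unfolding invert_step_def
    apply (rule hrun_le)
     apply (rule hrun_IfLess_false)
        apply (use h in \<open>simp add: invert_regs_def; fail\<close>)+
     apply (rule hrun_IfLess_true)
        apply (use h in \<open>simp add: invert_regs_def; fail\<close>)+
     apply (rule hrun_Seq_exact, rule hrun_asg_exact)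
       apply (use h in \<open>simp add: invert_regs_def; fail\<close>)+
     apply (rule hrun_IfLess_true)
        apply (use h in \<open>simp add: invert_regs_def; fail\<close>)+
     apply (rule hrun_Seq_exact, rule hrun_Schur[where b = b and n = n and l = l])
          apply (use h in \<open>simp add: invert_regs_def; fail\<close>)+
     apply (rule hrun_Seq_exact, rule hrun_sto_exact, simp, simp)
      apply (use h in \<open>simp add: invert_regs_def chg_reg; fail\<close>)
     apply (rule hrun_Seq_exact, rule hrun_asg_exact, simp, simp)
     apply (rule hrun_asg_exact, simp, simp)
     apply (rule cont)
        apply (use h in \<open>simp add: invert_regs_def chg_reg; fail\<close>)
       apply (use h in \<open>simp add: chg_def; fail\<close>)
      apply (use h in \<open>simp add: invert_regs_def chg_reg chg_arr; fail\<close>)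
     apply (use h in \<open>simp; fail\<close>)
    apply simp
    done
qed (use h in \<open>auto simp: invert_regs_def\<close>)

lemma hrun_right_step:
  assumes h: "invert_regs n h b (l + b) 1" "b \<ge> 1" "l + b + b \<le> n" "arr h 8 b = 1"
    and cont: "\<And>h'. invert_regs n h' (2 * b) l 1 \<Longrightarrow>
      chg {11, 12, 17, 18, 20, 21, 39} {4, 5, 6, 7, 9, 10, 11} h h' \<Longrightarrow>
      (\<And>p q. q < n \<Longrightarrow> arr h' 4 (p * n + q) =
        (if l \<le> p \<and> p < l + b + b \<and> l \<le> q \<and> q < l + b + b
         then block_inverse b (block_get (arr h 4) n l l) (p - l) (q - l)
         else arr h 4 (p * n + q))) \<Longrightarrow> hrun invert_loop h' U R"
  shows "hrun invert_loop h (5 * mm_time b + 600 * (real b * real b) + 60 + U) R"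
proof (rule hrun_invert_loop)
  show "hrun invert_step h (5 * mm_time b + 600 * (real b * real b) + 50) (\<lambda>h'. hrun invert_loop h' U R)"
    unfolding invert_step_def
    apply (rule hrun_le)
     apply (rule hrun_IfLess_false)
        apply (use h in \<open>simp add: invert_regs_def; fail\<close>)+
     apply (rule hrun_IfLess_true)
        apply (use h in \<open>simp add: invert_regs_def; fail\<close>)+
     apply (rule hrun_Seq_exact, rule hrun_asg_exact)
       apply (use h in \<open>simp add: invert_regs_def; fail\<close>)+
     apply (rule hrun_IfLess_false)
        apply (use h in \<open>simp add: invert_regs_def; fail\<close>)+
     apply (rule hrun_Seq_exact, rule hrun_asg_exact, simp, simp)
     apply (rule hrun_Seq_exact, rule hrun_asg_exact, simp, simp)
     apply (rule hrun_Seq_exact, rule hrun_combine[where b = b and n = n and l = l])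
           apply (use h in \<open>simp add: invert_regs_def; fail\<close>)+
     apply (rule hrun_asg_exact, simp, simp)
     apply (rule cont)
       apply (use h in \<open>simp add: invert_regs_def chg_reg; fail\<close>)
      apply (use h in \<open>simp add: chg_def; fail\<close>)
     apply (use h in \<open>simp; fail\<close>)
    apply simp
    done
qed (use h in \<open>auto simp: invert_regs_def\<close>)

text \<open>A block needs 7 products of matrices of half its size, two for the Schur complement and
  five to combine; 1100 bounds the remaining work.\<close>

definition invert_const :: real where
  "invert_const = 7 * (\<bar>cM\<bar> + 40) + 1100"

text \<open>Induction over the recursion tree that the loop walks through. A loop has no return, so
  the statement takes what is to happen after the block has been inverted as a continuation
  \<open>U\<close>, \<open>R\<close>. The flag of a block of size \<open>b\<close> lies at index
  \<open>b\<close> of array 8, and work inside the block writes at smaller indices only, so the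
  flags of the block and its ancestors survive.\<close>

lemma hrun_invert_block:
  assumes "invert_regs n h (2 ^ v) l 0" "l + 2 ^ v \<le> n" "pos_def (2 ^ v) (block_get (arr h 4) n l l)"
    and "\<And>h'. invert_regs n h' (2 ^ v) l 1 \<Longrightarrow>
      chg {11, 12, 13, 17, 18, 20, 21, 39} {4, 5, 6, 7, 8, 9, 10, 11} h h' \<Longrightarrow>
      (\<And>x. x \<ge> 2 ^ v \<Longrightarrow> arr h' 8 x = arr h 8 x) \<Longrightarrow>
      right_inverse (2 ^ v) (block_get (arr h 4) n l l) (block_get (arr h' 4) n l l) \<Longrightarrow>
      (\<And>p q. q < n \<Longrightarrow> \<not> (l \<le> p \<and> p < l + 2 ^ v \<and> l \<le> q \<and> q < l + 2 ^ v) \<Longrightarrow>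
        arr h' 4 (p * n + q) = arr h 4 (p * n + q)) \<Longrightarrow> hrun invert_loop h' U R"
  shows "hrun invert_loop h (invert_const * real (2 ^ v) powr w + U) R"
  using assms
proof (induction v arbitrary: h l U R)
  case 0
  have "hrun invert_loop h (50 + U) R"
  proof (rule hrun_leaf_step[of n h l])
    fix h' assume h': "invert_regs n h' 1 l 1" "chg {13} {4} h h'"
      "arr h' 4 = (arr h 4)(l * n + l := 1 / arr h 4 (l * n + l))"
    have pos: "0 < arr h 4 (l * n + l)"
      using pos_def_singleton 0(3) by (fastforce simp: block_get_def)
    show "hrun invert_loop h' U R"
    proof (rule 0(4))
      show "chg {11, 12, 13, 17, 18, 20, 21, 39} {4, 5, 6, 7, 8, 9, 10, 11} h h'"
        using h'(2) by (rule chg_mono) auto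
      show "right_inverse (2 ^ 0) (block_get (arr h 4) n l l) (block_get (arr h' 4) n l l)"
        using pos h' by (simp add: right_inverse_def mmul_def block_get_def)
      show "arr h' 8 x = arr h 8 x" for x
        using h' by (simp add: chg_arr)
      show "arr h' 4 (p * n + q) = arr h 4 (p * n + q)"
        if "q < n" "\<not> (l \<le> p \<and> p < l + 2 ^ 0 \<and> l \<le> q \<and> q < l + 2 ^ 0)" for p q
        using index_inj[of p n q l l] that 0(2) h'(3) by auto
    qed (use h' in auto)
  qed (use 0 in auto)
  then show ?case
    by (rule hrun_mono) (auto simp: invert_const_def)
next
  case (Suc v)
  define b :: nat where "b = 2 ^ v"
  have b: "b \<ge> 1" "2 ^ Suc v = b + b" by (simp_all add: b_def)
  define M where "M = block_get (arr h 4) n l l"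
  note regs = Suc.prems(1)[unfolded b] and len = Suc.prems(2)[unfolded b]
    and pd = Suc.prems(3)[unfolded b, folded M_def] and cont = Suc.prems(4)[unfolded b, folded M_def]
  let ?t = "invert_const * real b powr w"
  \<comment> \<open>The summands are, in order: descending, the left half, the Schur complement, its
    inversion, and combining.\<close>
  have "hrun invert_loop h (50 + (?t + (2 * mm_time b + 300 * (real b * real b) + 60 + (?t +
    (5 * mm_time b + 600 * (real b * real b) + 60 + U))))) R"
  proof (rule hrun_down_step[of n h b l])
    fix h1 assume h1: "invert_regs n h1 b l 0" "chg {11} {8} h h1" "arr h1 8 = (arr h 8)(b := 0)"
    have a1: "arr h1 4 = arr h 4" using h1(2) by (simp add: chg_arr)
    show "hrun invert_loop h1 (?t + (2 * mm_time b + 300 * (real b * real b) + 60 + (?t +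
      (5 * mm_time b + 600 * (real b * real b) + 60 + U)))) R"
    proof (rule Suc.IH[of h1 l, folded b_def])
      show "invert_regs n h1 b l 0" by (rule h1)
      show "l + b \<le> n" using len by simp
      show "pos_def b (block_get (arr h1 4) n l l)"
        unfolding a1 M_def[symmetric] by (rule pos_def_upper_left[OF pd])
      fix h2
      assume h2: "invert_regs n h2 b l 1"
        "chg {11, 12, 13, 17, 18, 20, 21, 39} {4, 5, 6, 7, 8, 9, 10, 11} h1 h2"
        "\<And>x. b \<le> x \<Longrightarrow> arr h2 8 x = arr h1 8 x"
        "right_inverse b (block_get (arr h1 4) n l l) (block_get (arr h2 4) n l l)"
        and a2: "\<And>p q. q < n \<Longrightarrow> \<not> (l \<le> p \<and> p < l + b \<and> l \<le> q \<and> q < l + b) \<Longrightarrow>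
          arr h2 4 (p * n + q) = arr h1 4 (p * n + q)"
      \<comment> \<open>\<open>M2\<close> is \<open>M\<close> with the upper left block inverted;
        \<open>M4\<close> below contains the inverse of the Schur complement in addition.\<close>
      define M2 where "M2 = block_get (arr h2 4) n l l"
      have Ai: "right_inverse b M M2" using h2(4) by (simp add: M_def M2_def a1)
      have M2: "M2 i j = M i j" if "i < b + b" "j < b + b" "\<not> (i < b \<and> j < b)" for i j
        using a2[of "l + j" "l + i"] that len by (auto simp: M2_def M_def block_get_def a1)
      show "hrun invert_loop h2 (2 * mm_time b + 300 * (real b * real b) + 60 + (?t +
        (5 * mm_time b + 600 * (real b * real b) + 60 + U))) R"
      proof (rule hrun_left_step[of n h2 b l])
        show "arr h2 8 b = 0" using h2(3)[of b] h1(3) by simp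
        fix h3
        assume h3: "invert_regs n h3 b (l + b) 0" "chg {12, 13, 17, 18, 20, 21, 39} {4, 5, 6, 7, 8} h2 h3"
          "arr h3 8 = (arr h2 8)(b := 1)"
          and a3: "\<And>p q. q < n \<Longrightarrow> arr h3 4 (p * n + q) =
            (if l + b \<le> p \<and> p < l + b + b \<and> l + b \<le> q \<and> q < l + b + b
             then Schur_entry b (block_get (arr h2 4) n l l) (p - (l + b)) (q - (l + b))
             else arr h2 4 (p * n + q))"
        define E where "E = mmul b M2 (\<lambda>i j. M2 i (b + j))"
        define S where "S = block_get (arr h3 4) n (l + b) (l + b)"
        have E: "E i j = mmul b M2 (\<lambda>i j. M i (b + j)) i j" if "i < b" "j < b" for i j
          unfolding E_def using that M2 by (intro mmul_cong) auto
        have S': "S i j = M2 (b + i) (b + j) - mmul b (\<lambda>i j. M2 (b + i) j) E i j" if "i < b" "j < b" for i j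
          using a3[of "l + b + j" "l + b + i"] that len
          by (simp add: S_def block_get_def[of _ _ "l + b" "l + b"] Schur_entry_def M2_def[symmetric] E_def)
        have S: "S i j = M (b + i) (b + j) - mmul b (\<lambda>i j. M (b + i) j) E i j" if "i < b" "j < b" for i j
        proof -
          have "mmul b (\<lambda>i j. M2 (b + i) j) E i j = mmul b (\<lambda>i j. M (b + i) j) E i j"
            using that M2 by (intro mmul_cong) auto
          then show ?thesis using S' M2 that by simp
        qed
        show "hrun invert_loop h3 (?t + (5 * mm_time b + 600 * (real b * real b) + 60 + U)) R"
        proof (rule Suc.IH[of h3 "l + b", folded b_def])
          show "invert_regs n h3 b (l + b) 0" by (rule h3)
          show "l + b + b \<le> n" using len by simp
          show "pos_def b (block_get (arr h3 4) n (l + b) (l + b))"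
            unfolding S_def[symmetric] by (rule pos_def_Schur_complement[OF pd Ai E S])
          fix h4
          assume h4: "invert_regs n h4 b (l + b) 1"
            "chg {11, 12, 13, 17, 18, 20, 21, 39} {4, 5, 6, 7, 8, 9, 10, 11} h3 h4"
            "\<And>x. b \<le> x \<Longrightarrow> arr h4 8 x = arr h3 8 x"
            "right_inverse b (block_get (arr h3 4) n (l + b) (l + b)) (block_get (arr h4 4) n (l + b) (l + b))"
            and a4: "\<And>p q. q < n \<Longrightarrow> \<not> (l + b \<le> p \<and> p < l + b + b \<and> l + b \<le> q \<and> q < l + b + b) \<Longrightarrow>
              arr h4 4 (p * n + q) = arr h3 4 (p * n + q)"
          define M4 where "M4 = block_get (arr h4 4) n l l"
          have M4: "M4 i j = M2 i j" if "i < b + b" "j < b + b" "\<not> (b \<le> i \<and> b \<le> j)" for i j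
            using a4[of "l + j" "l + i"] a3[of "l + j" "l + i"] that len
            by (auto simp: M4_def M2_def block_get_def)
          define Si where "Si = (\<lambda>i j. M4 (b + i) (b + j))"
          have "Si = block_get (arr h4 4) n (l + b) (l + b)"
            by (simp add: Si_def M4_def block_get_def fun_eq_iff add.assoc)
          then have Si: "right_inverse b S Si" using h4(4) by (simp add: S_def)
          show "hrun invert_loop h4 (5 * mm_time b + 600 * (real b * real b) + 60 + U) R"
          proof (rule hrun_right_step[of n h4 b l])
            show "arr h4 8 b = 1" using h4(3)[of b] h3(3) by simp
            fix h5
            assume h5: "invert_regs n h5 (2 * b) l 1"
              "chg {11, 12, 17, 18, 20, 21, 39} {4, 5, 6, 7, 9, 10, 11} h4 h5"
              and a5: "\<And>p q. q < n \<Longrightarrow> arr h5 4 (p * n + q) =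
                (if l \<le> p \<and> p < l + b + b \<and> l \<le> q \<and> q < l + b + b
                 then block_inverse b (block_get (arr h4 4) n l l) (p - l) (q - l)
                 else arr h4 4 (p * n + q))"
            have X: "block_get (arr h5 4) n l l i j = block_inverse b M4 i j" if "i < b + b" "j < b + b" for i j
              using a5[of "l + j" "l + i"] that len by (simp add: block_get_def[of _ _ l l i j] M4_def)
            show "hrun invert_loop h5 U R"
            proof (rule cont)
              show "invert_regs n h5 (b + b) l 1" using h5(1) by (simp add: mult_2)
              have "chg {11, 12, 13, 17, 18, 20, 21, 39} {4, 5, 6, 7, 8, 9, 10, 11} h h2"
                by (rule chg_trans[OF h1(2) h2(2)]) auto
              then have "chg {11, 12, 13, 17, 18, 20, 21, 39} {4, 5, 6, 7, 8, 9, 10, 11} h h3"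
                by (rule chg_trans[OF _ h3(2)]) auto
              then have "chg {11, 12, 13, 17, 18, 20, 21, 39} {4, 5, 6, 7, 8, 9, 10, 11} h h4"
                by (rule chg_trans[OF _ h4(2)]) auto
              then show "chg {11, 12, 13, 17, 18, 20, 21, 39} {4, 5, 6, 7, 8, 9, 10, 11} h h5"
                by (rule chg_trans[OF _ h5(2)]) auto
              show "arr h5 8 x = arr h 8 x" if "b + b \<le> x" for x
                using that b h4(3)[of x] h3(3) h2(3)[of x] h1(3) h5(2) by (simp add: chg_arr)
              show "right_inverse (b + b) M (block_get (arr h5 4) n l l)"
              proof (rule right_inverse_block[OF Ai E S Si])
                let ?E = "mmul b M4 (\<lambda>i j. M4 i (b + j))" and ?F = "mmul b (\<lambda>i j. M4 (b + i) j) M4"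
                have MM: "M4 i j = M2 i j" if "i < b" "j < b" for i j using that M4 by auto
                show F: "?F i j = mmul b (\<lambda>i j. M (b + i) j) M2 i j" if "i < b" "j < b" for i j
                  using that M4 M2 by (intro mmul_cong) auto
                show G: "mmul b ?E Si i j = mmul b E Si i j" if "i < b" "j < b" for i j
                  unfolding E_def using that M4 MM by (intro mmul_cong[OF mmul_cong]) auto
                show "mmul b (mmul b ?E Si) ?F i j = mmul b (mmul b ?E Si) ?F i j" for i j ..
                show "mmul b Si ?F i j = mmul b Si ?F i j" for i j ..
                show "block_get (arr h5 4) n l l i j = M2 i j + mmul b (mmul b ?E Si) ?F i j"
                  "block_get (arr h5 4) n l l i (b + j) = - mmul b ?E Si i j"
                  "block_get (arr h5 4) n l l (b + i) j = - mmul b Si ?F i j"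
                  "block_get (arr h5 4) n l l (b + i) (b + j) = Si i j" if "i < b" "j < b" for i j
                  using that by (simp_all add: X block_inverse_def Let_def MM Si_def)
              qed
              show "arr h5 4 (p * n + q) = arr h 4 (p * n + q)"
                if "q < n" "\<not> (l \<le> p \<and> p < l + (b + b) \<and> l \<le> q \<and> q < l + (b + b))" for p q
                using that a5[of q p] a4[of q p] a3[of q p] a2[of q p] by (auto simp: a1)
            qed
          qed (use h4 b len in auto)
        qed
      qed (use h2 b len in auto)
    qed
  qed (use regs b in \<open>auto simp: mult_2\<close>)
  moreover have "50 + (?t + (2 * mm_time b + 300 * (real b * real b) + 60 + (?t +
      (5 * mm_time b + 600 * (real b * real b) + 60 + U)))) \<le> invert_const * real (2 ^ Suc v) powr w + U"
  proof -
    have K: "0 \<le> invert_const" by (simp add: invert_const_def)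
    \<comment> \<open>Here \<open>w \<ge> 2\<close> excludes a logarithm: the bound for the parent
      is at least four times that for a half. Two of these shares pay for the halves and a third one
      for the work at the parent.\<close>
    have "4 \<le> (2::real) powr w"
      using powr_mono[OF w_ge, of 2] by (simp add: powr_numeral)
    then have "invert_const * real b powr w * 4 \<le> invert_const * real b powr w * 2 powr w"
      using K by (intro mult_left_mono) auto
    also have "\<dots> = invert_const * real (2 ^ Suc v) powr w"
      by (simp add: b_def powr_mult)
    finally have "?t * 4 \<le> invert_const * real (2 ^ Suc v) powr w" .
    moreover have "0 \<le> ?t" using K by (intro mult_nonneg_nonneg) auto
    ultimately have "2 * ?t + invert_const * real b powr w \<le> invert_const * real (2 ^ Suc v) powr w"
      by linarith
    moreover have "1100 * (real b * real b) \<le> 1100 * real b powr w"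
      using n2_le_powr[OF b(1)] by simp
    ultimately show ?thesis
      using one_le_square[OF b(1)] by (simp add: invert_const_def mm_time_def algebra_simps)
  qed
  ultimately show ?case by (rule hrun_le)
qed

lemma hrun_invert:
  assumes h: "reg h 6 = of_nat n" "n = 2 ^ v" "pos_def n (block_get (arr h 4) n 0 0)"
    and post: "\<And>h'. chg {11, 12, 13, 14, 15, 16, 17, 18, 20, 21, 39} {4, 5, 6, 7, 8, 9, 10, 11} h h' \<Longrightarrow>
      right_inverse n (block_get (arr h 4) n 0 0) (block_get (arr h' 4) n 0 0) \<Longrightarrow> Q h'"
  shows "hrun invert h (invert_const * real n powr w + 60) Q"
  unfolding invert_def
  apply (rule hrun_le)
   apply (rule hrun_Seq_exact, rule hrun_asg_exact, simp, simp)
   apply (rule hrun_Seq_exact, rule hrun_asg_exact, simp, simp)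
   apply (rule hrun_Seq_exact, rule hrun_asg_exact, simp, simp)
   apply (rule hrun_Seq_exact, rule hrun_asg_exact, simp, simp)
   apply (rule hrun_Seq_exact, rule hrun_asg_exact, simp, simp)
   apply (rule hrun_Seq_exact, rule hrun_asg_exact, simp, simp)
   apply (rule hrun_invert_block[where n = n and v = v and l = 0 and U = 30])
      apply (use h in \<open>simp add: invert_regs_def; fail\<close>)
     apply (use h in \<open>simp; fail\<close>)
    apply (use h in \<open>simp; fail\<close>)
  \<comment> \<open>The whole matrix has been inverted and registers 11 and 6 agree, so one more
    round clears register 14 and the loop stops.\<close>
  subgoal premises h' for h'
  proof (rule hrun_invert_loop)
    let ?h = "set_reg 14 0 h'"
    have c: "chg {11, 12, 13, 14, 15, 16, 17, 18, 20, 21, 39} {4, 5, 6, 7, 8, 9, 10, 11} h ?h"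
      using h'(2) by (simp add: chg_def)
    have Q: "Q ?h"
      by (rule post[OF c]) (use h'(4) h(2) in simp)
    have loop: "hrun invert_loop ?h 1 Q"
      unfolding invert_loop_def
      by (rule hrun_While_end) (use h'(1) Q in \<open>simp_all add: invert_regs_def\<close>)
    show "hrun invert_step h' 20 (\<lambda>h'. hrun invert_loop h' 1 Q)"
      unfolding invert_step_def
      apply (rule hrun_le)
       apply (rule hrun_IfLess_false)
          apply (use h'(1) in \<open>simp add: invert_regs_def; fail\<close>)+
       apply (rule hrun_IfLess_false)
          apply (use h'(1) h(2) in \<open>simp add: invert_regs_def; fail\<close>)+
       apply (rule hrun_asg_exact, simp, simp)
       apply (use loop in \<open>simp; fail\<close>)
      apply simp
      done
  qed (use h'(1) in \<open>auto simp: invert_regs_def\<close>)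
  apply (use h(2) in simp)
  done

end

section \<open>The selection program\<close>

text \<open>
  Registers: 0 holds \<open>k\<close>, 1 \<open>r\<close>, 2 \<open>|R|\<close>, 3 \<open>|R| k\<close>, 4 \<open>N = r\<^sup>k\<close>, 5 the number of selected tuples, 6 the
  dimension \<open>n\<close>, the least power of 2 not below \<open>N\<close>, 8 \<open>\<delta>\<close> and 9 finally \<open>\<delta>\<^sup>|\<^sup>R\<^sup>|\<close>. Arrays: 0 holds the
  input, 1 the output, 2 the weights, 3 the vectors \<open>a\<^sub>j\<close>, padded with zeros to length \<open>n\<close>, and 4 the
  matrix \<open>H\<close>, later its inverse. Beyond row \<open>|R|\<close> the array 3 is arbitrary; weight 0 hides these rows.
\<close>

lemma power_in_Nats_rat [simp]: "q \<in> \<nat> \<Longrightarrow> q ^ i \<in> \<nat>" for q :: rat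
  by (induction i) auto

lemma nat_of_rat_power [simp]: "q \<in> \<nat> \<Longrightarrow> nat_of_rat (q ^ i) = nat_of_rat q ^ i"
  by (induction i) auto

section \<open>Powers, dimension, weights and Vandermonde vectors\<close>

context ram
begin

definition power_prog :: "nat \<Rightarrow> nat \<Rightarrow> nat \<Rightarrow> nat \<Rightarrow> prog" where
  "power_prog z x i c = Seq (z ::= K 1) (For i c (z ::= V z |*| V x))"

lemma hrun_power:
  assumes d: "distinct [z, x, i, c]" "z < 40" "x < 40" "i < 40" "c < 40" and e: "reg h c = of_nat e"
    and post: "\<And>h'. reg h' = (reg h)(z := reg h x ^ e, i := of_nat e) \<Longrightarrow> arr h' = arr h \<Longrightarrow> Q h'"
  shows "hrun (power_prog z x i c) h (20 * (real e + 1)) Q"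
  unfolding power_prog_def
proof (rule hrun_Seq[where U = "14 * real e + 4", OF hrun_asg_exact])
  show "hrun (For i c (z ::= V z |*| V x)) (set_reg z (eval (K 1) h) h) (14 * real e + 4) Q"
  proof (rule hrun_For[where n = e and T = 7 and
        I = "\<lambda>l h'. reg h' = (reg h)(z := reg h x ^ l, i := of_nat l) \<and> arr h' = arr h"])
    fix l :: nat and h' :: state assume "l < e" "reg h' = (reg h)(z := reg h x ^ l, i := of_nat l) \<and> arr h' = arr h"
    then show "hrun (z ::= V z |*| V x) h' 7 (\<lambda>h'. reg h' i = of_nat l \<and> reg h' c = of_nat e \<and>
      reg (set_reg i (of_nat (Suc l)) h') = (reg h)(z := reg h x ^ Suc l, i := of_nat (Suc l)) \<and>
      arr (set_reg i (of_nat (Suc l)) h') = arr h)"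
      using d e by (intro hrun_asg) (auto simp: fun_eq_iff)
  qed (use d e post in auto)
qed (use d in auto)

definition round_up :: prog where
  "round_up = Seq (6 ::= K 1) (While 6 4 (6 ::= V 6 |+| V 6))"

lemma hrun_round_up:
  assumes N: "reg h 4 = of_nat N" "N \<ge> 1"
    and post: "\<And>h' v. reg h' = (reg h)(6 := of_nat (2 ^ v)) \<Longrightarrow> arr h' = arr h \<Longrightarrow>
      N \<le> 2 ^ v \<Longrightarrow> 2 ^ v \<le> 2 * N \<Longrightarrow> Q h'"
  shows "hrun round_up h (12 * (real N + 1)) Q"
proof -
  define v where "v = (LEAST v. N \<le> 2 ^ v)"
  \<comment> \<open>The crude bound \<open>v \<le> N\<close> on the number of doublings is good
    enough, as time linear in \<open>N\<close> is affordable.\<close>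
  have v: "N \<le> 2 ^ v" "v \<le> N"
    unfolding v_def by (rule LeastI[of _ N], simp) (rule Least_le, simp)
  have below: "2 ^ u < N" if "u < v" for u
    using not_less_Least[OF that[unfolded v_def]] by simp
  have v2: "2 ^ v \<le> 2 * N"
  proof (cases v)
    case (Suc u)
    with below[of u] show ?thesis by simp
  qed (use N in simp)
  show ?thesis
    unfolding round_up_def
  proof (rule hrun_Seq[where U = "8 * real N + 1", OF hrun_asg_exact])
    show "hrun (While 6 4 (6 ::= V 6 |+| V 6)) (set_reg 6 (eval (K 1) h) h) (8 * real N + 1) Q"
    proof (rule hrun_While[where n = v and T = 7 and
          I = "\<lambda>u h'. reg h' = (reg h)(6 := of_nat (2 ^ u)) \<and> arr h' = arr h"])
      fix u :: nat and h' :: state assume u: "u < v" "reg h' = (reg h)(6 := of_nat (2 ^ u)) \<and> arr h' = arr h"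
      have "(of_nat (2 ^ u) :: rat) < of_nat N" using below[OF u(1)] by (simp only: of_nat_less_iff)
      then show "reg h' 6 < reg h' 4 \<and> hrun (6 ::= V 6 |+| V 6) h' 7
        (\<lambda>h'. reg h' = (reg h)(6 := of_nat (2 ^ Suc u)) \<and> arr h' = arr h)"
        using u(2) N(1) by (auto intro!: hrun_asg simp: fun_eq_iff)
    next
      fix h' :: state assume h': "reg h' = (reg h)(6 := of_nat (2 ^ v)) \<and> arr h' = arr h"
      have "(of_nat N :: rat) \<le> of_nat (2 ^ v)" using v(1) by (simp only: of_nat_le_iff)
      then show "\<not> reg h' 6 < reg h' 4" using h' N(1) by simp
    qed (use v v2 post in \<open>auto simp: fun_eq_iff\<close>)
  qed auto
qed

text \<open>The result plays the role of \<open>W\<close>: all entries are natural numbers, so 1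
  plus their sum exceeds each of them.\<close>

definition sum_input :: prog where
  "sum_input = Seq (9 ::= K 1) (For 22 3 (9 ::= V 9 |+| L 0 (V 22)))"

lemma hrun_sum_input:
  assumes M: "reg h 3 = of_nat M"
    and post: "\<And>h'. reg h' = (reg h)(9 := 1 + (\<Sum>x<M. arr h 0 x), 22 := of_nat M) \<Longrightarrow> arr h' = arr h \<Longrightarrow> Q h'"
  shows "hrun sum_input h (20 * (real M + 1)) Q"
  unfolding sum_input_def
proof (rule hrun_Seq[where U = "15 * real M + 4", OF hrun_asg_exact])
  show "hrun (For 22 3 (9 ::= V 9 |+| L 0 (V 22))) (set_reg 9 (eval (K 1) h) h) (15 * real M + 4) Q"
  proof (rule hrun_For[where n = M and T = 8 and
        I = "\<lambda>l h'. reg h' = (reg h)(9 := 1 + (\<Sum>x<l. arr h 0 x), 22 := of_nat l) \<and> arr h' = arr h"])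
    fix l :: nat and h' :: state assume "l < M" "reg h' = (reg h)(9 := 1 + (\<Sum>x<l. arr h 0 x), 22 := of_nat l) \<and> arr h' = arr h"
    then show "hrun (9 ::= V 9 |+| L 0 (V 22)) h' 8 (\<lambda>h'. reg h' 22 = of_nat l \<and> reg h' 3 = of_nat M \<and>
      reg (set_reg 22 (of_nat (Suc l)) h') = (reg h)(9 := 1 + (\<Sum>x<Suc l. arr h 0 x), 22 := of_nat (Suc l)) \<and>
      arr (set_reg 22 (of_nat (Suc l)) h') = arr h)"
      using M by (intro hrun_asg) (auto simp: fun_eq_iff)
  qed (use M post in auto)
qed auto

definition weights_prog :: prog where
  "weights_prog = Seq (9 ::= K 1) (Seq (For 22 2 (Seq (sto 2 (V 22) (V 9)) (9 ::= V 9 |*| V 8)))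
     (For 22 6 (sto 2 (V 2 |+| V 22) (K 0))))"

lemma hrun_weights:
  assumes r: "reg h 2 = of_nat m" "reg h 6 = of_nat n" "reg h 8 = \<delta>"
    and post: "\<And>h' F. reg h' = (reg h)(9 := \<delta> ^ m, 22 := of_nat n) \<Longrightarrow> arr h' = (arr h)(2 := F) \<Longrightarrow>
      (\<And>j. j < m \<Longrightarrow> F j = \<delta> ^ j) \<Longrightarrow> (\<And>j. m \<le> j \<Longrightarrow> j < m + n \<Longrightarrow> F j = 0) \<Longrightarrow> Q h'"
  shows "hrun weights_prog h (30 * (real m + real n + 1)) Q"
  unfolding weights_prog_def
proof (rule hrun_Seq[where U = "(19 * real m + 4) + (14 * real n + 4)", OF hrun_asg_exact])
  let ?I = "\<lambda>l h'. reg h' = (reg h)(9 := \<delta> ^ l, 22 := of_nat l) \<and>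
    (\<exists>F. arr h' = (arr h)(2 := F) \<and> (\<forall>j<l. F j = \<delta> ^ j))"
  show "hrun (Seq (For 22 2 (Seq (sto 2 (V 22) (V 9)) (9 ::= V 9 |*| V 8)))
     (For 22 6 (sto 2 (V 2 |+| V 22) (K 0)))) (set_reg 9 (eval (K 1) h) h) ((19 * real m + 4) + (14 * real n + 4)) Q"
  proof (rule hrun_Seq_exact, rule hrun_For[where n = m and T = 12 and I = ?I])
    fix l :: nat and h' :: state assume I: "?I l h'" and "l < m"
    then obtain F where "arr h' = (arr h)(2 := F)" "\<forall>j<l. F j = \<delta> ^ j" by blast
    then show "hrun (Seq (sto 2 (V 22) (V 9)) (9 ::= V 9 |*| V 8)) h' 12
      (\<lambda>h'. reg h' 22 = of_nat l \<and> reg h' 2 = of_nat m \<and> ?I (Suc l) (set_reg 22 (of_nat (Suc l)) h'))"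
      apply (intro hrun_Seq_exact[THEN hrun_le])
       apply (rule hrun_sto_exact, simp, simp)
        apply (use I in \<open>simp; fail\<close>)
       apply (rule hrun_asg_exact, simp, simp)
       apply (use I r in \<open>auto simp: fun_eq_iff less_Suc_eq intro!: exI[of _ "F(l := \<delta> ^ l)"]\<close>)[1]
      apply simp
      done
  next
    fix h1 :: state assume h1: "?I m h1"
    then obtain F1 where F1: "arr h1 = (arr h)(2 := F1)" "\<forall>j<m. F1 j = \<delta> ^ j" by blast
    let ?J = "\<lambda>l h'. reg h' = (reg h)(9 := \<delta> ^ m, 22 := of_nat l) \<and> (\<exists>F. arr h' = (arr h)(2 := F) \<and>
      (\<forall>j<m. F j = \<delta> ^ j) \<and> (\<forall>j. m \<le> j \<longrightarrow> j < m + l \<longrightarrow> F j = 0))"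
    show "hrun (For 22 6 (sto 2 (V 2 |+| V 22) (K 0))) h1 (14 * real n + 4) Q"
    proof (rule hrun_For[where n = n and T = 7 and I = ?J])
      show "?J 0 (set_reg 22 0 h1)" using h1 F1 by (auto simp: fun_eq_iff)
      fix l :: nat and h' :: state assume I: "?J l h'" and "l < n"
      then obtain F where F: "arr h' = (arr h)(2 := F)" "\<forall>j<m. F j = \<delta> ^ j"
        "\<forall>j. m \<le> j \<longrightarrow> j < m + l \<longrightarrow> F j = 0" by blast
      show "hrun (sto 2 (V 2 |+| V 22) (K 0)) h' 7 (\<lambda>h'. reg h' 22 = of_nat l \<and> reg h' 6 = of_nat n \<and>
        ?J (Suc l) (set_reg 22 (of_nat (Suc l)) h'))"
        apply (rule hrun_le)
         apply (rule hrun_sto_exact, simp, simp)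
          apply (use I r in \<open>simp; fail\<close>)
         apply (use I r F in \<open>auto simp: fun_eq_iff less_Suc_eq intro!: exI[of _ "F(m + l := 0)"]\<close>)[1]
        apply simp
        done
    next
      fix h' :: state assume "?J n h'"
      then show "Q h'" using post by blast
    qed (use h1 r in auto)
  qed (use r in \<open>auto simp: fun_eq_iff intro!: exI[of _ "arr h 2"]\<close>)
qed auto

text \<open>Level \<open>i\<close> extends the vector from length \<open>r ^ i\<close>, kept in
  register 12, to \<open>r ^ Suc i\<close> by \<open>vandermonde_shift\<close>. The entries are
  produced in increasing order, since an entry may depend on one written earlier in the same inner
  loop.\<close>

definition row_prog :: prog where
  "row_prog = Seq (11 ::= V 22 |*| V 6) (Seq (For 23 6 (sto 3 (V 11 |+| V 23) (K 0)))
     (Seq (sto 3 (V 11) (K 1)) (Seq (12 ::= K 1)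
       (For 23 0 (Seq (13 ::= L 0 (V 22 |*| V 0 |+| V 23)) (Seq (14 ::= V 12 |*| V 1 |-| V 12)
         (Seq (For 24 14 (sto 3 (V 11 |+| V 12 |+| V 24) (L 3 (V 11 |+| V 24) |*| V 13)))
           (12 ::= V 12 |*| V 1))))))))"

lemma hrun_row_level:
  assumes h: "reg h 11 = of_nat (j * n)" "reg h 12 = of_nat (r ^ i)" "reg h 13 = of_nat (x ! i)"
      "reg h 14 = of_nat (r ^ Suc i - r ^ i)" "r \<ge> 1" "r ^ Suc i \<le> n"
    and row: "\<And>t. t < n \<Longrightarrow> arr h 3 (j * n + t) = (if t < r ^ i then vandermonde r i x t else 0)"
    and post: "\<And>h'. chg {24} {3} h h' \<Longrightarrow> (\<And>t. t < n \<Longrightarrow> arr h' 3 (j * n + t) =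
        (if t < r ^ Suc i then vandermonde r (Suc i) x t else 0)) \<Longrightarrow>
      (\<And>y. y < j * n \<Longrightarrow> arr h' 3 y = arr h 3 y) \<Longrightarrow> Q h'"
  shows "hrun (For 24 14 (sto 3 (V 11 |+| V 12 |+| V 24) (L 3 (V 11 |+| V 24) |*| V 13))) h (25 * real n + 4) Q"
proof (rule hrun_For[where n = "r ^ Suc i - r ^ i" and T = 18 and
      I = "\<lambda>u h'. chg {24} {3} h h' \<and> (\<forall>t<n. arr h' 3 (j * n + t) =
        (if t < r ^ i + u then vandermonde r (Suc i) x t else 0)) \<and> (\<forall>y<j * n. arr h' 3 y = arr h 3 y)"])
  show "chg {24} {3} h (set_reg 24 0 h) \<and> (\<forall>t<n. arr (set_reg 24 0 h) 3 (j * n + t) =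
        (if t < r ^ i + 0 then vandermonde r (Suc i) x t else 0)) \<and> (\<forall>y<j * n. arr (set_reg 24 0 h) 3 y = arr h 3 y)"
    using row by (auto simp: vandermonde_low)
next
  fix u :: nat and h' :: state
  assume u: "u < r ^ Suc i - r ^ i" and I: "chg {24} {3} h h' \<and> (\<forall>t<n. arr h' 3 (j * n + t) =
        (if t < r ^ i + u then vandermonde r (Suc i) x t else 0)) \<and> (\<forall>y<j * n. arr h' 3 y = arr h 3 y)"
    and u24: "reg h' 24 = of_nat u" "reg h' 14 = of_nat (r ^ Suc i - r ^ i)"
  have r0: "0 < r ^ i" using h by simp
  have un: "r ^ i + u < n" "u < n" using u h by linarith+
  have regs: "reg h' 11 = of_nat (j * n)" "reg h' 12 = of_nat (r ^ i)" "reg h' 13 = of_nat (x ! i)"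
    using I h chg_reg[of "{24}" "{3}" h h'] by auto
  have val: "arr h' 3 (j * n + u) = vandermonde r (Suc i) x u"
    using I un(2) r0 by simp
  have new: "vandermonde r (Suc i) x (r ^ i + u) = vandermonde r (Suc i) x u * of_nat (x ! i)"
    by (rule vandermonde_shift[OF h(5)])
  show "hrun (sto 3 (V 11 |+| V 12 |+| V 24) (L 3 (V 11 |+| V 24) |*| V 13)) h' 18
    (\<lambda>h'. reg h' 24 = of_nat u \<and> reg h' 14 = of_nat (r ^ Suc i - r ^ i) \<and>
      chg {24} {3} h (set_reg 24 (of_nat (Suc u)) h') \<and>
      (\<forall>t<n. arr (set_reg 24 (of_nat (Suc u)) h') 3 (j * n + t) =
        (if t < r ^ i + Suc u then vandermonde r (Suc i) x t else 0)) \<and>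
      (\<forall>y<j * n. arr (set_reg 24 (of_nat (Suc u)) h') 3 y = arr h 3 y))"
    apply (rule hrun_le)
     apply (rule hrun_sto_exact)
        apply (simp add: regs u24)
       apply (simp add: regs u24)
      apply (simp add: regs u24)
     apply (use I u24 new val in \<open>auto simp: regs less_Suc_eq add.assoc chg_def\<close>)[1]
    apply simp
    done
next
  have "r ^ Suc i - r ^ i \<le> n"
    using h(6) by (rule order_trans[OF diff_le_self])
  then have "real (r ^ Suc i - r ^ i) * 25 \<le> real n * 25"
    by (intro mult_right_mono) (simp_all only: of_nat_le_iff)
  then show "real (r ^ Suc i - r ^ i) * (18 + 7) + 4 \<le> 25 * real n + 4"
    by (simp only: mult.commute) argo
next
  fix h' :: state assume "chg {24} {3} h h' \<and> (\<forall>t<n. arr h' 3 (j * n + t) =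
        (if t < r ^ i + (r ^ Suc i - r ^ i) then vandermonde r (Suc i) x t else 0)) \<and>
      (\<forall>y<j * n. arr h' 3 y = arr h 3 y)"
  moreover have "r ^ i + (r ^ Suc i - r ^ i) = r ^ Suc i" using h(5) by simp
  ultimately show "Q h'" using post by auto
qed (use h in auto)

lemma hrun_row:
  assumes h: "reg h 0 = of_nat k" "reg h 1 = of_nat r" "reg h 6 = of_nat n" "reg h 22 = of_nat j"
      "r \<ge> 1" "k \<ge> 1" "r ^ k \<le> n"
    and x: "\<And>i. i < k \<Longrightarrow> arr h 0 (j * k + i) = of_nat (x ! i)"
    and post: "\<And>h'. chg {11, 12, 13, 14, 23, 24} {3} h h' \<Longrightarrow> (\<And>t. t < n \<Longrightarrow> arr h' 3 (j * n + t) =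
        (if t < r ^ k then vandermonde r k x t else 0)) \<Longrightarrow>
      (\<And>y. y < j * n \<Longrightarrow> arr h' 3 y = arr h 3 y) \<Longrightarrow> Q h'"
  shows "hrun row_prog h (200 * (real k * real n)) Q"
proof -
  let ?X = "{11, 12, 13, 14, 23, 24} :: nat set"
  have "1 \<le> r ^ k" using h(5) by simp
  then have n: "n \<ge> 1" using h(7) by (rule order_trans)
  let ?I = "\<lambda>i h'. chg ?X {3} h h' \<and> reg h' 11 = of_nat (j * n) \<and> reg h' 12 = of_nat (r ^ i) \<and>
    (\<forall>t<n. arr h' 3 (j * n + t) = (if t < r ^ i then vandermonde r i x t else 0)) \<and>
    (\<forall>y<j * n. arr h' 3 y = arr h 3 y)"
  let ?lev = "Seq (13 ::= L 0 (V 22 |*| V 0 |+| V 23)) (Seq (14 ::= V 12 |*| V 1 |-| V 12)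
         (Seq (For 24 14 (sto 3 (V 11 |+| V 12 |+| V 24) (L 3 (V 11 |+| V 24) |*| V 13)))
           (12 ::= V 12 |*| V 1)))"
  have lev: "hrun ?lev h' (25 * real n + 40) (\<lambda>h'. reg h' 23 = of_nat i \<and> reg h' 0 = of_nat k \<and>
      ?I (Suc i) (set_reg 23 (of_nat (Suc i)) h'))"
    if i: "i < k" and I: "?I i h'" and h23: "reg h' 23 = of_nat i" for i h'
  proof -
    have regs: "reg h' 0 = of_nat k" "reg h' 1 = of_nat r" "reg h' 22 = of_nat j" "arr h' 0 = arr h 0"
      using I h by (auto simp: chg_reg chg_arr)
    have pw: "r ^ Suc i \<le> n"
      using power_increasing[of "Suc i" k r] i h by simp
    define g where "g = set_reg 14 (of_nat (r ^ Suc i - r ^ i)) (set_reg 13 (of_nat (x ! i)) h')"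
    have e: "eval (L 0 (V 22 |*| V 0 |+| V 23)) h' = of_nat (x ! i)"
      "eval (V 12 |*| V 1 |-| V 12) (set_reg 13 (of_nat (x ! i)) h') = of_nat (r ^ Suc i - r ^ i)"
      using h(5) regs h23 x[OF i] I by (simp, subst of_nat_diff) (simp_all add: mult.commute)
    have g: "reg g 11 = of_nat (j * n)" "reg g 12 = of_nat (r ^ i)" "reg g 13 = of_nat (x ! i)"
      "reg g 14 = of_nat (r ^ Suc i - r ^ i)" "arr g = arr h'" "chg {11, 12, 13, 14, 23, 24} {3} h' g"
      "reg g 23 = of_nat i" "reg g 0 = of_nat k" "reg g 1 = of_nat r"
      using I regs h23 by (simp_all add: g_def chg_def del: of_nat_mult of_nat_power)
    show ?thesis
      apply (rule hrun_le)
       apply (rule hrun_Seq_exact, rule hrun_asg_exact)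
         apply (simp add: regs h23)
        apply simp
       apply (rule hrun_Seq_exact, rule hrun_asg_exact)
         apply simp
        apply simp
       apply (unfold e g_def[symmetric])
       apply (rule hrun_Seq_exact, rule hrun_row_level[where j = j and n = n and r = r and i = i and x = x])
               apply (rule g h pw)+
         apply (use I g(5) in \<open>simp; fail\<close>)
       apply (rule hrun_asg_exact, simp, simp)
      subgoal premises p for h2
      proof -
        have c: "chg ?X {3} h h2"
          using chg_trans[OF _ p(1), of ?X "{3}" h ?X "{3}"] chg_trans[OF _ g(6), of ?X "{3}" h ?X "{3}"] I by auto
        have "reg h2 11 = of_nat (j * n)" "reg h2 12 = of_nat (r ^ i)" "reg h2 1 = of_nat r"
          "reg h2 23 = of_nat i" "reg h2 0 = of_nat k"
          using g p(1) by (simp_all add: chg_reg)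
        moreover have "chg ?X {3} h (set_reg 23 (of_nat (Suc i)) (set_reg 12 (eval (V 12 |*| V 1) h2) h2))"
          using c by (simp add: chg_def)
        ultimately show ?thesis
          using p(2,3) I g(5) by (auto simp: mult.commute)
      qed
      apply simp
      done
  qed
  have loop: "hrun (For 23 0 ?lev) h1 (real k * (25 * real n + 47) + 4) Q"
    if "?I 0 (set_reg 23 0 h1)" for h1
  proof (rule hrun_For[where n = k and T = "25 * real n + 40" and I = ?I])
    show "reg h1 0 = of_nat k"
      using that h(1) chg_reg[of ?X "{3}" h "set_reg 23 0 h1" 0] by simp
    fix h' :: state assume "?I k h'"
    then show "Q h'" using post by blast
  qed (use that lev in \<open>auto simp: algebra_simps\<close>)
  have zero: "hrun (For 23 6 (sto 3 (V 11 |+| V 23) (K 0))) h1 (14 * real n + 4) Q'"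
    if h1: "reg h1 11 = of_nat (j * n)" "reg h1 6 = of_nat n"
      and Q': "\<And>h'. chg {23} {3} h1 h' \<Longrightarrow> (\<And>t. t < n \<Longrightarrow> arr h' 3 (j * n + t) = 0) \<Longrightarrow>
        (\<And>y. y < j * n \<Longrightarrow> arr h' 3 y = arr h1 3 y) \<Longrightarrow> Q' h'" for h1 Q'
  proof (rule hrun_For[where n = n and T = 7 and I = "\<lambda>u h'. chg {23} {3} h1 h' \<and>
      (\<forall>t<u. arr h' 3 (j * n + t) = 0) \<and> (\<forall>y<j * n. arr h' 3 y = arr h1 3 y)"])
    fix u :: nat and h' :: state
    assume I: "chg {23} {3} h1 h' \<and> (\<forall>t<u. arr h' 3 (j * n + t) = 0) \<and> (\<forall>y<j * n. arr h' 3 y = arr h1 3 y)"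
      and u: "reg h' 23 = of_nat u" "reg h' 6 = of_nat n"
    have r11: "reg h' 11 = of_nat (j * n)" using I h1 by (auto simp: chg_reg)
    show "hrun (sto 3 (V 11 |+| V 23) (K 0)) h' 7 (\<lambda>h'. reg h' 23 = of_nat u \<and> reg h' 6 = of_nat n \<and>
      chg {23} {3} h1 (set_reg 23 (of_nat (Suc u)) h') \<and>
      (\<forall>t<Suc u. arr (set_reg 23 (of_nat (Suc u)) h') 3 (j * n + t) = 0) \<and>
      (\<forall>y<j * n. arr (set_reg 23 (of_nat (Suc u)) h') 3 y = arr h1 3 y))"
      by (rule hrun_sto) (use I u r11 in \<open>auto simp: less_Suc_eq chg_def\<close>)
  qed (use h1 Q' in auto)
  show ?thesis
    unfolding row_prog_def
    apply (rule hrun_le)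
     apply (rule hrun_Seq_exact, rule hrun_asg_exact, simp, simp)
     apply (rule hrun_Seq_exact, rule zero)
       apply (use h in \<open>simp; fail\<close>)
      apply (use h in \<open>simp; fail\<close>)
     apply (rule hrun_Seq_exact, rule hrun_sto_exact, simp, simp)
      apply (use h in \<open>simp add: chg_reg; fail\<close>)
     apply (rule hrun_Seq_exact, rule hrun_asg_exact, simp, simp)
     apply (rule loop)
    subgoal for h2
      using h n by (auto simp: chg_def vandermonde_def)
    subgoal
    proof -
      have "1 * 1 \<le> real k * real n" "1 * real n \<le> real k * real n" "real k * 1 \<le> real k * real n"
        using h(6) n by (intro mult_mono; simp)+
      then show ?thesis by (simp add: algebra_simps)
    qed
    done
qed

definition rows_prog :: prog where
  "rows_prog = For 22 2 row_prog"

lemma hrun_rows: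
  assumes h: "reg h 0 = of_nat k" "reg h 1 = of_nat r" "reg h 2 = of_nat (length xs)" "reg h 6 = of_nat n"
      "r \<ge> 1" "k \<ge> 1" "r ^ k \<le> n"
    and x: "stores_tuples (arr h 0) k xs"
    and post: "\<And>h'. chg {11, 12, 13, 14, 22, 23, 24} {3} h h' \<Longrightarrow> (\<And>j t. j < length xs \<Longrightarrow> t < n \<Longrightarrow>
        arr h' 3 (j * n + t) = (if t < r ^ k then vandermonde r k (xs ! j) t else 0)) \<Longrightarrow> Q h'"
  shows "hrun rows_prog h (real (length xs) * (200 * (real k * real n) + 7) + 4) Q"
  unfolding rows_prog_def
proof (rule hrun_For[where n = "length xs" and T = "200 * (real k * real n)" and
      I = "\<lambda>c h'. chg {11, 12, 13, 14, 22, 23, 24} {3} h h' \<and> (\<forall>j<c. \<forall>t<n.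
        arr h' 3 (j * n + t) = (if t < r ^ k then vandermonde r k (xs ! j) t else 0))"])
  fix c :: nat and h' :: state
  assume c: "c < length xs" and I: "chg {11, 12, 13, 14, 22, 23, 24} {3} h h' \<and> (\<forall>j<c. \<forall>t<n.
        arr h' 3 (j * n + t) = (if t < r ^ k then vandermonde r k (xs ! j) t else 0))"
    and r: "reg h' 22 = of_nat c" "reg h' 2 = of_nat (length xs)"
  show "hrun row_prog h' (200 * (real k * real n)) (\<lambda>h'. reg h' 22 = of_nat c \<and>
      reg h' 2 = of_nat (length xs) \<and> chg {11, 12, 13, 14, 22, 23, 24} {3} h (set_reg 22 (of_nat (Suc c)) h') \<and>
      (\<forall>j<Suc c. \<forall>t<n. arr (set_reg 22 (of_nat (Suc c)) h') 3 (j * n + t) =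
        (if t < r ^ k then vandermonde r k (xs ! j) t else 0)))"
  proof (rule hrun_row[where j = c and x = "xs ! c" and k = k and r = r and n = n])
    show "arr h' 0 (c * k + i) = of_nat (xs ! c ! i)" if "i < k" for i
      using I x c that by (auto simp: chg_arr stores_tuples_def)
    fix h2 :: state assume 2: "chg {11, 12, 13, 14, 23, 24} {3} h' h2"
      "\<And>t. t < n \<Longrightarrow> arr h2 3 (c * n + t) = (if t < r ^ k then vandermonde r k (xs ! c) t else 0)"
      "\<And>y. y < c * n \<Longrightarrow> arr h2 3 y = arr h' 3 y"
    have "chg {11, 12, 13, 14, 22, 23, 24} {3} h h2"
      by (rule chg_trans[OF conjunct1[OF I] 2(1)]) auto
    then show "reg h2 22 = of_nat c \<and>
      reg h2 2 = of_nat (length xs) \<and> chg {11, 12, 13, 14, 22, 23, 24} {3} h (set_reg 22 (of_nat (Suc c)) h2) \<and>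
      (\<forall>j<Suc c. \<forall>t<n. arr (set_reg 22 (of_nat (Suc c)) h2) 3 (j * n + t) =
        (if t < r ^ k then vandermonde r k (xs ! j) t else 0))"
      using 2 r I index_less by (auto simp: chg_reg less_Suc_eq)
  qed (use I h r in \<open>auto simp: chg_reg\<close>)
qed (use h post in auto)

end

lemma sum_lessThan_add: "(\<Sum>j<a + b. f j) = (\<Sum>j<a. f j) + (\<Sum>l<b. f (a + l))"
  for f :: "nat \<Rightarrow> rat"
  by (induction b) (simp_all add: add.assoc)

text \<open>\<open>J\<close> is \<open>m / n\<close> rounded up. The machine never computes it: it
  is the number of rounds of a loop that advances by \<open>n\<close> until \<open>m\<close> is
  reached.\<close>

lemma chunk_count:
  fixes m n :: nat
  assumes "n \<ge> 1"
  obtains J where "\<And>c. c < J \<Longrightarrow> c * n < m" "m \<le> J * n" "J * n < m + n"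
proof -
  define J where "J = (LEAST J. m \<le> J * n)"
  have ex: "m \<le> m * n" using assms by simp
  have 1: "m \<le> J * n" unfolding J_def by (rule LeastI[of "\<lambda>J. m \<le> J * n" m, OF ex])
  have 2: "c * n < m" if "c < J" for c
    using not_less_Least[OF that[unfolded J_def]] by simp
  have 3: "J * n < m + n"
  proof (cases J)
    case (Suc c)
    with 2[of c] show ?thesis by simp
  qed (use assms in simp)
  show thesis using that 1 2 3 by blast
qed

section \<open>The Gram matrix, one chunk of rows at a time\<close>

context matmul_ram
begin

abbreviation (input) cell :: exp where
  "cell \<equiv> V 20 |*| V 6 |+| V 21"

definition gram_init :: prog where
  "gram_init = Seq (fill_matrix 6 4 cell (K 0)) (For 22 6 (sto 4 (V 22 |*| V 6 |+| V 22) (V 9)))"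

lemma hrun_gram_init:
  assumes h: "reg h 6 = of_nat n" "n \<ge> 1" "reg h 9 = \<epsilon>"
    and post: "\<And>h'. chg {20, 21, 22} {4} h h' \<Longrightarrow>
      (\<And>i t. i < n \<Longrightarrow> t < n \<Longrightarrow> arr h' 4 (i * n + t) = of_bool (i = t) * \<epsilon>) \<Longrightarrow> Q h'"
  shows "hrun gram_init h (60 * (real n * real n)) Q"
  unfolding gram_init_def
  apply (rule hrun_le)
   apply (rule hrun_Seq_exact[where U = "18 * real n + 4"])
   apply (rule hrun_fill_matrix[where n = n and f = "\<lambda>i t. i * n + t" and g = "\<lambda>_ _. 0", OF _ _ _ _ _ order_refl])
        apply (use h in \<open>simp; fail\<close>)+
    apply (use index_inj in blast)
  subgoal premises p for h1 F
  proof (rule hrun_For[where n = n and T = 11 and I = "\<lambda>c h'. chg {20, 21, 22} {4} h h' \<and>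
      (\<forall>i<n. \<forall>t<n. arr h' 4 (i * n + t) = of_bool (i = t \<and> i < c) * \<epsilon>)"])
    show "chg {20, 21, 22} {4} h (set_reg 22 0 h1) \<and>
      (\<forall>i<n. \<forall>t<n. arr (set_reg 22 0 h1) 4 (i * n + t) = of_bool (i = t \<and> i < 0) * \<epsilon>)"
      using p by (auto simp: chg_def)
  next
    fix c :: nat and h' :: state
    assume c: "c < n" "reg h' 22 = of_nat c" "reg h' 6 = of_nat n"
      and I: "chg {20, 21, 22} {4} h h' \<and>
        (\<forall>i<n. \<forall>t<n. arr h' 4 (i * n + t) = of_bool (i = t \<and> i < c) * \<epsilon>)"
    have e: "reg h' 9 = \<epsilon>" using I h(3) by (auto simp: chg_reg)
    have new: "((arr h' 4)(c * n + c := \<epsilon>)) (i * n + t) = of_bool (i = t \<and> i < Suc c) * \<epsilon>"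
      if "i < n" "t < n" for i t
      using that I index_inj[of i n t c c] c(1) by (cases "i * n + t = c * n + c") (auto simp: less_Suc_eq)
    show "hrun (sto 4 (V 22 |*| V 6 |+| V 22) (V 9)) h' 11 (\<lambda>h'. reg h' 22 = of_nat c \<and> reg h' 6 = of_nat n \<and>
      chg {20, 21, 22} {4} h (set_reg 22 (of_nat (Suc c)) h') \<and>
      (\<forall>i<n. \<forall>t<n. arr (set_reg 22 (of_nat (Suc c)) h') 4 (i * n + t) = of_bool (i = t \<and> i < Suc c) * \<epsilon>))"
      by (rule hrun_sto) (use I c e new in \<open>auto simp: chg_def\<close>)
  next
    fix h' :: state
    assume "chg {20, 21, 22} {4} h h' \<and> (\<forall>i<n. \<forall>t<n. arr h' 4 (i * n + t) = of_bool (i = t \<and> i < n) * \<epsilon>)"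
    then show "Q h'" using post by auto
  qed (use p h in auto)
  subgoal
  proof -
    have "1 * 1 \<le> real n * real n" "1 * real n \<le> real n * real n"
      using h(2) by (intro mult_mono; simp)+
    then show ?thesis by (simp add: algebra_simps)
  qed
  done

text \<open>For \<open>n\<close> consecutive rows \<open>A\<close> with diagonal weight matrix
  \<open>D\<close>, this adds \<open>A^T D A\<close> to array 4; transposing and weighting happen
  while array 5 is filled.\<close>

definition gram_chunk :: prog where
  "gram_chunk = Seq (fill_matrix 6 5 cell (L 2 (V 10 |+| V 21) |*| L 3 ((V 10 |+| V 21) |*| V 6 |+| V 20)))
     (Seq (fill_matrix 6 6 cell (L 3 ((V 10 |+| V 20) |*| V 6 |+| V 21)))
     (Seq (matmul 6 5 6 7) (Seq (fill_matrix 6 4 cell (L 4 cell |+| L 7 cell)) (10 ::= V 10 |+| V 6))))"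

lemma hrun_gram_chunk:
  assumes h: "reg h 6 = of_nat n" "n \<ge> 1" "reg h 10 = of_nat c0"
    and post: "\<And>h'. chg {10, 20, 21, 39} {4, 5, 6, 7} h h' \<Longrightarrow> reg h' 10 = of_nat (c0 + n) \<Longrightarrow>
      (\<And>i t. i < n \<Longrightarrow> t < n \<Longrightarrow> arr h' 4 (i * n + t) = arr h 4 (i * n + t) +
        (\<Sum>l<n. arr h 2 (c0 + l) * arr h 3 ((c0 + l) * n + i) * arr h 3 ((c0 + l) * n + t))) \<Longrightarrow> Q h'"
  shows "hrun gram_chunk h (mm_time n + 300 * (real n * real n)) Q"
  unfolding gram_chunk_def
  apply (rule hrun_le)
   apply (rule hrun_Seq_exact)
   apply (rule hrun_fill_matrix[where n = n and f = "\<lambda>i t. i * n + t" and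
        g = "\<lambda>i l. arr h 2 (c0 + l) * arr h 3 ((c0 + l) * n + i)", OF _ _ _ _ _ order_refl])
        apply (use h in \<open>simp; fail\<close>)+
    apply (use index_inj in blast)
   apply (rule hrun_Seq_exact)
   apply (rule hrun_fill_matrix[where n = n and f = "\<lambda>i t. i * n + t" and
        g = "\<lambda>l t. arr h 3 ((c0 + l) * n + t)", OF _ _ _ _ _ order_refl])
        apply (use h in \<open>simp; fail\<close>)+
    apply (use index_inj in blast)
   apply (rule hrun_Seq_exact, rule hrun_mm[where n = n and
        P = "\<lambda>i l. arr h 2 (c0 + l) * arr h 3 ((c0 + l) * n + i)" and R = "\<lambda>l t. arr h 3 ((c0 + l) * n + t)"])
        apply (use h in \<open>simp; fail\<close>)+
   apply (rule hrun_Seq_exact)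
   apply (rule hrun_fill_matrix[where n = n and f = "\<lambda>i t. i * n + t" and
        g = "\<lambda>i t. arr h 4 (i * n + t) + mmul n (\<lambda>i l. arr h 2 (c0 + l) * arr h 3 ((c0 + l) * n + i))
          (\<lambda>l t. arr h 3 ((c0 + l) * n + t)) i t", OF _ _ _ _ _ order_refl])
        apply (use h in \<open>simp; fail\<close>)+
    apply (use index_inj in blast)
   apply (rule hrun_asg_exact, simp, simp)
   apply (rule post)
     apply (simp add: chg_def)
    apply (use h in \<open>simp; fail\<close>)
   apply (simp add: mmul_def)
  apply (use one_le_square[OF h(2)] in \<open>simp add: algebra_simps; fail\<close>)
  done

definition gram_prog :: prog where
  "gram_prog = Seq gram_init (Seq (10 ::= K 0) (While 10 2 gram_chunk))"

lemma hrun_gram: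
  assumes h: "reg h 6 = of_nat n" "n \<ge> 1" "reg h 2 = of_nat m" "reg h 9 = \<epsilon>"
    and d0: "\<And>j. m \<le> j \<Longrightarrow> j < m + n \<Longrightarrow> arr h 2 j = 0"
    and J: "\<And>c. c < J \<Longrightarrow> c * n < m" "m \<le> J * n" "J * n < m + n"
    and post: "\<And>h'. chg {10, 20, 21, 22, 39} {4, 5, 6, 7} h h' \<Longrightarrow>
      (\<And>i t. i < n \<Longrightarrow> t < n \<Longrightarrow> arr h' 4 (i * n + t) = of_bool (i = t) * \<epsilon> +
        (\<Sum>j<m. arr h 2 j * arr h 3 (j * n + i) * arr h 3 (j * n + t))) \<Longrightarrow> Q h'"
  shows "hrun gram_prog h (60 * (real n * real n) + real J * (mm_time n + 301 * (real n * real n)) + 4) Q"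
  unfolding gram_prog_def
proof (rule hrun_le, rule hrun_Seq_exact, rule hrun_gram_init[OF h(1,2,4)])
  fix h1
  assume 1: "chg {20, 21, 22} {4} h h1"
    "\<And>i t. i < n \<Longrightarrow> t < n \<Longrightarrow> arr h1 4 (i * n + t) = of_bool (i = t) * \<epsilon>"
  let ?S = "\<lambda>a i t. \<Sum>j<a. arr h 2 j * arr h 3 (j * n + i) * arr h 3 (j * n + t)"
  let ?I = "\<lambda>c h'. chg {10, 20, 21, 22, 39} {4, 5, 6, 7} h h' \<and> reg h' 10 = of_nat (c * n) \<and>
    (\<forall>i<n. \<forall>t<n. arr h' 4 (i * n + t) = of_bool (i = t) * \<epsilon> + ?S (c * n) i t)"
  show "hrun (Seq (10 ::= K 0) (While 10 2 gram_chunk)) h1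
    (3 + (real J * (mm_time n + 301 * (real n * real n)) + 1)) Q"
  proof (rule hrun_Seq[where U = "real J * (mm_time n + 301 * (real n * real n)) + 1", OF hrun_asg_exact])
    show "hrun (While 10 2 gram_chunk) (set_reg 10 (eval (K 0) h1) h1)
      (real J * (mm_time n + 301 * (real n * real n)) + 1) Q"
    proof (rule hrun_While[where n = J and T = "mm_time n + 300 * (real n * real n)" and I = ?I])
      show "?I 0 (set_reg 10 (eval (K 0) h1) h1)"
        using 1 by (auto simp: chg_def)
    next
      fix c :: nat and h' :: state assume c: "c < J" and I: "?I c h'"
      then have r: "reg h' 6 = of_nat n" "reg h' 2 = of_nat m" "reg h' 10 = of_nat (c * n)"
        "arr h' 2 = arr h 2" "arr h' 3 = arr h 3"
        using h by (auto simp: chg_reg chg_arr)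
      have "(of_nat (c * n) :: rat) < of_nat m" using J(1)[OF c] by (simp only: of_nat_less_iff)
      then have "reg h' 10 < reg h' 2" using r by simp
      moreover have "hrun gram_chunk h' (mm_time n + 300 * (real n * real n)) (?I (Suc c))"
      proof (rule hrun_gram_chunk[OF r(1) h(2) r(3)])
        fix h2 assume 2: "chg {10, 20, 21, 39} {4, 5, 6, 7} h' h2" "reg h2 10 = of_nat (c * n + n)"
          "\<And>i t. i < n \<Longrightarrow> t < n \<Longrightarrow> arr h2 4 (i * n + t) = arr h' 4 (i * n + t) +
            (\<Sum>l<n. arr h' 2 (c * n + l) * arr h' 3 ((c * n + l) * n + i) * arr h' 3 ((c * n + l) * n + t))"
        have "chg {10, 20, 21, 22, 39} {4, 5, 6, 7} h h2"
          by (rule chg_trans[OF conjunct1[OF I] 2(1)]) auto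
        moreover have "reg h2 10 = of_nat (Suc c * n)"
          using 2(2) by (simp only: mult_Suc add.commute)
        moreover have "arr h2 4 (i * n + t) = of_bool (i = t) * \<epsilon> + ?S (Suc c * n) i t" if "i < n" "t < n" for i t
        proof -
          have "?S (Suc c * n) i t = ?S (c * n) i t + (\<Sum>l<n. arr h 2 (c * n + l) *
              arr h 3 ((c * n + l) * n + i) * arr h 3 ((c * n + l) * n + t))"
            using sum_lessThan_add[of _ "c * n" n] by (simp add: add.commute[of n "c * n"])
          then show ?thesis using 2(3)[OF that] I r(4,5) that by (simp del: mult_Suc)
        qed
        ultimately show "?I (Suc c) h2" by blast
      qed
      ultimately show "reg h' 10 < reg h' 2 \<and> hrun gram_chunk h' (mm_time n + 300 * (real n * real n)) (?I (Suc c))"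
        by simp
    next
      fix h' :: state assume I: "?I J h'"
      have "(of_nat m :: rat) \<le> of_nat (J * n)" using J(2) by (simp only: of_nat_le_iff)
      then show "\<not> reg h' 10 < reg h' 2"
        using I h by (auto simp: chg_reg)
    next
      have "real J \<le> real J * (real n * real n)"
        using mult_left_mono[OF one_le_square[OF h(2)], of "real J"] by simp
      then show "real J * (mm_time n + 300 * (real n * real n) + 1) + 1
        \<le> real J * (mm_time n + 301 * (real n * real n)) + 1"
        by (simp add: algebra_simps)
    next
      fix h' :: state assume I: "?I J h'"
      \<comment> \<open>The last chunk may overrun row \<open>m\<close>, but the weights there
        vanish.\<close>
      have S: "?S (J * n) i t = ?S m i t" for i t
        using J(2,3) d0 by (intro sum.mono_neutral_right) auto
      show "Q h'"
        by (rule post) (use I S in auto)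
    qed auto
  qed auto
qed auto

section \<open>Selecting and writing the rows of large score\<close>

definition copy_row :: prog where
  "copy_row = For 23 0 (sto 1 (V 13 |+| V 23) (L 0 (V 14 |+| V 23)))"

lemma hrun_copy_row:
  assumes h: "reg h 0 = of_nat k" "reg h 13 = of_nat a" "reg h 14 = of_nat b"
    and post: "\<And>h'. chg {23} {1} h h' \<Longrightarrow> (\<And>t. t < k \<Longrightarrow> arr h' 1 (a + t) = arr h 0 (b + t)) \<Longrightarrow>
      (\<And>y. y < a \<Longrightarrow> arr h' 1 y = arr h 1 y) \<Longrightarrow> Q h'"
  shows "hrun copy_row h (19 * real k + 4) Q"
  unfolding copy_row_def
proof (rule hrun_For[where n = k and T = 12 and I = "\<lambda>u h'. chg {23} {1} h h' \<and>
    (\<forall>t<u. arr h' 1 (a + t) = arr h 0 (b + t)) \<and> (\<forall>y<a. arr h' 1 y = arr h 1 y)"])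
  fix u :: nat and h' :: state
  assume I: "chg {23} {1} h h' \<and> (\<forall>t<u. arr h' 1 (a + t) = arr h 0 (b + t)) \<and> (\<forall>y<a. arr h' 1 y = arr h 1 y)"
    and u: "reg h' 23 = of_nat u" "reg h' 0 = of_nat k"
  have r: "reg h' 13 = of_nat a" "reg h' 14 = of_nat b" "arr h' 0 = arr h 0"
    using I h by (auto simp: chg_reg chg_arr)
  show "hrun (sto 1 (V 13 |+| V 23) (L 0 (V 14 |+| V 23))) h' 12 (\<lambda>h'. reg h' 23 = of_nat u \<and>
    reg h' 0 = of_nat k \<and> chg {23} {1} h (set_reg 23 (of_nat (Suc u)) h') \<and>
    (\<forall>t<Suc u. arr (set_reg 23 (of_nat (Suc u)) h') 1 (a + t) = arr h 0 (b + t)) \<and>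
    (\<forall>y<a. arr (set_reg 23 (of_nat (Suc u)) h') 1 y = arr h 1 y))"
    by (rule hrun_sto) (use I u r in \<open>auto simp: less_Suc_eq chg_def\<close>)
qed (use h post in auto)

definition select_row :: prog where
  "select_row = Seq (11 ::= V 10 |+| V 22) (Seq (12 ::= K 0) (Seq (13 ::= V 22 |*| V 6)
     (Seq (14 ::= V 11 |*| V 6)
     (Seq (For 23 6 (12 ::= V 12 |+| L 7 (V 13 |+| V 23) |*| L 3 (V 14 |+| V 23)))
     (Seq (12 ::= L 2 (V 11) |*| V 12 |*| (V 4 |+| K 1))
       (IfLess 4 12 (Seq (13 ::= V 5 |*| V 0) (Seq (14 ::= V 11 |*| V 0)
         (Seq copy_row (5 ::= V 5 |+| K 1)))) Skip))))))"

lemma hrun_accumulate: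
  assumes h: "reg h 6 = of_nat n" "reg h 13 = of_nat a" "reg h 14 = of_nat b" "reg h 12 = 0"
    and post: "\<And>h'. reg h' = (reg h)(12 := \<Sum>t<n. arr h 7 (a + t) * arr h 3 (b + t), 23 := of_nat n) \<Longrightarrow>
      arr h' = arr h \<Longrightarrow> Q h'"
  shows "hrun (For 23 6 (12 ::= V 12 |+| L 7 (V 13 |+| V 23) |*| L 3 (V 14 |+| V 23))) h (25 * real n + 4) Q"
proof (rule hrun_For[where n = n and T = 18 and I = "\<lambda>u h'. arr h' = arr h \<and>
    reg h' = (reg h)(12 := \<Sum>t<u. arr h 7 (a + t) * arr h 3 (b + t), 23 := of_nat u)"])
  fix u :: nat and h' :: state
  assume "arr h' = arr h \<and>
    reg h' = (reg h)(12 := \<Sum>t<u. arr h 7 (a + t) * arr h 3 (b + t), 23 := of_nat u)"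
  then show "hrun (12 ::= V 12 |+| L 7 (V 13 |+| V 23) |*| L 3 (V 14 |+| V 23)) h' 18
    (\<lambda>h'. reg h' 23 = of_nat u \<and> reg h' 6 = of_nat n \<and> arr (set_reg 23 (of_nat (Suc u)) h') = arr h \<and>
    reg (set_reg 23 (of_nat (Suc u)) h') =
      (reg h)(12 := \<Sum>t<Suc u. arr h 7 (a + t) * arr h 3 (b + t), 23 := of_nat (Suc u)))"
    using h by (intro hrun_asg) (auto simp: fun_eq_iff)
qed (use h post in \<open>auto simp: fun_eq_iff\<close>)

lemma hrun_select_row:
  fixes N :: nat
  assumes h: "reg h 0 = of_nat k" "reg h 4 = of_nat N" "reg h 5 = of_nat q" "reg h 6 = of_nat n"
      "reg h 10 = of_nat c" "reg h 22 = of_nat i"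
    and P: "P \<longleftrightarrow> of_nat N < arr h 2 (c + i) * (\<Sum>t<n. arr h 7 (i * n + t) * arr h 3 ((c + i) * n + t)) * (of_nat N + 1)"
    and post: "\<And>h'. chg {5, 11, 12, 13, 14, 23} {1} h h' \<Longrightarrow>
      reg h' 5 = of_nat (q + of_bool P) \<Longrightarrow> (\<And>y. y < q * k \<Longrightarrow> arr h' 1 y = arr h 1 y) \<Longrightarrow>
      (\<And>t. P \<Longrightarrow> t < k \<Longrightarrow> arr h' 1 (q * k + t) = arr h 0 ((c + i) * k + t)) \<Longrightarrow> Q h'"
  shows "hrun select_row h (25 * real n + 19 * real k + 100) Q"
  unfolding select_row_def
  apply (rule hrun_le)
   apply (rule hrun_Seq_exact, rule hrun_asg_exact, simp, simp)
   apply (rule hrun_Seq_exact, rule hrun_asg_exact, simp, simp)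
   apply (rule hrun_Seq_exact, rule hrun_asg_exact, simp, simp)
   apply (rule hrun_Seq_exact, rule hrun_asg_exact, simp, simp)
   apply (rule hrun_Seq_exact, rule hrun_accumulate[where n = n and a = "i * n" and b = "(c + i) * n"])
       apply (use h in \<open>simp; fail\<close>)+
   apply (rule hrun_Seq_exact[where U = "19 * real k + 30 + 1"], rule hrun_asg_exact)
     apply (use h in \<open>simp; fail\<close>)+
  subgoal premises p for h1
  proof -
    define h2 where "h2 = set_reg 12 (eval (L 2 (V 11) |*| V 12 |*| (V 4 |+| K 1)) h1) h1"
    have c2: "chg {11, 12, 13, 14, 23} {} h h2"
      using p by (auto simp: h2_def chg_def)
    have r2: "reg h2 0 = of_nat k" "reg h2 4 = of_nat N" "reg h2 5 = of_nat q" "reg h2 11 = of_nat (c + i)"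
      "arr h2 = arr h"
      using p h by (auto simp: h2_def)
    have P2: "P \<longleftrightarrow> reg h2 4 < reg h2 12"
      unfolding P using p h by (simp add: h2_def)
    show ?thesis
      unfolding h2_def[symmetric]
    proof (rule hrun_IfLess[where T = "19 * real k + 30", OF _ _ _ _ order_refl])
      assume less: "reg h2 4 < reg h2 12"
      show "hrun (Seq (13 ::= V 5 |*| V 0) (Seq (14 ::= V 11 |*| V 0) (Seq copy_row (5 ::= V 5 |+| K 1))))
        h2 (19 * real k + 30) Q"
        apply (rule hrun_le)
         apply (rule hrun_Seq_exact, rule hrun_asg_exact, simp, simp)
         apply (rule hrun_Seq_exact, rule hrun_asg_exact, simp, simp)
         apply (rule hrun_Seq_exact, rule hrun_copy_row[where k = k and a = "q * k" and b = "(c + i) * k"])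
            apply (use r2 in \<open>simp; fail\<close>)+
         apply (rule hrun_asg_exact, simp, simp)
        subgoal premises w for h3
        proof (rule post)
          have c3: "chg {13, 14, 23} {1} h2 h3" using w(1) by (auto simp: chg_def)
          have "chg {5, 11, 12, 13, 14, 23} {1} h h3"
            by (rule chg_trans[OF c2 c3]) auto
          then show "chg {5, 11, 12, 13, 14, 23} {1} h (set_reg 5 (eval (V 5 |+| K 1) h3) h3)"
            by simp
          show "reg (set_reg 5 (eval (V 5 |+| K 1) h3) h3) 5 = of_nat (q + of_bool P)"
            using less P2 r2 chg_reg[OF c3, of 5] by simp
        qed (use w r2 in auto)
        apply simp
        done
    next
      assume less: "\<not> reg h2 4 < reg h2 12"
      show "hrun Skip h2 (19 * real k + 30) Q"
      proof (rule hrun_Skip)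
        show "Q h2"
        proof (rule post)
          show "chg {5, 11, 12, 13, 14, 23} {1} h h2" using c2 by (rule chg_mono) auto
        qed (use r2 less P2 in auto)
      qed simp
    qed auto
  qed
  apply simp
  done

text \<open>A list of indices, rather than a set, determines where each selected row is stored. Its
  increasing order also rules out repetitions in the output.\<close>

definition selected :: "nat \<Rightarrow> (nat \<Rightarrow> bool) \<Rightarrow> (nat \<Rightarrow> rat) \<Rightarrow> nat \<Rightarrow> state \<Rightarrow> bool" where
  "selected k P F j h \<longleftrightarrow> reg h 5 = of_nat (length (filter P [0..<j])) \<and>
     (\<forall>q<length (filter P [0..<j]). \<forall>t<k. arr h 1 (q * k + t) = F (filter P [0..<j] ! q * k + t))"

lemma selected_step:
  assumes "selected k P F j h" "reg h' 5 = of_nat (length (filter P [0..<j]) + of_bool (P j))"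
    "\<And>y. y < length (filter P [0..<j]) * k \<Longrightarrow> arr h' 1 y = arr h 1 y"
    "\<And>t. P j \<Longrightarrow> t < k \<Longrightarrow> arr h' 1 (length (filter P [0..<j]) * k + t) = F (j * k + t)"
  shows "selected k P F (Suc j) h'"
proof -
  let ?l = "length (filter P [0..<j])"
  have old: "arr h' 1 (q * k + t) = F (filter P [0..<j] ! q * k + t)" if "q < ?l" "t < k" for q t
  proof -
    show ?thesis using index_less[OF that] assms(1,3) that by (simp add: selected_def)
  qed
  show ?thesis
    using assms(2,4) old by (auto simp: selected_def nth_append less_Suc_eq)
qed

definition select_chunk :: prog where
  "select_chunk = Seq (fill_matrix 6 6 cell (L 3 ((V 10 |+| V 20) |*| V 6 |+| V 21)))
     (Seq (matmul 6 6 4 7) (Seq (For 22 6 select_row) (10 ::= V 10 |+| V 6)))"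

definition select_prog :: prog where
  "select_prog = Seq (10 ::= K 0) (Seq (5 ::= K 0) (While 10 2 select_chunk))"

lemma hrun_select:
  fixes N :: nat and X :: "nat \<Rightarrow> nat \<Rightarrow> rat"
  assumes h: "reg h 0 = of_nat k" "reg h 2 = of_nat m" "reg h 4 = of_nat N" "reg h 6 = of_nat n" "n \<ge> 1"
    and X: "\<And>l t. l < n \<Longrightarrow> t < n \<Longrightarrow> arr h 4 (l * n + t) = X l t"
    and P: "\<And>j. P j \<longleftrightarrow> of_nat N < arr h 2 j *
      (\<Sum>t<n. (\<Sum>l<n. arr h 3 (j * n + l) * X l t) * arr h 3 (j * n + t)) * (of_nat N + 1)"
    and J: "\<And>c. c < J \<Longrightarrow> c * n < m" "m \<le> J * n"
    and post: "\<And>h'. selected k P (arr h 0) (J * n) h' \<Longrightarrow>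
      chg {5, 10, 11, 12, 13, 14, 20, 21, 22, 23, 39} {1, 6, 7} h h' \<Longrightarrow> Q h'"
  shows "hrun select_prog h (real J * (mm_time n + 300 * (real n * real n) + 19 * (real n * real k)) + 10) Q"
proof -
  let ?R = "{5, 10, 11, 12, 13, 14, 20, 21, 22, 23, 39} :: nat set"
  let ?I = "\<lambda>c h'. chg ?R {1, 6, 7} h h' \<and> reg h' 10 = of_nat (c * n) \<and> selected k P (arr h 0) (c * n) h'"
  let ?T = "mm_time n + 200 * (real n * real n) + 19 * (real n * real k)"
  have chunk: "hrun select_chunk h' (?T + 50) (?I (Suc c))" if I: "?I c h'" for c h'
  proof -
    have r: "reg h' 0 = of_nat k" "reg h' 4 = of_nat N" "reg h' 6 = of_nat n" "reg h' 10 = of_nat (c * n)"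
      "arr h' 0 = arr h 0" "arr h' 2 = arr h 2" "arr h' 3 = arr h 3" "arr h' 4 = arr h 4"
      using I h by (auto simp: chg_reg chg_arr)
    show ?thesis
      unfolding select_chunk_def
      apply (rule hrun_le)
       apply (rule hrun_Seq_exact)
       apply (rule hrun_fill_matrix[where n = n and f = "\<lambda>i t. i * n + t" and
            g = "\<lambda>i t. arr h 3 ((c * n + i) * n + t)", OF _ _ _ _ _ order_refl])
            apply (use h r in \<open>simp; fail\<close>)+
        apply (use index_inj in blast)
       apply (rule hrun_Seq_exact[where U = "(real n * (25 * real n + 19 * real k + 107) + 4) + 7"],
          rule hrun_mm[where n = n and P = "\<lambda>i t. arr h 3 ((c * n + i) * n + t)" and R = X])
            apply (use h r X in \<open>simp; fail\<close>)+
      subgoal premises p for h1 F h2 G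
      proof (rule hrun_Seq_exact[where T = "real n * (25 * real n + 19 * real k + 107) + 4" and U = 7])
        let ?I' = "\<lambda>i h3. chg {5, 11, 12, 13, 14, 22, 23} {1} h2 h3 \<and> selected k P (arr h 0) (c * n + i) h3"
        have c2: "chg {20, 21, 39} {6, 7} h' h2"
          using p by (auto simp: chg_def)
        show "hrun (For 22 6 select_row) h2 (real n * (25 * real n + 19 * real k + 107) + 4)
          (\<lambda>h'. hrun (10 ::= V 10 |+| V 6) h' 7 (?I (Suc c)))"
        proof (rule hrun_For[where n = n and T = "25 * real n + 19 * real k + 100" and I = ?I'])
          show "reg h2 6 = of_nat n" using r(3) chg_reg[OF c2, of 6] by simp
          show "?I' 0 (set_reg 22 0 h2)"
            using I chg_reg[OF c2, of 5] chg_arr[OF c2, of 1] by (auto simp: selected_def)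
        next
          fix i :: nat and h3 :: state
          assume i: "i < n" "reg h3 22 = of_nat i" "reg h3 6 = of_nat n" and I': "?I' i h3"
          have c3: "chg ?R {1, 6, 7} h' h3"
            by (rule chg_trans[OF c2 conjunct1[OF I']]) auto
          have r3: "reg h3 0 = of_nat k" "reg h3 4 = of_nat N" "arr h3 0 = arr h 0" "arr h3 2 = arr h 2"
            "arr h3 3 = arr h 3"
            using c3 r by (auto simp: chg_reg chg_arr)
          have r3': "reg h3 10 = of_nat (c * n)" "arr h3 7 = G"
            using chg_reg[OF conjunct1[OF I'], of 10] chg_reg[OF c2, of 10] r
              chg_arr[OF conjunct1[OF I'], of 7] p by auto
          have Pi: "P (c * n + i) \<longleftrightarrow> of_nat N < arr h3 2 (c * n + i) *
            (\<Sum>t<n. arr h3 7 (i * n + t) * arr h3 3 ((c * n + i) * n + t)) * (of_nat N + 1)"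
            unfolding P r3 r3' using p i(1) by (simp add: mmul_def)
          show "hrun select_row h3 (25 * real n + 19 * real k + 100) (\<lambda>h4. reg h4 22 = of_nat i \<and>
            reg h4 6 = of_nat n \<and> ?I' (Suc i) (set_reg 22 (of_nat (Suc i)) h4))"
          proof (rule hrun_select_row[where k = k and N = N and n = n and c = "c * n" and i = i and
                P = "P (c * n + i)" and q = "length (filter P [0..<c * n + i])"])
            show "reg h3 5 = of_nat (length (filter P [0..<c * n + i]))"
              using I' by (simp add: selected_def)
            fix h4
            assume 4: "chg {5, 11, 12, 13, 14, 23} {1} h3 h4"
              "reg h4 5 = of_nat (length (filter P [0..<c * n + i]) + of_bool (P (c * n + i)))"
              "\<And>y. y < length (filter P [0..<c * n + i]) * k \<Longrightarrow> arr h4 1 y = arr h3 1 y"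
              "\<And>t. P (c * n + i) \<Longrightarrow> t < k \<Longrightarrow>
                arr h4 1 (length (filter P [0..<c * n + i]) * k + t) = arr h3 0 ((c * n + i) * k + t)"
            have s: "selected k P (arr h 0) (Suc (c * n + i)) h4"
              by (rule selected_step[OF conjunct2[OF I']]) (use 4 r3 in auto)
            have "chg {5, 11, 12, 13, 14, 22, 23} {1} h2 h4"
              by (rule chg_trans[OF conjunct1[OF I'] 4(1)]) auto
            then show "reg h4 22 = of_nat i \<and>
              reg h4 6 = of_nat n \<and> ?I' (Suc i) (set_reg 22 (of_nat (Suc i)) h4)"
              using s i chg_reg[OF 4(1)] by (simp add: selected_def)
          qed (use r3 r3' i Pi in auto)
        next
          fix h3 assume I': "?I' n h3"
          have c3: "chg ?R {1, 6, 7} h' h3"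
            by (rule chg_trans[OF c2 conjunct1[OF I']]) auto
          have c4: "chg ?R {1, 6, 7} h h3"
            by (rule chg_trans[OF conjunct1[OF I] c3]) auto
          have r3: "reg h3 6 = of_nat n" "reg h3 10 = of_nat (c * n)"
            using chg_reg[OF c3, of 6] chg_reg[OF conjunct1[OF I'], of 10] chg_reg[OF c2, of 10] r by auto
          show "hrun (10 ::= V 10 |+| V 6) h3 7 (?I (Suc c))"
            by (rule hrun_asg) (use c4 r3 I' in \<open>auto simp: selected_def add.commute\<close>)
        next
          show "real n * (25 * real n + 19 * real k + 100 + 7) + 4
            \<le> real n * (25 * real n + 19 * real k + 107) + 4"
            by (simp add: algebra_simps)
        qed auto
      qed
      subgoal
      proof -
        have "1 * real n \<le> real n * real n"
          using h(5) by (intro mult_right_mono) auto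
        then show ?thesis by (simp add: algebra_simps)
      qed
      done
  qed
  have "hrun (While 10 2 select_chunk) h1 (real J * (?T + 51) + 1) Q" if "?I 0 h1" for h1
  proof (rule hrun_While[where n = J and T = "?T + 50" and I = ?I])
    fix c :: nat and h' :: state assume c: "c < J" and I: "?I c h'"
    have "(of_nat (c * n) :: rat) < of_nat m" using J(1)[OF c] by (simp only: of_nat_less_iff)
    then show "reg h' 10 < reg h' 2 \<and> hrun select_chunk h' (?T + 50) (?I (Suc c))"
      using I h(2) chunk[OF I] chg_reg[OF conjunct1[OF I], of 2] by simp
  next
    fix h' :: state assume I: "?I J h'"
    have "(of_nat m :: rat) \<le> of_nat (J * n)" using J(2) by (simp only: of_nat_le_iff)
    then show "\<not> reg h' 10 < reg h' 2"
      using I h(2) chg_reg[OF conjunct1[OF I], of 2] by simp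
  qed (use that post in \<open>auto simp: algebra_simps\<close>)
  note loop = this
  show ?thesis
    unfolding select_prog_def
    apply (rule hrun_le)
     apply (rule hrun_Seq_exact, rule hrun_asg_exact, simp, simp)
     apply (rule hrun_Seq_exact, rule hrun_asg_exact, simp, simp)
     apply (rule loop)
     apply (simp add: selected_def chg_def)
    subgoal
    proof -
      have "real J \<le> real J * (real n * real n)"
        using mult_left_mono[OF one_le_square[OF h(5)], of "real J"] by simp
      then show ?thesis by (simp add: algebra_simps)
    qed
    done
qed

section \<open>The assembled selection program and its running time\<close>

definition solve_prog :: prog where
  "solve_prog = Seq gram_prog (Seq invert select_prog)"

lemma hrun_solve:
  fixes xs :: "nat list list" and n r k :: nat and \<delta> :: rat
  defines "m \<equiv> length xs"
  defines "a \<equiv> \<lambda>j t. if t < r ^ k then vandermonde r k (xs ! j) t else 0"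
  assumes h: "reg h 0 = of_nat k" "reg h 2 = of_nat m" "reg h 4 = of_nat (r ^ k)" "reg h 6 = of_nat n"
      "reg h 9 = \<delta> ^ m" "n = 2 ^ v" "0 < \<delta>"
    and d: "\<And>j. j < m \<Longrightarrow> arr h 2 j = \<delta> ^ j" "\<And>j. m \<le> j \<Longrightarrow> j < m + n \<Longrightarrow> arr h 2 j = 0"
    and A: "\<And>j t. j < m \<Longrightarrow> t < n \<Longrightarrow> arr h 3 (j * n + t) = a j t"
    and J: "\<And>c. c < J \<Longrightarrow> c * n < m" "m \<le> J * n" "J * n < m + n"
    and post: "\<And>h' X. right_inverse n (weighted_rows.gram m a (power \<delta>) (\<delta> ^ m)) X \<Longrightarrow>
      selected k (\<lambda>j. of_nat (r ^ k) < weighted_rows.leverage n a (power \<delta>) X j * (of_nat (r ^ k) + 1)) (arr h 0) m h' \<Longrightarrow>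
      reg h' 0 = of_nat k \<Longrightarrow> Q h'"
  shows "hrun solve_prog h (60 * (real n * real n) + real J * (2 * mm_time n + 601 * (real n * real n) + 19 * (real n * real k))
    + invert_const * real n powr w + 80) Q"
proof -
  interpret W: weighted_rows n m a "power \<delta>" "\<delta> ^ m" X for X
    by unfold_locales (use h in auto)
  have n: "n \<ge> 1" using h(6) by simp
  have "hrun solve_prog h ((60 * (real n * real n) + real J * (mm_time n + 301 * (real n * real n)) + 4) +
    ((invert_const * real n powr w + 60) +
     (real J * (mm_time n + 300 * (real n * real n) + 19 * (real n * real k)) + 10))) Q"
    unfolding solve_prog_def
  proof (rule hrun_Seq_exact, rule hrun_gram[OF h(4) n h(2) h(5) d(2) J])
    fix h1
    assume 1: "chg {10, 20, 21, 22, 39} {4, 5, 6, 7} h h1"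
      "\<And>i t. i < n \<Longrightarrow> t < n \<Longrightarrow> arr h1 4 (i * n + t) = of_bool (i = t) * \<delta> ^ m +
        (\<Sum>j<m. arr h 2 j * arr h 3 (j * n + i) * arr h 3 (j * n + t))"
    have gram: "block_get (arr h1 4) n 0 0 i t = W.gram i t" if "i < n" "t < n" for i t
      using that 1(2) d(1) A by (simp add: block_get_def W.gram_def)
    have pd: "pos_def n (block_get (arr h1 4) n 0 0)"
      using W.pos_def_gram gram unfolding pos_def_def by simp
    show "hrun (Seq invert select_prog) h1 ((invert_const * real n powr w + 60) +
      (real J * (mm_time n + 300 * (real n * real n) + 19 * (real n * real k)) + 10)) Q"
    proof (rule hrun_Seq_exact, rule hrun_invert[OF _ h(6) pd])
      show "reg h1 6 = of_nat n" using 1(1) h(4) by (simp add: chg_reg)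
      fix h2
      assume 2: "chg {11, 12, 13, 14, 15, 16, 17, 18, 20, 21, 39} {4, 5, 6, 7, 8, 9, 10, 11} h1 h2"
        "right_inverse n (block_get (arr h1 4) n 0 0) (block_get (arr h2 4) n 0 0)"
      define X where "X = block_get (arr h2 4) n 0 0"
      have X: "right_inverse n W.gram X"
        using 2(2) unfolding right_inverse_def X_def[symmetric] by (simp add: mmul_def gram)
      define P where "P j \<longleftrightarrow> of_nat (r ^ k) < arr h2 2 j *
        (\<Sum>t<n. (\<Sum>l<n. arr h2 3 (j * n + l) * X l t) * arr h2 3 (j * n + t)) * (of_nat (r ^ k) + 1)" for j
      have old: "arr h2 0 = arr h 0" "arr h2 2 = arr h 2" "arr h2 3 = arr h 3"
        "reg h2 0 = of_nat k" "reg h2 2 = of_nat m" "reg h2 4 = of_nat (r ^ k)" "reg h2 6 = of_nat n"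
        using 1(1) 2(1) h by (simp_all add: chg_arr chg_reg del: of_nat_power)
      have P1: "P j \<longleftrightarrow> of_nat (r ^ k) < W.leverage X j * (of_nat (r ^ k) + 1)" if "j < m" for j
        using that d(1) A by (simp add: P_def old W.leverage_def)
      have P2: "\<not> P j" if "m \<le> j" "j < m + n" for j
        using that d(2) by (simp add: P_def old)
      show "hrun select_prog h2 (real J * (mm_time n + 300 * (real n * real n) + 19 * (real n * real k)) + 10) Q"
      proof (rule hrun_select[OF old(4-7) n _ P_def J(1,2)])
        show "arr h2 4 (l * n + t) = X l t" for l t by (simp add: X_def block_get_def)
        fix h3
        assume 3: "selected k P (arr h2 0) (J * n) h3"
          "chg {5, 10, 11, 12, 13, 14, 20, 21, 22, 23, 39} {1, 6, 7} h2 h3"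
        \<comment> \<open>Indices from \<open>m\<close> on have weight 0, hence score 0, and are
          never selected.\<close>
        have "[0..<J * n] = [0..<m] @ [m..<J * n]"
          using upt_add_eq_append[of 0 m "J * n - m"] J(2) by simp
        then have "filter P [0..<J * n] = filter P [0..<m]"
          using P2 J(3) by simp
        also have "\<dots> = filter (\<lambda>j. of_nat (r ^ k) < W.leverage X j * (of_nat (r ^ k) + 1)) [0..<m]"
          by (rule filter_cong) (use P1 in auto)
        finally show "Q h3"
          using 3 old X chg_reg[OF 3(2), of 0] by (intro post) (auto simp: selected_def)
      qed auto
    qed
  qed auto
  then show ?thesis
    by (rule hrun_le) (simp add: algebra_simps)
qed

definition big_prog :: prog where
  "big_prog = Seq sum_input (Seq (power_prog 10 9 22 1) (Seq (power_prog 8 10 22 0)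
     (Seq (8 ::= K 1 |/| (K 4 |*| V 4 |*| (V 8 |*| V 8)))
     (Seq weights_prog (Seq rows_prog solve_prog)))))"

definition chosen :: "nat \<Rightarrow> nat \<Rightarrow> nat list list \<Rightarrow> state \<Rightarrow> state \<Rightarrow> bool" where
  "chosen k r xs h h' \<longleftrightarrow> reg h' 0 = of_nat k \<and> (\<exists>P. selected k P (arr h 0) (length xs) h' \<and>
     card {j. j < length xs \<and> P j} \<le> r ^ k \<and>
     represents k (r - 1) ((!) xs ` {j. j < length xs \<and> P j}) (set xs))"

lemma hrun_big:
  fixes xs :: "nat list list"
  defines "m \<equiv> length xs"
  assumes h: "reg h 0 = of_nat k" "reg h 1 = of_nat r" "reg h 2 = of_nat m" "reg h 3 = of_nat (m * k)"
      "reg h 4 = of_nat (r ^ k)" "reg h 6 = of_nat n" "n = 2 ^ v" "r ^ k \<le> n"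
    and kr: "k \<ge> 1" "r \<ge> 1"
    and xs: "stores_tuples (arr h 0) k xs" "\<And>x. x \<in> set xs \<Longrightarrow> length x = k"
    and J: "\<And>c. c < J \<Longrightarrow> c * n < m" "m \<le> J * n" "J * n < m + n"
  shows "hrun big_prog h (60 * (real n * real n) + real J * (2 * mm_time n + 601 * (real n * real n) + 19 * (real n * real k))
    + invert_const * real n powr w + 20 * (real m * real k) + 20 * real r + 20 * real k + 30 * (real m + real n) +
    real m * (200 * (real k * real n) + 7) + 300) (chosen k r xs h)"
proof -
  define W where "W = 1 + (\<Sum>j<m. \<Sum>i<k. xs ! j ! i)"
  have sum: "1 + (\<Sum>x<m * k. arr h 0 x) = of_nat W"
  proof -
    have "(\<Sum>x<m * k. arr h 0 x) = (\<Sum>j<m. \<Sum>i<k. arr h 0 (j * k + i))"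
      using kr(1) sum_digits[of k "\<lambda>i j. arr h 0 (j * k + i)" m] by simp
    also have "\<dots> = (\<Sum>j<m. \<Sum>i<k. of_nat (xs ! j ! i))"
      using xs(1) by (intro sum.cong refl) (simp add: stores_tuples_def m_def)
    finally show ?thesis by (simp add: W_def)
  qed
  have bound: "Suc (x ! i) \<le> W" if "x \<in> set xs" "i < k" for x i
  proof -
    from that(1) obtain j where j: "j < m" "x = xs ! j" by (auto simp: in_set_conv_nth m_def)
    have "x ! i \<le> (\<Sum>i<k. xs ! j ! i)"
      unfolding j(2) by (rule member_le_sum) (use that in auto)
    also have "\<dots> \<le> (\<Sum>j<m. \<Sum>i<k. xs ! j ! i)"
      by (rule member_le_sum[of j]) (use j in auto)
    finally show ?thesis by (simp add: W_def)
  qed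
  define \<delta> where "\<delta> = step_weight r k W"
  have W1: "W \<ge> 1" by (simp add: W_def)
  have \<delta>: "0 < \<delta>" using kr W1 by (simp add: \<delta>_def step_weight_def)
  show ?thesis
    unfolding big_prog_def
    apply (rule hrun_le)
     apply (rule hrun_Seq_exact, rule hrun_sum_input[where M = "m * k"])
      apply (use h in \<open>simp; fail\<close>)
     apply (unfold sum)
     apply (rule hrun_Seq_exact, rule hrun_power[where e = r])
           apply (use h in \<open>simp; fail\<close>)+
     apply (rule hrun_Seq_exact, rule hrun_power[where e = k])
           apply (use h in \<open>simp; fail\<close>)+
     apply (rule hrun_Seq_exact, rule hrun_asg_exact, simp, simp)
     apply (rule hrun_Seq_exact, rule hrun_weights[where m = m and n = n and \<delta> = \<delta>])
        apply (use h in \<open>simp; fail\<close>)+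
      apply (use h in \<open>simp add: \<delta>_def step_weight_def; fail\<close>)
     apply (rule hrun_Seq_exact, rule hrun_rows[where k = k and r = r and n = n and xs = xs])
             apply (use h kr xs in \<open>simp add: m_def; fail\<close>)+
     apply (rule hrun_solve[where xs = xs and r = r and k = k and n = n and \<delta> = \<delta> and v = v and J = J, folded m_def])
                    apply (use h \<delta> J in \<open>simp add: chg_reg chg_arr; fail\<close>)+
       apply (simp add: m_def)
      apply (rule J, assumption)
     apply (rule J)+
    subgoal premises p for h1 h2 h3 h4 F h5 h6 X
    proof -
      let ?P = "\<lambda>j. of_nat (r ^ k) < weighted_rows.leverage n
        (\<lambda>j t. if t < r ^ k then vandermonde r k (xs ! j) t else 0) (power \<delta>) X j * (of_nat (r ^ k) + 1)"
      have X: "right_inverse n (weighted_rows.gram m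
        (\<lambda>j t. if t < r ^ k then vandermonde r k (xs ! j) t else 0) (power \<delta>) (\<delta> ^ m)) X"
        using p by blast
      have "card {j. j < m \<and> ?P j} \<le> r ^ k" "represents k (r - 1) ((!) xs ` {j. j < m \<and> ?P j}) (set xs)"
        using represents_large_leverage[OF kr(2) W1 xs(2) bound h(8) X[unfolded m_def \<delta>_def]]
        by (simp_all add: m_def \<delta>_def)
      moreover have "selected k ?P (arr h 0) m h6"
        using p by (simp add: chg_arr)
      moreover have "reg h6 0 = of_nat k" using p by blast
      ultimately show ?thesis
        unfolding chosen_def m_def by blast
    qed
    apply (simp add: algebra_simps m_def)
    done
qed

text \<open>The factor \<open>2 powr w\<close> stems from \<open>n \<le> 2 * N\<close>. As
  \<open>J * n \<le> 3 * m\<close>, the work per chunk counts three times: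
  \<open>1863 = 60 + 3 * 601\<close> and \<open>6 = 2 * 3\<close>. The 3000 covers everything
  outside the matrix computations.\<close>

definition run_const :: real where
  "run_const = 2 powr w * (1863 + 6 * (\<bar>cM\<bar> + 40) + invert_const) + 3000"

lemma run_const_ge: "3000 \<le> run_const"
  unfolding run_const_def invert_const_def by simp

text \<open>\<open>N < m\<close> lets the inversion, of order \<open>N powr w\<close>, be charged to
  \<open>m * N powr (w - 1)\<close>. It also gives \<open>n \<le> 2 * m\<close>, hence
  \<open>J * n \<le> 3 * m\<close>, so the \<open>J\<close> products cost at most
  \<open>3 * m * n powr (w - 1)\<close> up to constants.\<close>

lemma big_time:
  fixes N n m k J r :: nat
  assumes N: "1 \<le> N" "N < m" "n \<le> 2 * N" "1 \<le> n" "J * n < m + n" and k: "1 \<le> k" and r: "r \<le> N"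
  shows "60 * (real n * real n) + real J * (2 * mm_time n + 601 * (real n * real n) + 19 * (real n * real k))
    + invert_const * real n powr w + 20 * (real m * real k) + 20 * real r + 20 * real k + 30 * (real m + real n) +
    real m * (200 * (real k * real n) + 7) + 300 \<le> (run_const - 1000) * (real m * real N powr (w - 1) * real k)"
proof -
  define p where "p = real N powr (w - 1)"
  define Y where "Y = real m * p * real k"
  have Np: "real N \<le> p"
    using powr_mono[of 1 "w - 1" "real N"] N(1) w_ge by (simp add: p_def)
  have p1: "1 \<le> p" using Np N(1) by linarith
  have m1: "1 \<le> real m" and k1: "1 \<le> real k" using N k by simp_all
  have mp: "real m * p \<le> Y" unfolding Y_def using mult_left_mono[OF k1, of "real m * p"] p1 by simp
  have mk: "real m * real k \<le> Y"
    unfolding Y_def using mult_left_mono[OF p1, of "real m * real k"] by (simp add: mult_ac)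
  have mY: "real m \<le> Y" using mult_left_mono[OF k1, of "real m"] mk by linarith
  have kY: "real k \<le> Y" using mult_right_mono[OF m1, of "real k"] mk by linarith
  have n2: "real n \<le> 2 * real N" using of_nat_mono[OF N(3), where ?'a = real] by simp
  have nm: "real n \<le> 2 * real m" using n2 N(2) by linarith
  have rY: "real r \<le> Y" using r N(2) mY by linarith
  have two: "(2::real) powr w \<ge> 0" by simp
  have powr_w: "real x powr w = real x * real x powr (w - 1)" if "1 \<le> x" for x :: nat
    using that powr_add[of "real x" 1 "w - 1"] by simp
  have F0: "real n powr (w - 1) \<le> 2 powr w * p"
  proof -
    have "real n powr (w - 1) \<le> (2 * real N) powr (w - 1)"
      using n2 w_ge by (intro powr_mono2) auto
    also have "\<dots> = 2 powr (w - 1) * p" by (simp add: powr_mult p_def)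
    also have "\<dots> \<le> 2 powr w * p" using p1 by (intro mult_right_mono powr_mono) auto
    finally show ?thesis .
  qed
  have F1: "real n powr w \<le> 2 powr w * Y"
  proof -
    have "real n powr w \<le> (2 * real N) powr w" using n2 w_ge by (intro powr_mono2) auto
    also have "\<dots> = 2 powr w * (real N * p)" using powr_w[OF N(1)] by (simp add: powr_mult p_def)
    also have "\<dots> \<le> 2 powr w * (real m * p)" using N(2) p1 by (intro mult_left_mono mult_right_mono) auto
    also have "\<dots> \<le> 2 powr w * Y" using mp by (intro mult_left_mono) auto
    finally show ?thesis .
  qed
  have Jn: "real J * real n \<le> 3 * real m"
    using of_nat_mono[OF less_imp_le[OF N(5)], where ?'a = real] nm by simp
  have F2: "real J * real n powr w \<le> 3 * (2 powr w * Y)"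
  proof -
    have "real J * real n powr w = (real J * real n) * real n powr (w - 1)"
      using powr_w[OF N(4)] by simp
    also have "\<dots> \<le> (3 * real m) * (2 powr w * p)"
      by (rule mult_mono[OF Jn F0]) auto
    also have "\<dots> = 3 * (2 powr w * (real m * p))" by simp
    also have "\<dots> \<le> 3 * (2 powr w * Y)" using mp by (intro mult_left_mono) auto
    finally show ?thesis .
  qed
  have F3: "real n * real n \<le> real n powr w" by (rule n2_le_powr[OF N(4)])
  have F3': "real J * (real n * real n) \<le> real J * real n powr w" using F3 by (intro mult_left_mono) auto
  have F4: "real J * (real n * real k) \<le> 3 * Y"
  proof -
    have "(real J * real n) * real k \<le> 3 * real m * real k" using Jn by (intro mult_right_mono) auto
    then show ?thesis using mk by (simp add: mult.assoc)
  qed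
  have F5: "real m * (real k * real n) \<le> 2 * Y"
  proof -
    have "(real m * real k) * real n \<le> (real m * real k) * (2 * p)"
      using n2 Np by (intro mult_left_mono) auto
    then show ?thesis by (simp add: Y_def mult_ac)
  qed
  have F6: "invert_const * real n powr w \<le> invert_const * (2 powr w * Y)"
    using F1 by (intro mult_left_mono) (auto simp: invert_const_def)
  have F7: "(\<bar>cM\<bar> + 40) * (real J * real n powr w) \<le> (\<bar>cM\<bar> + 40) * (3 * (2 powr w * Y))"
    using F2 by (intro mult_left_mono) auto
  have "60 * (real n * real n) + real J * (2 * mm_time n + 601 * (real n * real n) + 19 * (real n * real k))
    + invert_const * real n powr w + 20 * (real m * real k) + 20 * real r + 20 * real k + 30 * (real m + real n) +
    real m * (200 * (real k * real n) + 7) + 300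
    = 60 * (real n * real n) + 2 * ((\<bar>cM\<bar> + 40) * (real J * real n powr w)) + 601 * (real J * (real n * real n)) +
      19 * (real J * (real n * real k)) + invert_const * real n powr w + 20 * (real m * real k) + 20 * real r +
      20 * real k + 30 * real m + 30 * real n + 200 * (real m * (real k * real n)) + 7 * real m + 300"
    by (simp add: mm_time_def algebra_simps)
  also have "\<dots> \<le> 60 * (2 powr w * Y) + 2 * ((\<bar>cM\<bar> + 40) * (3 * (2 powr w * Y))) + 601 * (3 * (2 powr w * Y)) +
      19 * (3 * Y) + invert_const * (2 powr w * Y) + 20 * Y + 20 * Y + 20 * Y + 30 * Y + 60 * Y + 400 * Y + 7 * Y + 500 * Y"
    using F1 F2 F3 F3' F4 F5 F6 F7 mk rY kY mY nm m1 by linarith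
  also have "\<dots> = (run_const - 1886) * Y" by (simp add: run_const_def algebra_simps)
  also have "\<dots> \<le> (run_const - 1000) * Y" using mY m1 by (intro mult_right_mono) auto
  finally show ?thesis by (simp add: Y_def p_def)
qed

text \<open>If \<open>R\<close> has at most \<open>r ^ k\<close> elements, it is copied to the
  output unchanged. Register 38 receives the number of output cells, which is needed for moving them
  out of the simulated memory.\<close>

definition main_prog :: prog where
  "main_prog = Seq (power_prog 4 1 22 0) (Seq (IfLess 4 2 (Seq round_up big_prog)
     (Seq (For 22 3 (sto 1 (V 22) (L 0 (V 22)))) (5 ::= V 2))) (38 ::= V 5 |*| V 0))"

lemma represents_refl: "set xs \<subseteq> {a. length a = k} \<Longrightarrow> represents k q (set xs) (set xs)"
  by (simp add: represents_def)

lemma hrun_small: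
  assumes h: "reg h 0 = of_nat k" "reg h 2 = of_nat (length xs)" "reg h 3 = of_nat (length xs * k)"
    and small: "length xs \<le> r ^ k" and k: "\<And>x. x \<in> set xs \<Longrightarrow> length x = k"
  shows "hrun (Seq (For 22 3 (sto 1 (V 22) (L 0 (V 22)))) (5 ::= V 2)) h (20 * (real (length xs) * real k) + 20)
    (chosen k r xs h)"
proof -
  let ?m = "length xs"
  have P: "filter (\<lambda>_. True) [0..<?m] = [0..<?m]" "{j. j < ?m \<and> True} = {..<?m}" by auto
  have S: "(!) xs ` {..<?m} = set xs" by (auto simp: set_conv_nth)
  have rep: "card {j. j < ?m \<and> True} \<le> r ^ k" "represents k (r - 1) ((!) xs ` {j. j < ?m \<and> True}) (set xs)"
    unfolding P S using small k by (auto intro: represents_refl)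
  show ?thesis
  proof (rule hrun_Seq[where U = 4])
    show "hrun (For 22 3 (sto 1 (V 22) (L 0 (V 22)))) h (real (?m * k) * 13 + 4)
      (\<lambda>h'. hrun (5 ::= V 2) h' 4 (chosen k r xs h))"
    proof (rule hrun_For[where n = "?m * k" and T = 6 and I = "\<lambda>c h'. chg {22} {1} h h' \<and>
        (\<forall>y<c. arr h' 1 y = arr h 0 y)"])
      fix c :: nat and h' :: state
      assume I: "chg {22} {1} h h' \<and> (\<forall>y<c. arr h' 1 y = arr h 0 y)"
        and c: "reg h' 22 = of_nat c" "reg h' 3 = of_nat (?m * k)"
      have "arr h' 0 = arr h 0" using I by (auto simp: chg_arr)
      then show "hrun (sto 1 (V 22) (L 0 (V 22))) h' 6 (\<lambda>h'. reg h' 22 = of_nat c \<and>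
        reg h' 3 = of_nat (?m * k) \<and> chg {22} {1} h (set_reg 22 (of_nat (Suc c)) h') \<and>
        (\<forall>y<Suc c. arr (set_reg 22 (of_nat (Suc c)) h') 1 y = arr h 0 y))"
        using I c by (intro hrun_sto) (auto simp: chg_def less_Suc_eq)
    next
      fix h' :: state
      assume I: "chg {22} {1} h h' \<and> (\<forall>y<?m * k. arr h' 1 y = arr h 0 y)"
      have r: "reg h' 2 = of_nat ?m" "reg h' 0 = of_nat k" using I h by (auto simp: chg_reg)
      have "chosen k r xs h (set_reg 5 (of_nat ?m) h')"
        unfolding chosen_def
      proof (intro conjI exI[of _ "\<lambda>_. True"] rep)
        show "selected k (\<lambda>_. True) (arr h 0) ?m (set_reg 5 (of_nat ?m) h')"
          using I index_less unfolding selected_def P by simp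
      qed (use r in simp)
      then show "hrun (5 ::= V 2) h' 4 (chosen k r xs h)"
        using r by (intro hrun_asg) auto
    qed (use h in auto)
  qed simp
qed

lemma hrun_main:
  fixes xs :: "nat list list"
  defines "m \<equiv> length xs"
  assumes h: "reg h 0 = of_nat k" "reg h 1 = of_nat r" "reg h 2 = of_nat m" "reg h 3 = of_nat (m * k)"
    and kr: "k \<ge> 1" "r \<ge> 1"
    and xs: "stores_tuples (arr h 0) k xs" "\<And>x. x \<in> set xs \<Longrightarrow> length x = k"
  shows "hrun main_prog h (run_const * (max 1 (real m) * real (r ^ k) powr (w - 1) * real k))
    (\<lambda>h'. chosen k r xs h h' \<and> reg h' 38 = reg h' 5 * of_nat k)"
proof -
  let ?Q = "\<lambda>h'. chosen k r xs h h' \<and> reg h' 38 = reg h' 5 * of_nat k"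
  define N where "N = r ^ k"
  \<comment> \<open>Computing \<open>r ^ k\<close> takes a time proportional to \<open>k\<close>
    even for an empty input, hence the maximum.\<close>
  define Z where "Z = max 1 (real m) * real N powr (w - 1) * real k"
  have N1: "1 \<le> N" using kr by (simp add: N_def)
  have rN: "r \<le> N" unfolding N_def using kr power_increasing[of 1 k r] by simp
  have p1: "1 \<le> real N powr (w - 1)" using N1 w_ge by (simp add: ge_one_powr_ge_zero)
  have mk: "real m * real k \<le> Z" "real k \<le> Z"
  proof -
    have "max 1 (real m) * 1 * real k \<le> Z"
      unfolding Z_def using p1 by (intro mult_right_mono mult_left_mono) auto
    moreover have "real m * real k \<le> max 1 (real m) * real k" "1 * real k \<le> max 1 (real m) * real k"
      by (intro mult_right_mono; simp)+
    ultimately show "real m * real k \<le> Z" "real k \<le> Z" by simp_all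
  qed
  have Z1: "1 \<le> Z" using mk(2) kr(1) by linarith
  have RZ: "3000 * Z \<le> run_const * Z"
    using run_const_ge Z1 by (intro mult_right_mono) auto
  have last: "hrun (38 ::= V 5 |*| V 0) h' 10 ?Q" if "chosen k r xs h h'" for h'
    using that by (intro hrun_asg) (auto simp: chosen_def selected_def)
  have branch: "hrun (IfLess 4 2 (Seq round_up big_prog)
     (Seq (For 22 3 (sto 1 (V 22) (L 0 (V 22)))) (5 ::= V 2))) h1 (run_const * Z - 50 - 20 * real k)
     (\<lambda>h'. hrun (38 ::= V 5 |*| V 0) h' 10 ?Q)"
    if h1: "reg h1 = (reg h)(4 := of_nat N, 22 := of_nat k)" "arr h1 = arr h" for h1
  proof (rule hrun_IfLess[where T = "run_const * Z - 51 - 20 * real k"])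
    assume less: "reg h1 4 < reg h1 2"
    then have "(of_nat N :: rat) < of_nat m" using h1 h by simp
    then have Nm: "N < m" by (simp only: of_nat_less_iff)
    then have Zeq: "Z = real m * real N powr (w - 1) * real k" by (simp add: Z_def)
    have mZ: "real m \<le> Z" using mk kr(1) mult_left_mono[of 1 "real k" "real m"] by simp
    show "hrun (Seq round_up big_prog) h1 (run_const * Z - 51 - 20 * real k)
      (\<lambda>h'. hrun (38 ::= V 5 |*| V 0) h' 10 ?Q)"
    proof (rule hrun_Seq[where T = "12 * (real N + 1)" and U = "(run_const - 1000) * Z"])
      show "hrun round_up h1 (12 * (real N + 1)) (\<lambda>h'. hrun big_prog h' ((run_const - 1000) * Z)
        (\<lambda>h'. hrun (38 ::= V 5 |*| V 0) h' 10 ?Q))"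
      proof (rule hrun_round_up[OF _ N1])
        show "reg h1 4 = of_nat N" using h1 by simp
        fix h2 :: state and v :: nat assume 2: "reg h2 = (reg h1)(6 := of_nat (2 ^ v))" "arr h2 = arr h1" "N \<le> 2 ^ v" "2 ^ v \<le> 2 * N"
        have n1: "(1::nat) \<le> 2 ^ v" by simp
        obtain J where J: "\<And>c. c < J \<Longrightarrow> c * 2 ^ v < m" "m \<le> J * 2 ^ v" "J * 2 ^ v < m + 2 ^ v"
          using chunk_count[OF n1, of m] by blast
        show "hrun big_prog h2 ((run_const - 1000) * Z) (\<lambda>h'. hrun (38 ::= V 5 |*| V 0) h' 10 ?Q)"
        proof (rule hrun_mono[OF hrun_big[where k = k and r = r and xs = xs and n = "2 ^ v" and v = v and J = J]])
          show "hrun (38 ::= V 5 |*| V 0) h' 10 ?Q" if "chosen k r xs h2 h'" for h'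
            by (rule last) (use that h1 2 in \<open>simp add: chosen_def\<close>)
        next
          show "60 * (real (2 ^ v) * real (2 ^ v)) + real J * (2 * mm_time (2 ^ v) +
              601 * (real (2 ^ v) * real (2 ^ v)) + 19 * (real (2 ^ v) * real k)) +
            invert_const * real (2 ^ v) powr w + 20 * (real (length xs) * real k) + 20 * real r + 20 * real k +
            30 * (real (length xs) + real (2 ^ v)) +
            real (length xs) * (200 * (real k * real (2 ^ v)) + 7) + 300 \<le> (run_const - 1000) * Z"
            using big_time[OF N1 Nm 2(4) n1 J(3) kr(1) rN] unfolding Zeq m_def .
        qed (use h h1 2 kr xs J in \<open>auto simp: m_def N_def\<close>)
      qed
      show "12 * (real N + 1) + (run_const - 1000) * Z \<le> run_const * Z - 51 - 20 * real k"
        using Nm mZ mk Z1 by (simp add: algebra_simps)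
    qed
  next
    assume "\<not> reg h1 4 < reg h1 2"
    then have "(of_nat m :: rat) \<le> of_nat N" using h1 h by simp
    then have mN: "length xs \<le> r ^ k" unfolding m_def N_def by (simp only: of_nat_le_iff)
    show "hrun (Seq (For 22 3 (sto 1 (V 22) (L 0 (V 22)))) (5 ::= V 2)) h1 (run_const * Z - 51 - 20 * real k)
      (\<lambda>h'. hrun (38 ::= V 5 |*| V 0) h' 10 ?Q)"
    proof (rule hrun_mono[OF hrun_small[where k = k and r = r and xs = xs]])
      show "20 * (real (length xs) * real k) + 20 \<le> run_const * Z - 51 - 20 * real k"
        using RZ mk Z1 unfolding m_def by linarith
      show "hrun (38 ::= V 5 |*| V 0) h' 10 ?Q" if "chosen k r xs h1 h'" for h'
        by (rule last) (use that h1 in \<open>simp add: chosen_def\<close>)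
    qed (use h1 h mN xs in \<open>auto simp: m_def\<close>)
  qed auto
  show ?thesis
    unfolding main_prog_def
    apply (rule hrun_le)
     apply (rule hrun_Seq_exact, rule hrun_power[where e = k])
           apply (use h in \<open>simp; fail\<close>)+
     apply (rule hrun_Seq_exact, rule branch)
      apply (use h in \<open>simp add: N_def; fail\<close>)
     apply assumption
    apply (simp add: Z_def N_def algebra_simps)
    done
qed

end

section \<open>The matrix multiplication exponent\<close>

text \<open>Writing down the product of two zero matrices already takes \<open>n\<^sup>2\<close> steps.\<close>

lemma matmul_time_ge_2:
  assumes "matmul_time w"
  shows "2 \<le> w"
proof (rule ccontr)
  assume "\<not> 2 \<le> w"
  from assms obtain P c where P: "\<And>n A B s. n \<ge> 1 \<Longrightarrow> A \<in> carrier_mat n n \<Longrightarrow> B \<in> carrier_mat n n \<Longrightarrow>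
      reg s 0 = of_nat n \<Longrightarrow> stores_matrix (arr s 0) n A \<Longrightarrow> stores_matrix (arr s 1) n B \<Longrightarrow>
      runs_within P s (c * real n powr w) (\<lambda>s'. stores_matrix (arr s' 2) n (A * B))"
    unfolding matmul_time_def by blast
  have le: "real n powr (2 - w) \<le> c" if n: "n \<ge> 1" for n
  proof -
    \<comment> \<open>Array 2 starts with ones, so each of the \<open>n * n\<close> zeros of the
      product requires a change.\<close>
    let ?s = "\<lparr>reg = \<lambda>_. of_nat n, arr = \<lambda>A _. if A = 2 then 1 else 0\<rparr>"
    let ?Z = "0\<^sub>m n n :: rat mat"
    have "runs_within P ?s (c * real n powr w) (\<lambda>s'. stores_matrix (arr s' 2) n (?Z * ?Z))"
      by (rule P) (use n in \<open>auto simp: stores_matrix_def index_less\<close>)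
    then obtain t s' where s': "exec P ?s t s'" "real t \<le> c * real n powr w" "stores_matrix (arr s' 2) n (?Z * ?Z)"
      unfolding runs_within_def by blast
    have zero: "arr s' 2 x = 0" if "x < n * n" for x
    proof -
      have "x div n < n" "x mod n < n" using that n by (simp_all add: less_mult_imp_div_less)
      then show ?thesis
        using s'(3) unfolding stores_matrix_def by (metis div_mult_mod_eq index_zero_mat(1) left_mult_zero_mat zero_carrier_mat)
    qed
    have sub: "{..<n * n} \<subseteq> {i. arr s' 2 i \<noteq> arr ?s 2 i}"
      using zero by auto
    have "changed_cells_le (arr ?s 2) (arr s' 2) t"
      by (rule exec_changed_cells[OF s'(1)])
    then have "n * n \<le> t"
      using card_mono[OF _ sub] unfolding changed_cells_le_def by fastforce
    then have "real n * real n \<le> c * real n powr w"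
      using s'(2) of_nat_mono[of "n * n" t, where ?'a = real] by simp
    moreover have "real n * real n = real n powr (2 - w) * real n powr w"
      using n by (simp add: powr_add[symmetric] powr_numeral power2_eq_square)
    ultimately show ?thesis
      using n by simp
  qed
  define e where "e = 2 - w"
  have e: "0 < e" using \<open>\<not> 2 \<le> w\<close> by (simp add: e_def)
  \<comment> \<open>Large enough for \<open>n powr e\<close> to exceed \<open>c\<close>, contrary to
    \<open>le\<close>.\<close>
  obtain n :: nat where n: "(\<bar>c\<bar> + 1) powr (1 / e) \<le> real n"
    using real_arch_simple by blast
  moreover have "0 < (\<bar>c\<bar> + 1) powr (1 / e)" by simp
  ultimately have "n \<ge> 1" by linarith
  have "\<bar>c\<bar> + 1 = ((\<bar>c\<bar> + 1) powr (1 / e)) powr e"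
    using e by (simp add: powr_powr)
  also have "\<dots> \<le> real n powr e"
    using n e by (intro powr_mono2) auto
  also have "\<dots> \<le> c"
    unfolding e_def by (rule le[OF \<open>n \<ge> 1\<close>])
  finally show False by simp
qed

lemma matmul_time_mono:
  assumes "matmul_time w" "w \<le> w'"
  shows "matmul_time w'"
proof -
  from assms(1) obtain P c where P: "\<And>n A B s. n \<ge> 1 \<Longrightarrow> A \<in> carrier_mat n n \<Longrightarrow> B \<in> carrier_mat n n \<Longrightarrow>
      reg s 0 = of_nat n \<Longrightarrow> stores_matrix (arr s 0) n A \<Longrightarrow> stores_matrix (arr s 1) n B \<Longrightarrow>
      runs_within P s (c * real n powr w) (\<lambda>s'. stores_matrix (arr s' 2) n (A * B))"
    unfolding matmul_time_def by blast
  have le: "c * real n powr w \<le> \<bar>c\<bar> * real n powr w'" if "n \<ge> 1" for n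
    using that assms(2) by (intro mult_mono powr_mono) auto
  show ?thesis
    unfolding matmul_time_def
  proof (rule exI[of _ P], rule exI[of _ "\<bar>c\<bar>"], intro allI impI, elim conjE)
    fix n :: nat and A B :: "rat mat" and s :: state
    assume "1 \<le> n" "A \<in> carrier_mat n n" "B \<in> carrier_mat n n" "reg s 0 = of_nat n"
      "stores_matrix (arr s 0) n A" "stores_matrix (arr s 1) n B"
    from P[OF this] le[OF \<open>1 \<le> n\<close>]
    show "runs_within P s (\<bar>c\<bar> * real n powr w') (\<lambda>s'. stores_matrix (arr s' 2) n (A * B))"
      unfolding runs_within_def by (meson order_trans)
  qed
qed

context ram
begin

text \<open>With the summation index in the outer loop, each round is a rank one update, which
  \<open>fill_matrix\<close> performs in place.\<close>

definition schoolbook :: prog where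
  "schoolbook = Seq (fill_matrix 6 2 (V 20 |*| V 6 |+| V 21) (K 0))
     (For 22 6 (fill_matrix 6 2 (V 20 |*| V 6 |+| V 21)
       (L 2 (V 20 |*| V 6 |+| V 21) |+| L 0 (V 20 |*| V 6 |+| V 22) |*| L 1 (V 22 |*| V 6 |+| V 21))))"

lemma hrun_schoolbook:
  assumes h: "reg h 6 = of_nat n" "n \<ge> 1"
    and post: "\<And>h'. (\<And>i j. i < n \<Longrightarrow> j < n \<Longrightarrow>
      arr h' 2 (i * n + j) = (\<Sum>l<n. arr h 0 (i * n + l) * arr h 1 (l * n + j))) \<Longrightarrow>
      chg {20, 21, 22} {2} h h' \<Longrightarrow> Q h'"
  shows "hrun schoolbook h (300 * (real n * real n * real n)) Q"
  unfolding schoolbook_def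
  apply (rule hrun_le)
   apply (rule hrun_Seq_exact[where U = "real n * (100 * (real n * real n) + 7) + 4"])
   apply (rule hrun_fill_matrix[where n = n and f = "\<lambda>i j. i * n + j" and g = "\<lambda>_ _. 0", OF _ _ _ _ _ order_refl])
        apply (use h in \<open>simp; fail\<close>)+
    apply (use index_inj in blast)
  subgoal premises p for h1 F
  proof (rule hrun_For[where n = n and T = "100 * (real n * real n)" and I = "\<lambda>c h'. chg {20, 21, 22} {2} h h' \<and>
      (\<forall>i<n. \<forall>j<n. arr h' 2 (i * n + j) = (\<Sum>l<c. arr h 0 (i * n + l) * arr h 1 (l * n + j)))"])
    show "chg {20, 21, 22} {2} h (set_reg 22 0 h1) \<and> (\<forall>i<n. \<forall>j<n. arr (set_reg 22 0 h1) 2 (i * n + j) =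
        (\<Sum>l<0. arr h 0 (i * n + l) * arr h 1 (l * n + j)))"
      using p by (auto simp: chg_def)
  next
    fix c :: nat and h' :: state
    assume c: "c < n" "reg h' 22 = of_nat c" "reg h' 6 = of_nat n"
      and I: "chg {20, 21, 22} {2} h h' \<and> (\<forall>i<n. \<forall>j<n. arr h' 2 (i * n + j) =
        (\<Sum>l<c. arr h 0 (i * n + l) * arr h 1 (l * n + j)))"
    have a: "arr h' 0 = arr h 0" "arr h' 1 = arr h 1" using I by (auto simp: chg_arr)
    show "hrun (fill_matrix 6 2 (V 20 |*| V 6 |+| V 21)
       (L 2 (V 20 |*| V 6 |+| V 21) |+| L 0 (V 20 |*| V 6 |+| V 22) |*| L 1 (V 22 |*| V 6 |+| V 21)))
      h' (100 * (real n * real n)) (\<lambda>h'. reg h' 22 = of_nat c \<and> reg h' 6 = of_nat n \<and>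
        chg {20, 21, 22} {2} h (set_reg 22 (of_nat (Suc c)) h') \<and>
        (\<forall>i<n. \<forall>j<n. arr (set_reg 22 (of_nat (Suc c)) h') 2 (i * n + j) =
          (\<Sum>l<Suc c. arr h 0 (i * n + l) * arr h 1 (l * n + j))))"
    proof (rule hrun_fill_matrix[where n = n and f = "\<lambda>i j. i * n + j" and
          g = "\<lambda>i j. arr h' 2 (i * n + j) + arr h 0 (i * n + c) * arr h 1 (c * n + j)"])
      fix i j i' j' assume "j < n" "j' < n" "i * n + j = i' * n + j'"
      then show "i = i' \<and> j = j'" using index_inj by blast
    qed (use c I a h in \<open>auto simp: chg_def\<close>)
  next
    fix h' :: state
    assume "chg {20, 21, 22} {2} h h' \<and> (\<forall>i<n. \<forall>j<n. arr h' 2 (i * n + j) =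
        (\<Sum>l<n. arr h 0 (i * n + l) * arr h 1 (l * n + j)))"
    then show "Q h'" using post by blast
  qed (use p h in auto)
  subgoal
  proof -
    have n2: "1 * real n \<le> real n * real n" "1 * 1 \<le> real n * real n"
      using h(2) by (intro mult_mono; simp)+
    moreover have "1 * (real n * real n) \<le> real n * (real n * real n)"
      using h(2) by (intro mult_right_mono) auto
    ultimately show ?thesis by (simp add: algebra_simps)
  qed
  done

definition get_reg :: "nat \<Rightarrow> nat \<Rightarrow> prog" where
  "get_reg z x = Seq (Const (B + 40) 0) (Arith z Add x (B + 40))"

lemma exec_get_reg:
  assumes "x < B + 40" "z < B + 40"
  shows "\<exists>s'. exec (get_reg z x) s 2 s' \<and> arr s' = arr s \<and> reg s' z = reg s x \<and>
    (\<forall>y<B + 40. y \<noteq> z \<longrightarrow> reg s' y = reg s y)"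
proof -
  let ?s = "set_reg (B + 40) 0 s"
  have "exec (get_reg z x) s (1 + 1) (set_reg z (apply_op Add (reg ?s x) (reg ?s (B + 40))) ?s)"
    unfolding get_reg_def by (rule exec.Seq[OF exec.Const exec.Arith])
  then show ?thesis using assms
    by (intro exI[of _ "set_reg z (apply_op Add (reg ?s x) (reg ?s (B + 40))) ?s"]) (auto simp: numeral_2_eq_2)
qed

end

text \<open>This makes the set in the definition of \<open>matmul_exponent\<close> nonempty, without
  which its infimum would carry no information.\<close>

lemma matmul_time_3: "matmul_time 3"
proof -
  define B :: nat where "B = 3"
  have B3: "B \<ge> 3" by (simp add: B_def)
  interpret ram B .
  define P where "P = Seq (get_reg (B + 6) 0) (Seq (Arith (B + 7) Mul (B + 6) (B + 6))
    (Seq (copy_array B 0 (B + 7)) (Seq (copy_array (B + 1) 1 (B + 7))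
    (Seq schoolbook (copy_array 2 (B + 2) (B + 7))))))"
  have "runs_within P s (400 * real n powr 3) (\<lambda>s'. stores_matrix (arr s' 2) n (A * C))"
    if n: "n \<ge> 1" and A: "A \<in> carrier_mat n n" and C: "C \<in> carrier_mat n n" and r: "reg s 0 = of_nat n"
      and sA: "stores_matrix (arr s 0) n A" and sC: "stores_matrix (arr s 1) n C" for n A C s
  proof -
    obtain s1 where 1: "exec (get_reg (B + 6) 0) s 2 s1" "arr s1 = arr s" "reg s1 (B + 6) = of_nat n"
      using exec_get_reg[of 0 "B + 6" s] r by auto
    let ?s2 = "set_reg (B + 7) (apply_op Mul (reg s1 (B + 6)) (reg s1 (B + 6))) s1"
    have r2: "reg ?s2 (B + 7) = of_nat (n * n)" "reg ?s2 (B + 6) = of_nat n" using 1 by simp_all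
    obtain t3 s3 where 3: "exec (copy_array B 0 (B + 7)) ?s2 t3 s3" "t3 \<le> 4 * (n * n) + 3"
      "arr s3 = (arr ?s2)(B := \<lambda>x. if x < n * n then arr ?s2 0 x else arr ?s2 B x)"
      "\<forall>x<B + 40. reg s3 x = reg ?s2 x"
      using exec_copy_array[OF r2(1), of 0 B] B3 by auto
    have r3: "reg s3 (B + 7) = of_nat (n * n)" "reg s3 (B + 6) = of_nat n" using 3(4) r2 by auto
    obtain t4 s4 where 4: "exec (copy_array (B + 1) 1 (B + 7)) s3 t4 s4" "t4 \<le> 4 * (n * n) + 3"
      "arr s4 = (arr s3)(B + 1 := \<lambda>x. if x < n * n then arr s3 1 x else arr s3 (B + 1) x)"
      "\<forall>x<B + 40. reg s4 x = reg s3 x"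
      using exec_copy_array[OF r3(1), of 1 "B + 1"] B3 by auto
    define h where "h = \<lparr>reg = \<lambda>x. reg s4 (B + x), arr = \<lambda>y. arr s4 (B + y)\<rparr>"
    have sim: "sim s4 h" by (simp add: sim_def h_def)
    have h6: "reg h 6 = of_nat n" "reg h 7 = of_nat (n * n)" using 4(4) r3 by (simp_all add: h_def)
    have hA: "arr h 0 (i * n + j) = A $$ (i, j)" "arr h 1 (i * n + j) = C $$ (i, j)" if "i < n" "j < n" for i j
      using sA sC that index_less[OF that] B3 by (simp_all add: h_def 4(3) 3(3) 1(2) stores_matrix_def)
    have "hrun schoolbook h (300 * (real n * real n * real n)) (\<lambda>h'. (\<forall>i<n. \<forall>j<n.
        arr h' 2 (i * n + j) = (A * C) $$ (i, j)) \<and> reg h' 7 = of_nat (n * n))"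
    proof (rule hrun_schoolbook[OF h6(1) n])
      fix h' assume h': "\<And>i j. i < n \<Longrightarrow> j < n \<Longrightarrow>
        arr h' 2 (i * n + j) = (\<Sum>l<n. arr h 0 (i * n + l) * arr h 1 (l * n + j))" "chg {20, 21, 22} {2} h h'"
      have "arr h' 2 (i * n + j) = (A * C) $$ (i, j)" if "i < n" "j < n" for i j
        using h'(1)[OF that] that A C hA by (simp add: scalar_prod_def lessThan_atLeast0)
      then show "(\<forall>i<n. \<forall>j<n. arr h' 2 (i * n + j) = (A * C) $$ (i, j)) \<and> reg h' 7 = of_nat (n * n)"
        using h'(2) h6 by (simp add: chg_reg)
    qed
    then obtain t5 s5 h5 where 5: "exec schoolbook s4 t5 s5" "real t5 \<le> 300 * (real n * real n * real n)"
      "sim s5 h5" "\<forall>i<n. \<forall>j<n. arr h5 2 (i * n + j) = (A * C) $$ (i, j)" "reg h5 7 = of_nat (n * n)"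
      using sim unfolding hrun_def by blast
    have r5: "reg s5 (B + 7) = of_nat (n * n)" using 5(3,5) by (simp add: sim_def)
    have a5: "arr s5 (B + 2) = arr h5 2" using 5(3) unfolding sim_def by blast
    obtain t6 s6 where 6: "exec (copy_array 2 (B + 2) (B + 7)) s5 t6 s6" "t6 \<le> 4 * (n * n) + 3"
      "arr s6 = (arr s5)(2 := \<lambda>x. if x < n * n then arr s5 (B + 2) x else arr s5 2 x)"
      using exec_copy_array[OF r5, of "B + 2" 2] B3 by auto
    have e: "exec P s (2 + (1 + (t3 + (t4 + (t5 + t6))))) s6"
      unfolding P_def
      by (rule exec.Seq[OF 1(1) exec.Seq[OF exec.Arith exec.Seq[OF 3(1) exec.Seq[OF 4(1) exec.Seq[OF 5(1) 6(1)]]]]])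
    have "stores_matrix (arr s6 2) n (A * C)"
      using 5(4) index_less by (simp add: stores_matrix_def 6(3) a5 del: add_2_eq_Suc')
    moreover have "real (2 + (1 + (t3 + (t4 + (t5 + t6))))) \<le> 400 * real n powr 3"
    proof -
      have "1 * (real n * real n) \<le> real n * (real n * real n)" "1 * 1 \<le> real n * real n"
        using n by (intro mult_mono; simp)+
      moreover have "real n powr 3 = real n * (real n * real n)"
        using n by (simp add: powr_numeral power3_eq_cube)
      moreover have "real t3 \<le> 4 * (real n * real n) + 3" "real t4 \<le> 4 * (real n * real n) + 3"
        "real t6 \<le> 4 * (real n * real n) + 3"
        using 3(2) 4(2) 6(2) of_nat_mono[where ?'a = real] by fastforce+
      ultimately show ?thesis using 5(2) by (simp add: mult.assoc)
    qed
    ultimately show ?thesis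
      using e unfolding runs_within_def by blast
  qed
  then show ?thesis
    unfolding matmul_time_def by (intro exI[of _ P] exI[of _ 400]) blast
qed

text \<open>A \<open>w\<close> above the infimum exceeds some admissible exponent, and admissibility
  is upward closed by \<open>matmul_time_mono\<close>.\<close>

lemma matmul_time_exponent:
  assumes "w > matmul_exponent \<or> (w = matmul_exponent \<and> matmul_time matmul_exponent)"
  shows "matmul_time w"
proof (cases "w > matmul_exponent")
  case True
  have "{w. matmul_time w} \<noteq> {}" using matmul_time_3 by blast
  then obtain w' where "matmul_time w'" "w' < w"
    using cInf_lessD[of "{w. matmul_time w}" w] True unfolding matmul_exponent_def by auto
  then show ?thesis using matmul_time_mono[of w' w] by simp
qed (use assms in auto)

section \<open>The complete program and the theorem\<close>

context matmul_ram
begin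

definition full_prog :: prog where
  "full_prog = Seq (get_reg B 0) (Seq (get_reg (B + 1) 1) (Seq (get_reg (B + 2) 2)
     (Seq (Arith (B + 3) Mul (B + 2) B) (Seq (copy_array B 0 (B + 3))
     (Seq main_prog (Seq (copy_array 1 (B + 1) (B + 38)) (get_reg 0 (B + 5))))))))"

lemma full_prog_correct:
  fixes xs :: "nat list list"
  assumes kr: "k \<ge> 1" "r \<ge> 1"
    and xs: "distinct xs" "\<And>x. x \<in> set xs \<Longrightarrow> length x = k"
    and s: "reg s 0 = of_nat k" "reg s 1 = of_nat r" "reg s 2 = of_nat (length xs)" "stores_tuples (arr s 0) k xs"
  shows "runs_within full_prog s ((run_const + 50) * (max 1 (real (length xs)) * real (r ^ k) powr (w - 1) * real k))
    (\<lambda>s'. \<exists>R'. output_set s' k R' \<and> R' \<subseteq> set xs \<and> card R' \<le> r ^ k \<and> represents k (r - 1) R' (set xs))"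
proof -
  let ?m = "length xs"
  obtain s1 where 1: "exec (get_reg B 0) s 2 s1" "arr s1 = arr s" "reg s1 B = of_nat k"
    "\<forall>y<B + 40. y \<noteq> B \<longrightarrow> reg s1 y = reg s y"
    using exec_get_reg[of 0 B s] s by auto
  have r1: "reg s1 1 = of_nat r" "reg s1 2 = of_nat ?m" using 1(4) s B_ge by auto
  obtain s2 where 2: "exec (get_reg (B + 1) 1) s1 2 s2" "arr s2 = arr s1" "reg s2 (B + 1) = of_nat r"
    "\<forall>y<B + 40. y \<noteq> B + 1 \<longrightarrow> reg s2 y = reg s1 y"
    using exec_get_reg[of 1 "B + 1" s1] r1 by auto
  have r2: "reg s2 B = of_nat k" "reg s2 2 = of_nat ?m" using 2(4) r1 1(3) B_ge by auto
  obtain s3 where 3: "exec (get_reg (B + 2) 2) s2 2 s3" "arr s3 = arr s2" "reg s3 (B + 2) = of_nat ?m"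
    "\<forall>y<B + 40. y \<noteq> B + 2 \<longrightarrow> reg s3 y = reg s2 y"
    using exec_get_reg[of 2 "B + 2" s2] r2 by auto
  let ?s4 = "set_reg (B + 3) (apply_op Mul (reg s3 (B + 2)) (reg s3 B)) s3"
  have r4: "reg ?s4 B = of_nat k" "reg ?s4 (B + 1) = of_nat r" "reg ?s4 (B + 2) = of_nat ?m"
    "reg ?s4 (B + 3) = of_nat (?m * k)" "arr ?s4 = arr s"
    using 1 2 3 r2 by auto
  obtain t5 s5 where 5: "exec (copy_array B 0 (B + 3)) ?s4 t5 s5" "t5 \<le> 4 * (?m * k) + 3"
    "arr s5 = (arr ?s4)(B := \<lambda>x. if x < ?m * k then arr ?s4 0 x else arr ?s4 B x)"
    "\<forall>x<B + 40. reg s5 x = reg ?s4 x"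
    using exec_copy_array[OF r4(4), of 0 B] B_ge by auto
  define h where "h = \<lparr>reg = \<lambda>x. reg s5 (B + x), arr = \<lambda>y. arr s5 (B + y)\<rparr>"
  have sim: "sim s5 h" by (simp add: sim_def h_def)
  have hr: "reg h 0 = of_nat k" "reg h 1 = of_nat r" "reg h 2 = of_nat ?m" "reg h 3 = of_nat (?m * k)"
    using 5(4) r4 by (simp_all add: h_def)
  have ha: "stores_tuples (arr h 0) k xs"
    using s(4) index_less by (simp add: stores_tuples_def h_def 5(3) 1(2) 2(2) 3(2))
  let ?Z = "max 1 (real ?m) * real (r ^ k) powr (w - 1) * real k"
  from hrun_main[OF hr kr ha xs(2)] sim obtain t6 s6 h6 where
    6: "exec main_prog s5 t6 s6" "real t6 \<le> run_const * ?Z" "sim s6 h6" "chosen k r xs h h6"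
      "reg h6 38 = reg h6 5 * of_nat k"
    unfolding hrun_def by blast
  obtain P where P: "selected k P (arr h 0) ?m h6" "card {j. j < ?m \<and> P j} \<le> r ^ k"
    "represents k (r - 1) ((!) xs ` {j. j < ?m \<and> P j}) (set xs)"
    using 6(4) unfolding chosen_def by blast
  define js where "js = filter P [0..<?m]"
  have js: "set js = {j. j < ?m \<and> P j}" "distinct js" "length js \<le> ?m"
    using length_filter_le[of P "[0..<?m]"] by (auto simp: js_def)
  have r6: "reg s6 (B + 38) = of_nat (length js * k)" "reg s6 (B + 5) = of_nat (length js)"
    using 6(3,5) P(1) by (simp_all add: sim_def selected_def js_def)
  have a6: "arr s6 (B + 1) (q * k + t) = of_nat (xs ! (js ! q) ! t)" if "q < length js" "t < k" for q t
  proof -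
    have "js ! q \<in> set js" using that(1) by simp
    then have "js ! q < ?m" by (simp add: js(1))
    moreover have "arr h6 1 (q * k + t) = arr h 0 (js ! q * k + t)"
      using P(1) that unfolding selected_def js_def[symmetric] by simp
    moreover have "arr s6 (B + 1) = arr h6 1" using 6(3) unfolding sim_def by blast
    ultimately show ?thesis using ha that(2) by (simp add: stores_tuples_def)
  qed
  obtain t7 s7 where 7: "exec (copy_array 1 (B + 1) (B + 38)) s6 t7 s7" "t7 \<le> 4 * (length js * k) + 3"
    "arr s7 = (arr s6)(1 := \<lambda>x. if x < length js * k then arr s6 (B + 1) x else arr s6 1 x)"
    "\<forall>x<B + 40. reg s7 x = reg s6 x"
    using exec_copy_array[OF r6(1), of "B + 1" 1] B_ge by auto
  obtain s8 where 8: "exec (get_reg 0 (B + 5)) s7 2 s8" "arr s8 = arr s7" "reg s8 0 = of_nat (length js)"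
    using exec_get_reg[of "B + 5" 0 s7] 7(4) r6 by auto
  have e: "exec full_prog s (2 + (2 + (2 + (1 + (t5 + (t6 + (t7 + 2))))))) s8"
    unfolding full_prog_def
    by (rule exec.Seq[OF 1(1) exec.Seq[OF 2(1) exec.Seq[OF 3(1) exec.Seq[OF exec.Arith exec.Seq[OF 5(1)
            exec.Seq[OF 6(1) exec.Seq[OF 7(1) 8(1)]]]]]]])
  define ys where "ys = map ((!) xs) js"
  have "inj_on ((!) xs) (set js)"
    using xs(1) js(1) by (auto intro!: inj_on_nth)
  then have "distinct ys"
    using js(2) by (simp add: ys_def distinct_map)
  moreover have sub: "set ys \<subseteq> set xs" by (auto simp: ys_def js(1))
  moreover have "set ys \<subseteq> {a. length a = k}" using sub xs(2) by auto
  moreover have "stores_tuples (arr s8 1) k ys"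
    using a6 index_less by (simp add: stores_tuples_def ys_def 8(2) 7(3))
  ultimately have "output_set s8 k (set ys)"
    using 8(3) unfolding output_set_def by (intro exI[of _ ys]) (simp add: ys_def)
  moreover have ys: "set ys = (!) xs ` {j. j < ?m \<and> P j}" by (simp add: ys_def js(1))
  moreover have "card (set ys) \<le> r ^ k"
    unfolding ys using P(2) card_image_le[of "{j. j < ?m \<and> P j}" "(!) xs"] by simp
  ultimately have "\<exists>R'. output_set s8 k R' \<and> R' \<subseteq> set xs \<and> card R' \<le> r ^ k \<and> represents k (r - 1) R' (set xs)"
    using sub P(3) by metis
  moreover have "real (2 + (2 + (2 + (1 + (t5 + (t6 + (t7 + 2))))))) \<le> (run_const + 50) * ?Z"
  proof -
    have p1: "1 \<le> real (r ^ k) powr (w - 1)"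
      using kr(2) w_ge by (intro ge_one_powr_ge_zero) simp_all
    have Z: "max 1 (real ?m) * 1 * real k \<le> ?Z"
      using p1 by (intro mult_right_mono mult_left_mono) auto
    have "real ?m * real k \<le> max 1 (real ?m) * 1 * real k" "1 * real k \<le> max 1 (real ?m) * 1 * real k"
      by (intro mult_right_mono; simp)+
    moreover have "1 \<le> 1 * real k" using kr(1) by simp
    ultimately have mk: "real ?m * real k \<le> ?Z" "1 \<le> ?Z" using Z by linarith+
    have "length js * k \<le> ?m * k" using js(3) by simp
    then have "t7 \<le> 4 * (?m * k) + 3" using 7(2) by linarith
    from of_nat_mono[OF this, where ?'a = real] of_nat_mono[OF 5(2), where ?'a = real]
    have "real t7 \<le> 4 * (real ?m * real k) + 3" "real t5 \<le> 4 * (real ?m * real k) + 3" by simp_all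
    then show ?thesis using 6(2) mk by (simp add: distrib_right)
  qed
  ultimately show ?thesis
    using e unfolding runs_within_def by blast
qed

end

(* A bound O(n^omega) for matrix multiplication may hold only up to arbitrarily small additions to
   the exponent, omega being an infimum: w is omega itself if n x n matrices can be multiplied in
   time O(n^omega), or any real above omega. The maximum with 1 matters for R = {} only. *)
theorem theorem3p6:
  fixes w :: real
  assumes "w > matmul_exponent \<or> (w = matmul_exponent \<and> matmul_time matmul_exponent)"
  shows "\<exists>P. \<exists>c::real. \<forall>(k::nat) (r::nat) (M :: nat \<Rightarrow> matroid) (U :: nat \<Rightarrow> nat set) R s.
    k \<ge> 1 \<and> r \<ge> 1 \<and>
    (\<forall>i<k. finite (U i) \<and> M i = uniform_matroid r (U i)) \<and>
    R \<subseteq> listset (map (\<lambda>i. universe (M i)) [0..<k]) \<and>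
    input_set s k r R \<longrightarrow>
    runs_within P s
      (c * max 1 (real (card R)) * real r powr (real k * (w - 1)) * real k)
      (\<lambda>s'. \<exists>R'. output_set s' k R' \<and> R' \<subseteq> R \<and> card R' \<le> r ^ k \<and> represents k (r - 1) R' R)"
proof -
  have w: "matmul_time w" by (rule matmul_time_exponent[OF assms])
  then obtain MM cM where MM: "\<And>n A C s. n \<ge> 1 \<Longrightarrow> A \<in> carrier_mat n n \<Longrightarrow> C \<in> carrier_mat n n \<Longrightarrow>
      reg s 0 = of_nat n \<Longrightarrow> stores_matrix (arr s 0) n A \<Longrightarrow> stores_matrix (arr s 1) n C \<Longrightarrow>
      runs_within MM s (cM * real n powr w) (\<lambda>s'. stores_matrix (arr s' 2) n (A * C))"
    unfolding matmul_time_def by blast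
  \<comment> \<open>This base puts the simulated memory above everything that \<open>MM\<close>
    writes and above its three interface arrays.\<close>
  interpret matmul_ram "max 3 (prog_bound MM)" MM cM w
    by unfold_locales (use MM matmul_time_ge_2[OF w] in auto)
  have length_listset: "length x = length Xs" if "x \<in> listset Xs" for x :: "nat list" and Xs
    using that by (induction Xs arbitrary: x) (auto simp: set_Cons_def)
  show ?thesis
  proof (rule exI[of _ full_prog], rule exI[of _ "run_const + 50"], intro allI impI, elim conjE)
    fix k r :: nat and M :: "nat \<Rightarrow> matroid" and U :: "nat \<Rightarrow> nat set" and R and s :: state
    assume kr: "1 \<le> k" "1 \<le> r" and R: "R \<subseteq> listset (map (\<lambda>i. universe (M i)) [0..<k])"
      and "input_set s k r R"
    then obtain xs where xs: "distinct xs" "set xs = R" "reg s 0 = of_nat k" "reg s 1 = of_nat r"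
      "reg s 2 = of_nat (length xs)" "stores_tuples (arr s 0) k xs"
      unfolding input_set_def by blast
    have len: "length x = k" if "x \<in> set xs" for x
      using length_listset[of x "map (\<lambda>i. universe (M i)) [0..<k]"] that R xs(2) by auto
    have "real r powr (real k * (w - 1)) = real (r ^ k) powr (w - 1)"
      using kr by (simp add: powr_powr[symmetric] powr_realpow)
    moreover have "card R = length xs" using xs(1,2) distinct_card by blast
    ultimately show "runs_within full_prog s
      ((run_const + 50) * max 1 (real (card R)) * real r powr (real k * (w - 1)) * real k)
      (\<lambda>s'. \<exists>R'. output_set s' k R' \<and> R' \<subseteq> R \<and> card R' \<le> r ^ k \<and> represents k (r - 1) R' R)"
      using full_prog_correct[OF kr xs(1) len xs(3-6)] xs(2) by (simp add: mult.assoc)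
  qed
qed

end
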